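(* Let $m,n\ge1$ be integers, let $A$ be a real $m\times n$ matrix, let $\psi:(0,\infty)\to(0,\infty)$ be non-increasing and dyadically regular (i.e. there exist $\varrho\in(0,1)$ and an integer $k_0\ge0$ with $\psi(2^{k+1})\le\varrho\,\psi(2^k)$ for all $k\ge k_0$), and let $0<s<m$. Then \[ \mathcal H^s(W_A(\psi))= \begin{cases} 0 & \text{if } \displaystyle\sum_{k=0}^{\infty}\frac{2^{kn}\psi(2^k)^s}{N_A(\psi(2^k),2^k)}<\infty,\\[8pt] \infty & \text{if } \displaystyle\sum_{k=0}^{\infty}\frac{2^{kn}\psi(2^k)^s}{N_A(\psi(2^k)^{s/m},2^k)}=\infty. \end{cases} \] (These are two separate implications; the two conditions need not be complementary.)
   Context: Norms $|\cdot|$ are supremum norms; $\mathbb T^m=\mathbb R^m/\mathbb Z^m$ with the induced metric; $|\mathbf x|_{\mathbb Z^m}:=\min_{\mathbf p\in\mathbb Z^m}|\mathbf x-\mathbf p|$; $\mathcal H^s$ is $s$-dimensional Hausdorff measure on $\mathbb T^m$. $W_A(\psi)$ is the set of $\mathbf b\in\mathbb T^m$ such that $|A\mathbf q-\mathbf b|_{\mathbb Z^m}<\psi(|\mathbf q|)$ holds for infinitely many distinct $\mathbf q\in\mathbb Z^n\setminus\{\mathbf 0\}$. For $r,T>0$, $N_A(r,T):=\#\{(\mathbf p,\mathbf q)\in\mathbb Z^m\times\mathbb Z^n: |A\mathbf q-\mathbf p|\le r,\ |\mathbf q|\le T\}$. *)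

theory Defs
  imports "HOL-Analysis.Analysis"
begin

text \<open>The supremum norm on \<open>real ^ 'n\<close> is the library's \<^const>\<open>infnorm\<close>
  (\<^const>\<open>norm\<close> is Euclidean there). The lattice of integer vectors is kept as a subset
  of \<open>real ^ 'n\<close>.\<close>

definition int_vecs :: "(real ^ 'n) set" where
  "int_vecs = {x. \<forall>i. x $ i \<in> \<int>}"

lemma int_vecs_0 [simp]: "0 \<in> int_vecs"
  by (simp add: int_vecs_def)

lemma int_vecs_add: "x \<in> int_vecs \<Longrightarrow> y \<in> int_vecs \<Longrightarrow> x + y \<in> int_vecs"
  by (simp add: int_vecs_def)

lemma int_vecs_minus: "x \<in> int_vecs \<Longrightarrow> - x \<in> int_vecs"
  by (simp add: int_vecs_def)

lemma int_vecs_diff: "x \<in> int_vecs \<Longrightarrow> y \<in> int_vecs \<Longrightarrow> x - y \<in> int_vecs"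
  by (simp add: int_vecs_def)

text \<open>The distance to the integer lattice; by \<open>lattice_norm_attained\<close> the infimum
  is a minimum.\<close>

definition lattice_norm :: "real ^ 'm \<Rightarrow> real" where
  "lattice_norm x = (INF p\<in>int_vecs. infnorm (x - p))"

lemma lattice_norm_attained:
  fixes x :: "real ^ 'm"
  obtains p where "p \<in> int_vecs" "lattice_norm x = infnorm (x - p)"
    "\<And>q. q \<in> int_vecs \<Longrightarrow> infnorm (x - p) \<le> infnorm (x - q)"
proof -
  define p :: "real ^ 'm" where "p = (\<chi> i. of_int (round (x $ i)))"
  have p: "p \<in> int_vecs"
    by (simp add: p_def int_vecs_def)
  have min: "infnorm (x - p) \<le> infnorm (x - q)" if q: "q \<in> int_vecs" for q
  proof -
    have "\<bar>(x - p) $ i\<bar> \<le> infnorm (x - q)" for i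
    proof -
      from q obtain m where "q $ i = of_int m"
        by (auto simp: int_vecs_def Ints_def)
      then have "\<bar>(x - p) $ i\<bar> \<le> \<bar>(x - q) $ i\<bar>"
        using round_diff_minimal[of "x $ i" m] by (simp add: p_def)
      also have "\<dots> \<le> infnorm (x - q)"
        by (rule component_le_infnorm_cart)
      finally show ?thesis .
    qed
    then show ?thesis
      unfolding infnorm_cart[of "x - p"] by (intro cSup_least) auto
  qed
  have eq: "lattice_norm x = infnorm (x - p)"
    unfolding lattice_norm_def using p min by (intro cInf_eq_minimum) auto
  show ?thesis
    by (rule that[OF p eq min])
qed

lemma lattice_norm_le: "p \<in> int_vecs \<Longrightarrow> lattice_norm x \<le> infnorm (x - p)"
  by (rule lattice_norm_attained[of x]) simp

lemma lattice_norm_eq_0_iff: "lattice_norm x = 0 \<longleftrightarrow> x \<in> int_vecs"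
proof
  assume 0: "lattice_norm x = 0"
  obtain p where "p \<in> int_vecs" "lattice_norm x = infnorm (x - p)"
    by (rule lattice_norm_attained)
  with 0 show "x \<in> int_vecs"
    by (simp add: infnorm_eq_0)
next
  assume "x \<in> int_vecs"
  then have "lattice_norm x \<le> 0"
    using lattice_norm_le[of x x] by (simp add: infnorm_0)
  moreover have "0 \<le> lattice_norm x"
    by (rule lattice_norm_attained[of x]) (simp add: infnorm_pos_le)
  ultimately show "lattice_norm x = 0"
    by simp
qed

lemma lattice_norm_minus: "lattice_norm (- x) = lattice_norm x"
proof -
  have "lattice_norm (- x) \<le> lattice_norm x" for x :: "real ^ 'm"
  proof -
    obtain p where p: "p \<in> int_vecs" "lattice_norm x = infnorm (x - p)"
      by (rule lattice_norm_attained)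
    have "lattice_norm (- x) \<le> infnorm (- x - - p)"
      by (intro lattice_norm_le int_vecs_minus p)
    also have "\<dots> = infnorm (x - p)"
      using infnorm_neg[of "x - p"] by simp
    finally show ?thesis
      using p by simp
  qed
  from this[of x] this[of "- x"] show ?thesis
    by simp
qed

lemma lattice_norm_triangle: "lattice_norm (x + y) \<le> lattice_norm x + lattice_norm y"
proof -
  obtain p where p: "p \<in> int_vecs" "lattice_norm x = infnorm (x - p)"
    by (rule lattice_norm_attained)
  obtain q where q: "q \<in> int_vecs" "lattice_norm y = infnorm (y - q)"
    by (rule lattice_norm_attained)
  have "lattice_norm (x + y) \<le> infnorm (x + y - (p + q))"
    by (intro lattice_norm_le int_vecs_add p q)
  also have "\<dots> = infnorm ((x - p) + (y - q))"
    by (simp add: algebra_simps)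
  also have "\<dots> \<le> infnorm (x - p) + infnorm (y - q)"
    by (rule infnorm_triangle)
  finally show ?thesis
    using p q by simp
qed

lemma lattice_norm_add_int_vec: "p \<in> int_vecs \<Longrightarrow> lattice_norm (x + p) = lattice_norm x"
  using lattice_norm_triangle[of x p] lattice_norm_triangle[of "x + p" "- p"]
  by (simp add: lattice_norm_minus lattice_norm_eq_0_iff[THEN iffD2])


text \<open>The torus \<open>\<real>\<^sup>m / \<int>\<^sup>m\<close>, with \<open>m = CARD('m)\<close>.\<close>

quotient_type 'm torus = "real ^ ('m::finite)" / "\<lambda>x y. x - y \<in> int_vecs"
  morphisms rep_torus to_torus
proof (rule equivpI)
  show "reflp (\<lambda>x y :: real ^ 'm. x - y \<in> int_vecs)"
    by (simp add: reflp_def)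
  show "symp (\<lambda>x y :: real ^ 'm. x - y \<in> int_vecs)"
    using int_vecs_minus by (fastforce intro: sympI)
  show "transp (\<lambda>x y :: real ^ 'm. x - y \<in> int_vecs)"
  proof (rule transpI)
    fix x y z :: "real ^ 'm"
    assume "x - y \<in> int_vecs" "y - z \<in> int_vecs"
    from int_vecs_add[OF this] show "x - z \<in> int_vecs"
      by simp
  qed
qed

instantiation torus :: (finite) metric_space
begin

lift_definition dist_torus :: "'a torus \<Rightarrow> 'a torus \<Rightarrow> real"
  is "\<lambda>x y. lattice_norm (x - y)"
proof -
  fix x x' y y' :: "real ^ 'a"
  assume "x - x' \<in> int_vecs" "y - y' \<in> int_vecs"
  from lattice_norm_add_int_vec[OF int_vecs_diff[OF this]]
  have "lattice_norm ((x' - y') + ((x - x') - (y - y'))) = lattice_norm (x' - y')" .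
  then show "lattice_norm (x - y) = lattice_norm (x' - y')"
    by (simp add: algebra_simps)
qed

definition uniformity_torus :: "('a torus \<times> 'a torus) filter" where
  "uniformity_torus = (INF e\<in>{0 <..}. principal {(x, y). dist x y < e})"

definition open_torus :: "'a torus set \<Rightarrow> bool" where
  "open_torus U = (\<forall>x\<in>U. eventually (\<lambda>(x', y). x' = x \<longrightarrow> y \<in> U) uniformity)"

instance
proof
  fix x y z :: "'a torus"
  show "dist x y = 0 \<longleftrightarrow> x = y"
    by transfer (simp add: lattice_norm_eq_0_iff)
  show "dist x y \<le> dist x z + dist y z"
  proof (transfer)
    fix x y z :: "real ^ 'a"
    have "lattice_norm ((x - z) + (z - y)) \<le> lattice_norm (x - z) + lattice_norm (z - y)"
      by (rule lattice_norm_triangle)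
    moreover have "lattice_norm (z - y) = lattice_norm (y - z)"
      using lattice_norm_minus[of "y - z"] by simp
    ultimately show "lattice_norm (x - y) \<le> lattice_norm (x - z) + lattice_norm (y - z)"
      by simp
  qed
qed (simp_all add: uniformity_torus_def open_torus_def)

end

lemma dist_to_torus: "dist (to_torus x) (to_torus y) = lattice_norm (x - y)"
  by transfer simp


text \<open>The \<open>s\<close>-dimensional Hausdorff (outer) measure on a metric space, for \<open>s > 0\<close>.
  Covering sets may be empty (\<open>0 powr s = 0\<close>), so finite covers are included; they are required to be
  bounded because \<^const>\<open>diameter\<close> is only meaningful for bounded sets. No normalising
  constant is used.\<close>

definition hausdorff_content :: "real \<Rightarrow> real \<Rightarrow> 'a::metric_space set \<Rightarrow> ennreal" where
  "hausdorff_content \<delta> s E =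
     (INF U\<in>{U :: nat \<Rightarrow> 'a set. E \<subseteq> (\<Union>i. U i) \<and> (\<forall>i. bounded (U i) \<and> diameter (U i) \<le> \<delta>)}.
        \<Sum>i. ennreal (diameter (U i) powr s))"

definition hausdorff_measure :: "real \<Rightarrow> 'a::metric_space set \<Rightarrow> ennreal" where
  "hausdorff_measure s E = (SUP \<delta>\<in>{0<..}. hausdorff_content \<delta> s E)"


definition inhom_approx_set :: "real ^ 'n ^ 'm \<Rightarrow> (real \<Rightarrow> real) \<Rightarrow> 'm torus set" where
  "inhom_approx_set A \<psi> = to_torus `
     {b. infinite {q \<in> int_vecs - {0}. lattice_norm (A *v q - b) < \<psi> (infnorm q)}}"

text \<open>The condition does not depend on the chosen representative.\<close>

lemma to_torus_in_inhom_approx_set_iff: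
  "to_torus b \<in> inhom_approx_set A \<psi> \<longleftrightarrow>
     infinite {q \<in> int_vecs - {0}. lattice_norm (A *v q - b) < \<psi> (infnorm q)}"
proof
  assume "to_torus b \<in> inhom_approx_set A \<psi>"
  then obtain b' where b': "to_torus b = to_torus b'"
    and inf: "infinite {q \<in> int_vecs - {0}. lattice_norm (A *v q - b') < \<psi> (infnorm q)}"
    unfolding inhom_approx_set_def by blast
  have "lattice_norm (A *v q - b) = lattice_norm (A *v q - b')" for q
    by (metis b' dist_to_torus)
  with inf show "infinite {q \<in> int_vecs - {0}. lattice_norm (A *v q - b) < \<psi> (infnorm q)}"
    by presburger
qed (unfold inhom_approx_set_def, blast)

definition lattice_count :: "real ^ 'n ^ 'm \<Rightarrow> real \<Rightarrow> real \<Rightarrow> nat" where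
  "lattice_count A r T =
     card {(p, q). p \<in> int_vecs \<and> q \<in> int_vecs \<and> infnorm (A *v q - p) \<le> r \<and> infnorm q \<le> T}"

definition dyadically_regular :: "(real \<Rightarrow> real) \<Rightarrow> bool" where
  "dyadically_regular \<psi> \<longleftrightarrow>
     (\<exists>\<rho>\<in>{0<..<1}. \<exists>k0::nat. \<forall>k\<ge>k0. \<psi> (2 ^ (k + 1)) \<le> \<rho> * \<psi> (2 ^ k))"

lemma finite_int_vecs_bounded: "finite {x \<in> int_vecs. infnorm (x :: real ^ 'n) \<le> R}"
proof -
  let ?S = "{x \<in> int_vecs. infnorm (x :: real ^ 'n) \<le> R}"
  let ?B = "of_int ` {- \<lceil>R\<rceil>..\<lceil>R\<rceil>} :: real set"
  have "finite {f :: 'n \<Rightarrow> real. \<forall>i. (i \<in> UNIV \<longrightarrow> f i \<in> ?B) \<and> (i \<notin> UNIV \<longrightarrow> f i = 0)}"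
    by (intro finite_set_of_finite_funs) auto
  moreover have "vec_nth ` ?S \<subseteq>
      {f :: 'n \<Rightarrow> real. \<forall>i. (i \<in> UNIV \<longrightarrow> f i \<in> ?B) \<and> (i \<notin> UNIV \<longrightarrow> f i = 0)}"
  proof -
    have "x $ i \<in> ?B" if x: "x \<in> ?S" for x i
    proof -
      from x obtain m where m: "x $ i = of_int m"
        by (auto simp: int_vecs_def Ints_def)
      have "\<bar>x $ i\<bar> \<le> R"
        using component_le_infnorm_cart[of x i] x by auto
      with m have "m \<in> {- \<lceil>R\<rceil>..\<lceil>R\<rceil>}"
        by (auto simp: abs_le_iff) linarith+
      with m show ?thesis by blast
    qed
    then show ?thesis by blast
  qed
  ultimately have "finite (vec_nth ` ?S)"
    by (rule rev_finite_subset)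
  then show ?thesis
    by (rule finite_imageD) (simp add: inj_on_def vec_nth_inject)
qed

text \<open>The set counted by \<open>lattice_count\<close> is always finite.\<close>

lemma finite_lattice_count:
  fixes A :: "real ^ 'n ^ 'm"
  shows "finite {(p, q). p \<in> int_vecs \<and> q \<in> int_vecs \<and> infnorm (A *v q - p) \<le> r \<and> infnorm q \<le> T}"
proof -
  let ?Q = "{q \<in> int_vecs. infnorm (q :: real ^ 'n) \<le> T}"
  let ?P = "\<lambda>q. {p \<in> int_vecs. infnorm p \<le> r + infnorm (A *v q)}"
  have "finite ((\<lambda>(q, p). (p, q)) ` Sigma ?Q ?P)"
    by (intro finite_imageI finite_SigmaI finite_int_vecs_bounded)
  moreover have "infnorm p \<le> r + infnorm (A *v q)" if "infnorm (A *v q - p) \<le> r" for p q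
    using that infnorm_triangle[of "p - A *v q" "A *v q"] infnorm_sub[of p "A *v q"] by simp
  ultimately show ?thesis
    by - (erule rev_finite_subset, auto simp: image_iff)
qed

end

theory Submission
  imports Defs "HOL-Probability.Probability_Mass_Function"
begin

text \<open>Write \<open>n(r, T)\<close> for the number of integer vectors \<open>q\<close> with \<open>|q| \<le> T\<close> and \<open>\<parallel>A q\<parallel> \<le> r\<close>.
  The orbit points \<open>A q\<close>, \<open>|q| \<le> T\<close>, behave like an approximate subgroup of the torus: by pigeonhole the
  density \<open>r\<^sup>m T\<^sup>n / n(r, T)\<close> is, up to constants, the volume of their \<open>r\<close>-neighbourhood. Covering the orbit
  by about \<open>T\<^sup>n / n(r, T)\<close> balls of radius \<open>r\<close> gives the convergence half.

  For the divergence half, put the mass \<open>\<psi>(2\<^sup>k)\<^sup>s / n(\<psi>(2\<^sup>k)\<^bsup>s/m\<^esup>, 2\<^sup>k)\<close> on a ball of radius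
  comparable to \<open>\<psi>(2\<^sup>k)\<close> around each orbit point of level \<open>k\<close> and sum over a finite block of levels whose total mass
  \<open>L\<close> is huge. A ball of radius \<open>r\<close> then has mass at most a constant times \<open>L r\<^sup>m + r\<^sup>s\<close>. The critical levels are those
  at which the \<open>r\<close>-neighbourhood of the orbit is not yet the whole torus; there the multiples of a neighbourhood of
  the orbit must keep growing, since otherwise they would form a proper open subgroup of the torus, and this forces
  the masses to be dominated by a geometric series. Since \<open>L\<close> is arbitrary, such measures can be nested
  without losing the constant in the Frostman bound, and a Cantor construction gives infinite Hausdorff measure.\<close>

section \<open>Counting orbit points\<close>

text \<open>Nothing is assumed about \<open>A\<close>: orbit points may cluster or coincide, so
  counting them directly says nothing about the space that they fill. Dividing by the number of hits
  counts clusters instead, and the only tools are packing inequalities with constants depending on m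
  and n. The exponent s/m comes from volume. A ball of radius \<open>\<psi>(2^k) powr (s/m)\<close>
  has volume of order \<open>\<psi>(2^k) powr s\<close>; with the weight of an orbit point
  normalised at that radius, every such ball receives total weight at most a constant times
  \<open>\<psi>(2^k) powr s\<close> from level k. Covering needs only clusters of radius
  \<open>\<psi>(2^k)\<close>, hence the two radii in the two halves. Dyadic regularity makes the
  sums over levels geometric. The obstacle to nesting is that a local measure in a ball obeys its
  Frostman bound only up to a fixed constant, which a naive iteration would multiply at every stage.
  The constant is paid in a different currency: the measure of the previous stage is made so thin at
  its own finest scale that the factor disappears there.\<close>

lemma lattice_norm_le_infnorm: "lattice_norm x \<le> infnorm x"
  using lattice_norm_le[of 0 x] by simp

lemma lattice_norm_le_iff:
  "lattice_norm x \<le> r \<longleftrightarrow> (\<exists>p\<in>int_vecs. infnorm (x - p) \<le> r)"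
proof
  assume "lattice_norm x \<le> r"
  then show "\<exists>p\<in>int_vecs. infnorm (x - p) \<le> r"
    using lattice_norm_attained[of x] by metis
next
  assume "\<exists>p\<in>int_vecs. infnorm (x - p) \<le> r"
  then show "lattice_norm x \<le> r"
    using lattice_norm_le order_trans by blast
qed

lemma lattice_norm_minus_commute: "lattice_norm (x - y) = lattice_norm (y - x)"
  using lattice_norm_minus[of "x - y"] by simp

lemma lattice_norm_diff_triangle: "lattice_norm (x - z) \<le> lattice_norm (x - y) + lattice_norm (y - z)"
  using lattice_norm_triangle[of "x - y" "y - z"] by simp

lemma infnorm_le_iff:
  fixes x :: "real ^ 'n"
  shows "infnorm x \<le> r \<longleftrightarrow> (\<forall>i. \<bar>x $ i\<bar> \<le> r)"
proof
  assume "infnorm x \<le> r"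
  then show "\<forall>i. \<bar>x $ i\<bar> \<le> r"
    using component_le_infnorm_cart order_trans by blast
next
  assume "\<forall>i. \<bar>x $ i\<bar> \<le> r"
  then show "infnorm x \<le> r"
    unfolding infnorm_cart by (intro cSup_least) auto
qed

lemma infnorm_diff_triangle: "infnorm (x - y) \<le> infnorm x + infnorm y"
  using infnorm_triangle[of x "- y"] by (simp add: infnorm_neg)

lemma card_le_fibers:
  assumes "finite B" "f ` S \<subseteq> B" "\<And>b. b \<in> B \<Longrightarrow> card {a \<in> S. f a = b} \<le> c" "finite S"
  shows "card S \<le> card B * c"
proof -
  have "card S = (\<Sum>b\<in>B. card {a \<in> S. f a = b})"
    using sum.group[OF assms(4,1,2), of "\<lambda>_. 1 :: nat"] by simp
  also have "\<dots> \<le> (\<Sum>b\<in>B. c)"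
    by (intro sum_mono assms(3))
  finally show ?thesis by simp
qed

section \<open>Sorting vectors into cubes\<close>

definition cell :: "real \<Rightarrow> real ^ 'k \<Rightarrow> 'k \<Rightarrow> int" where
  "cell \<sigma> y = (\<lambda>i. \<lfloor>y $ i / \<sigma>\<rfloor>)"

lemma cell_eq_imp_close:
  fixes y y' :: "real ^ 'k"
  assumes "cell \<sigma> y = cell \<sigma> y'" "0 < \<sigma>"
  shows "infnorm (y - y') \<le> \<sigma>"
  unfolding infnorm_le_iff
proof
  fix i
  have "\<lfloor>y $ i / \<sigma>\<rfloor> = \<lfloor>y' $ i / \<sigma>\<rfloor>"
    using assms(1) by (simp add: cell_def fun_eq_iff)
  then have "\<bar>y $ i / \<sigma> - y' $ i / \<sigma>\<bar> \<le> 1"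
    by linarith
  then have "\<bar>(y $ i - y' $ i) / \<sigma>\<bar> \<le> 1"
    by (simp add: diff_divide_distrib)
  then show "\<bar>(y - y') $ i\<bar> \<le> \<sigma>"
    using assms(2) by (simp add: abs_divide divide_le_eq)
qed

definition cells :: "real \<Rightarrow> real \<Rightarrow> ('k::finite \<Rightarrow> int) set" where
  "cells R \<sigma> = (\<Pi>\<^sub>E i\<in>UNIV. {\<lfloor>- R / \<sigma>\<rfloor>..\<lfloor>R / \<sigma>\<rfloor>})"

lemma cell_in_cells:
  fixes y :: "real ^ 'k"
  assumes "infnorm y \<le> R" "0 < \<sigma>"
  shows "cell \<sigma> y \<in> cells R \<sigma>"
proof -
  have "\<lfloor>- R / \<sigma>\<rfloor> \<le> \<lfloor>y $ i / \<sigma>\<rfloor> \<and> \<lfloor>y $ i / \<sigma>\<rfloor> \<le> \<lfloor>R / \<sigma>\<rfloor>" for i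
  proof -
    have "\<bar>y $ i\<bar> \<le> R"
      using assms(1) by (simp add: infnorm_le_iff)
    then have "- R / \<sigma> \<le> y $ i / \<sigma>" "y $ i / \<sigma> \<le> R / \<sigma>"
      using assms(2) by (auto intro!: divide_right_mono simp del: divide_minus_left)
    then show ?thesis by (auto intro: floor_mono)
  qed
  then show ?thesis
    by (auto simp: cells_def cell_def)
qed

lemma finite_cells: "finite (cells R \<sigma> :: ('k::finite \<Rightarrow> int) set)"
  unfolding cells_def by (intro finite_PiE) auto

text \<open>An interval of length 4R meets at most 4R/\<sigma> + 2 cells of side \<sigma>, and
  \<open>\<sigma> \<le> R\<close> absorbs the 2.\<close>

lemma card_cells_le:
  assumes "0 < \<sigma>" "\<sigma> \<le> R"
  shows "real (card (cells (2 * R) \<sigma> :: ('k::finite \<Rightarrow> int) set)) \<le> (6 * R / \<sigma>) ^ CARD('k)"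
proof -
  have "real (card (cells (2 * R) \<sigma> :: ('k \<Rightarrow> int) set))
      = real (nat (\<lfloor>2 * R / \<sigma>\<rfloor> - \<lfloor>- (2 * R) / \<sigma>\<rfloor> + 1)) ^ CARD('k)"
    unfolding cells_def by (simp add: card_PiE)
  also have "\<dots> \<le> (6 * R / \<sigma>) ^ CARD('k)"
  proof (rule power_mono)
    have R: "1 \<le> R / \<sigma>" using assms by simp
    have "0 \<le> \<lfloor>2 * R / \<sigma>\<rfloor> - \<lfloor>- (2 * R) / \<sigma>\<rfloor> + 1"
      using R by linarith
    then have "real (nat (\<lfloor>2 * R / \<sigma>\<rfloor> - \<lfloor>- (2 * R) / \<sigma>\<rfloor> + 1))
        = real_of_int (\<lfloor>2 * R / \<sigma>\<rfloor> - \<lfloor>- (2 * R) / \<sigma>\<rfloor> + 1)" by simp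
    also have "\<dots> \<le> 2 * R / \<sigma> - (- (2 * R) / \<sigma> - 1) + 1"
      by linarith
    also have "\<dots> \<le> 6 * R / \<sigma>" using R by linarith
    finally show "real (nat (\<lfloor>2 * R / \<sigma>\<rfloor> - \<lfloor>- (2 * R) / \<sigma>\<rfloor> + 1)) \<le> 6 * R / \<sigma>" .
  qed simp
  finally show ?thesis .
qed

section \<open>Hits of the orbit and neighbourhoods of the orbit\<close>

definition hits :: "real ^ 'n ^ 'm \<Rightarrow> real \<Rightarrow> real \<Rightarrow> (real ^ 'n) set" where
  "hits A r T = {q \<in> int_vecs. infnorm q \<le> T \<and> lattice_norm (A *v q) \<le> r}"

text \<open>The r-neighbourhood of a finite piece of the orbit, kept as a periodic subset of the
  covering space so that \<open>reach_add\<close> is plain Minkowski addition.\<close>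

definition reach :: "real ^ 'n ^ 'm \<Rightarrow> real \<Rightarrow> real \<Rightarrow> (real ^ 'm) set" where
  "reach A r T = {x. \<exists>q\<in>int_vecs. infnorm q \<le> T \<and> lattice_norm (x - A *v q) \<le> r}"

lemma finite_hits: "finite (hits A r T)"
  unfolding hits_def by (rule finite_subset[OF _ finite_int_vecs_bounded[of T]]) auto

lemma hits_mono: "r \<le> r' \<Longrightarrow> T \<le> T' \<Longrightarrow> hits A r T \<subseteq> hits A r' T'"
  unfolding hits_def by auto

lemma card_hits_mono: "r \<le> r' \<Longrightarrow> T \<le> T' \<Longrightarrow> card (hits A r T) \<le> card (hits A r' T')"
  by (intro card_mono finite_hits hits_mono)

lemma card_hits_pos: "0 \<le> r \<Longrightarrow> 0 \<le> T \<Longrightarrow> 0 < card (hits A r T)"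
  unfolding card_gt_0_iff
  using finite_hits[of A r T] by (auto simp: hits_def infnorm_0 lattice_norm_eq_0_iff[THEN iffD2] intro!: exI[of _ 0])

lemma reach_mono: "r \<le> r' \<Longrightarrow> T \<le> T' \<Longrightarrow> reach A r T \<subseteq> reach A r' T'"
  unfolding reach_def by (blast intro: order_trans)

lemma reach_add:
  assumes "x \<in> reach A r T" "y \<in> reach A r' T'"
  shows "x + y \<in> reach A (r + r') (T + T')"
proof -
  obtain p q where "p \<in> int_vecs" "infnorm p \<le> T" "lattice_norm (x - A *v p) \<le> r"
    "q \<in> int_vecs" "infnorm q \<le> T'" "lattice_norm (y - A *v q) \<le> r'"
    using assms unfolding reach_def by blast
  then show ?thesis
    unfolding reach_def using lattice_norm_triangle[of "x - A *v p" "y - A *v q"] infnorm_triangle[of p q]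
    by (intro CollectI bexI[of _ "p + q"]) (auto simp: int_vecs_add algebra_simps matrix_vector_right_distrib)
qed

lemma zero_in_reach: "0 \<le> r \<Longrightarrow> 0 \<le> T \<Longrightarrow> 0 \<in> reach A r T"
  unfolding reach_def
  by (intro CollectI bexI[of _ 0]) (auto simp: infnorm_0 lattice_norm_eq_0_iff[THEN iffD2])

text \<open>Shifting the points \<open>x j\<close> by the orbit points \<open>A q\<close> with \<open>q \<in> hits A r T\<close> and sorting the resulting pairs into
  boxes of size \<open>(r', T')\<close>, each box determines \<open>j\<close> and contains at most \<open>card (hits A r' T')\<close> pairs.\<close>

lemma card_hits_packing:
  fixes A :: "real ^ 'n ^ 'm" and x :: "'i \<Rightarrow> real ^ 'm"
  assumes "finite J" and x: "\<And>j. j \<in> J \<Longrightarrow> x j \<in> reach A r T"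
    and sep: "\<And>i j. i \<in> J \<Longrightarrow> j \<in> J \<Longrightarrow> i \<noteq> j \<Longrightarrow> x i - x j \<notin> reach A r' T'"
    and r: "0 < r'" "r' \<le> r" and T: "0 < T'" "T' \<le> T"
  shows "real (card J) * card (hits A r T)
    \<le> 6 ^ (CARD('m) + CARD('n)) * (r / r') ^ CARD('m) * (T / T') ^ CARD('n) * card (hits A r' T')"
proof -
  have "\<forall>j\<in>J. \<exists>q p. q \<in> int_vecs \<and> infnorm q \<le> T \<and> p \<in> int_vecs \<and> infnorm (x j - A *v q - p) \<le> r"
    using x unfolding reach_def lattice_norm_le_iff by blast
  then obtain Q P where QP: "\<And>j. j \<in> J \<Longrightarrow> Q j \<in> int_vecs \<and> infnorm (Q j) \<le> T \<and> P j \<in> int_vecs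
      \<and> infnorm (x j - A *v Q j - P j) \<le> r"
    by metis
  \<comment> \<open>Subtracting integer vectors gives residues of norm at most r in the vector space
    itself, where they can be sorted into cubes; the integer parts drop out of
    \<open>lattice_norm\<close> afterwards.\<close>
  define e where "e j = x j - A *v Q j - P j" for j
  have "\<forall>q\<in>hits A r T. \<exists>p. p \<in> int_vecs \<and> infnorm (A *v q - p) \<le> r"
    unfolding hits_def lattice_norm_le_iff by blast
  then obtain R where R: "\<And>q. q \<in> hits A r T \<Longrightarrow> R q \<in> int_vecs \<and> infnorm (A *v q - R q) \<le> r"
    by metis
  define f where "f q = A *v q - R q" for q
  define g where "g = (\<lambda>(j, q). (cell T' (q + Q j), cell r' (e j - f q)))"
  let ?S = "J \<times> hits A r T"
  let ?B = "(cells (2 * T) T' :: ('n \<Rightarrow> int) set) \<times> (cells (2 * r) r' :: ('m \<Rightarrow> int) set)"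
  \<comment> \<open>Two pairs in one box have nearly equal q-parts and residues, so
    \<open>x i - x j\<close> lies in the small neighbourhood of the orbit. Separation forces i = j,
    and then the shifts cancel and leave a difference that is itself a hit.\<close>
  have key: "i = j \<and> q' - q \<in> hits A r' T'"
    if iq: "i \<in> J" "q \<in> hits A r T" and jq: "j \<in> J" "q' \<in> hits A r T" and g: "g (i, q) = g (j, q')" for i j q q'
  proof -
    let ?d = "q + Q i - (q' + Q j)"
    have d: "infnorm ?d \<le> T'"
      using g T by (intro cell_eq_imp_close) (auto simp: g_def)
    have ef: "infnorm ((e i - f q) - (e j - f q')) \<le> r'"
      using g r by (intro cell_eq_imp_close) (auto simp: g_def)
    have dint: "?d \<in> int_vecs"
      using iq jq QP by (intro int_vecs_diff int_vecs_add) (auto simp: hits_def)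
    let ?p = "P i - P j + (R q' - R q)"
    have pint: "- ?p \<in> int_vecs"
      using iq jq QP R by (intro int_vecs_minus int_vecs_diff int_vecs_add) auto
    have "(e i - f q) - (e j - f q') = (x i - x j - A *v ?d) + - ?p"
      by (simp add: e_def f_def matrix_vector_right_distrib matrix_vector_mult_diff_distrib algebra_simps)
    then have "lattice_norm (x i - x j - A *v ?d) \<le> r'"
      using ef lattice_norm_le_infnorm lattice_norm_add_int_vec[OF pint] by (metis order_trans)
    then have "x i - x j \<in> reach A r' T'"
      unfolding reach_def using d dint by blast
    with sep iq jq have ij: "i = j" by blast
    have "lattice_norm (A *v (q' - q)) \<le> r'"
    proof -
      have 1: "(e i - f q) - (e j - f q') = A *v (q' - q) + (R q - R q')"
        using ij by (simp add: f_def matrix_vector_mult_diff_distrib)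
      have "R q - R q' \<in> int_vecs" using iq jq R by (intro int_vecs_diff) auto
      then show ?thesis
        using ef 1 lattice_norm_le_infnorm lattice_norm_add_int_vec by (metis order_trans)
    qed
    moreover have "infnorm (q' - q) \<le> T'"
      using d ij by (simp add: infnorm_sub)
    moreover have "q' - q \<in> int_vecs"
      using iq jq by (intro int_vecs_diff) (auto simp: hits_def)
    ultimately show ?thesis using ij by (simp add: hits_def)
  qed
  have "card ?S \<le> card ?B * card (hits A r' T')"
  proof (rule card_le_fibers[where f = g])
    show "finite ?B" by (intro finite_cartesian_product finite_cells)
    show "finite ?S" using assms(1) finite_hits by blast
    show "g ` ?S \<subseteq> ?B"
    proof
      fix y assume "y \<in> g ` ?S"
      then obtain j q where jq: "j \<in> J" "q \<in> hits A r T" and y: "y = (cell T' (q + Q j), cell r' (e j - f q))"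
        by (auto simp: g_def)
      have "infnorm (q + Q j) \<le> 2 * T"
        using infnorm_triangle[of q "Q j"] jq QP[of j] by (auto simp: hits_def)
      moreover have "infnorm (e j - f q) \<le> 2 * r"
        using infnorm_diff_triangle[of "e j" "f q"] jq QP[of j] R[of q]
        unfolding e_def f_def by linarith
      ultimately show "y \<in> ?B" using y r T by (auto intro: cell_in_cells)
    qed
    fix b assume "b \<in> ?B"
    let ?F = "{a \<in> ?S. g a = b}"
    show "card ?F \<le> card (hits A r' T')"
    proof (cases "?F = {}")
      case False
      then obtain i q where iq: "i \<in> J" "q \<in> hits A r T" "g (i, q) = b" by auto
      \<comment> \<open>Translating by one fixed element of the fibre embeds the whole fibre into
        the hits of size \<open>(r', T')\<close>.\<close>
      have F: "fst a = i \<and> snd a - q \<in> hits A r' T'" if "a \<in> ?F" for a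
        using key[OF iq(1,2), of "fst a" "snd a"] iq(3) that by auto
      have sub: "(\<lambda>a. snd a - q) ` ?F \<subseteq> hits A r' T'"
        using F by blast
      have inj: "inj_on (\<lambda>a. snd a - q) ?F"
        using F by (intro inj_onI prod_eqI) auto
      show ?thesis
        using card_mono[OF finite_hits sub] card_image[OF inj] by simp
    next
      case True
      then show ?thesis by (metis card.empty le0)
    qed
  qed
  then have "real (card ?S) \<le> real (card ?B) * card (hits A r' T')"
    by (metis of_nat_le_iff of_nat_mult)
  then have "real (card J) * card (hits A r T) \<le> real (card ?B) * card (hits A r' T')"
    by (simp add: card_cartesian_product)
  also have "real (card ?B) \<le> (6 * T / T') ^ CARD('n) * (6 * r / r') ^ CARD('m)"
    unfolding card_cartesian_product of_nat_mult
    using r T by (intro mult_mono card_cells_le) auto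
  also have "\<dots> = 6 ^ (CARD('m) + CARD('n)) * (r / r') ^ CARD('m) * (T / T') ^ CARD('n)"
    by (simp add: power_add power_mult_distrib power_divide mult_ac)
  finally show ?thesis by (simp add: mult_right_mono)
qed

lemma lattice_norm_le_half: "lattice_norm (x :: real ^ 'm) \<le> 1 / 2"
  unfolding lattice_norm_le_iff
proof
  show "(\<chi> i. of_int (round (x $ i))) \<in> (int_vecs :: (real ^ 'm) set)"
    by (simp add: int_vecs_def)
  show "infnorm (x - (\<chi> i. of_int (round (x $ i)))) \<le> 1 / 2"
    unfolding infnorm_le_iff using of_int_round_abs_le[of "x $ _"]
    by (simp add: abs_minus_commute)
qed

lemma int_vec_infnorm_less_1:
  assumes "q \<in> int_vecs" "infnorm q < 1" shows "q = 0"
proof -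
  have "q $ i = 0" for i
  proof -
    have "\<bar>q $ i\<bar> < 1"
      using component_le_infnorm_cart[of q i] assms(2) by linarith
    moreover have "q $ i \<in> \<int>" using assms(1) by (simp add: int_vecs_def)
    ultimately show ?thesis using Ints_nonzero_abs_less1 by blast
  qed
  then show ?thesis by (simp add: vec_eq_iff)
qed

lemma hits_half: "hits A (1 / 2) T = {q \<in> int_vecs. infnorm q \<le> T}"
  unfolding hits_def using lattice_norm_le_half by blast

lemma card_hits_le_1: "(T :: real) < 1 \<Longrightarrow> card (hits A r T) \<le> 1"
  using card_mono[of "{0}" "hits A r T"] int_vec_infnorm_less_1 by (force simp: hits_def)

text \<open>The packing inequality for the single point 0: enlarging the parameters increases the
  count at most as it increases volume.\<close>

lemma card_hits_scale:
  fixes A :: "real ^ 'n ^ 'm" and r r' T T' :: real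
  assumes r: "0 < r'" "r' \<le> r" and T: "0 < T'" "T' \<le> T"
  shows "card (hits A r T)
    \<le> 6 ^ (CARD('m) + CARD('n)) * (r / r') ^ CARD('m) * (T / T') ^ CARD('n) * card (hits A r' T')"
  using card_hits_packing[of "{()}" "\<lambda>_. 0" A r T r' T'] assms zero_in_reach[of r T A] by simp

text \<open>At radius 1/2 the Diophantine condition is void, and at height 1/2 only q = 0 survives;
  the bound scales between these two extremes.\<close>

lemma card_hits_upper:
  fixes A :: "real ^ 'n ^ 'm" and r r' T T' :: real
  assumes "1 / 2 \<le> T"
  shows "card (hits A r T) \<le> 6 ^ (CARD('m) + CARD('n)) * (2 * T) ^ CARD('n)"
proof -
  have "hits A r T \<subseteq> hits A (1/2) T"
    unfolding hits_half by (auto simp: hits_def)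
  then have "real (card (hits A r T)) \<le> card (hits A (1/2) T)"
    by (simp add: card_mono finite_hits)
  also have "\<dots> \<le> 6 ^ (CARD('m) + CARD('n)) * ((1/2) / (1/2)) ^ CARD('m) * (T / (1/2)) ^ CARD('n) * card (hits A (1/2) (1/2))"
    using assms by (intro card_hits_scale) auto
  also have "\<dots> \<le> 6 ^ (CARD('m) + CARD('n)) * ((1/2) / (1/2)) ^ CARD('m) * (T / (1/2)) ^ CARD('n) * 1"
    using assms card_hits_le_1[of "1/2" A "1/2"] by (intro mult_left_mono) auto
  finally show ?thesis by (simp add: mult.commute)
qed

text \<open>The vectors with all coordinates between 0 and \<open>\<lfloor>T\<rfloor>\<close>
  suffice, since \<open>\<lfloor>T\<rfloor> + 1 \<ge> T\<close>.\<close>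

lemma card_int_vecs_ge:
  assumes "0 \<le> T"
  shows "T ^ CARD('n) \<le> card {q \<in> int_vecs. infnorm (q :: real ^ 'n) \<le> T}"
proof -
  define P where "P = (\<Pi>\<^sub>E i\<in>(UNIV :: 'n set). {0..\<lfloor>T\<rfloor>})"
  define f where "f g = (\<chi> i. real_of_int (g i))" for g :: "'n \<Rightarrow> int"
  have "T ^ CARD('n) \<le> real (card P)"
  proof -
    have "T \<le> real (nat (\<lfloor>T\<rfloor> + 1))" using assms by linarith
    then show ?thesis using assms by (simp add: P_def card_PiE power_mono)
  qed
  also have "card P = card (f ` P)"
    by (intro card_image[symmetric]) (auto simp: inj_on_def f_def vec_eq_iff fun_eq_iff)
  also have "\<dots> \<le> card {q \<in> int_vecs. infnorm (q :: real ^ 'n) \<le> T}"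
  proof (intro card_mono finite_int_vecs_bounded subsetI)
    fix q assume "q \<in> f ` P"
    then obtain g where g: "g \<in> P" "q = f g" by blast
    have "\<bar>q $ i\<bar> \<le> T" for i
    proof -
      have "0 \<le> g i" "g i \<le> \<lfloor>T\<rfloor>" using g by (auto simp: P_def)
      then show ?thesis using g by (simp add: f_def le_floor_iff)
    qed
    then show "q \<in> {q \<in> int_vecs. infnorm q \<le> T}"
      using g by (simp add: infnorm_le_iff int_vecs_def f_def)
  qed
  finally show ?thesis by simp
qed

text \<open>Dirichlet's pigeonhole: at radius 1/2 every q of height at most T is a hit, and
  shrinking the radius to r costs at most a constant times \<open>r ^ CARD('m)\<close>.\<close>

lemma card_hits_lower:
  fixes A :: "real ^ 'n ^ 'm" and r r' T T' :: real
  assumes "0 < r" "r \<le> 1 / 2" "0 < T"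
  shows "r ^ CARD('m) * T ^ CARD('n) \<le> 6 ^ (CARD('m) + CARD('n)) * real (card (hits A r T))"
proof -
  have "T ^ CARD('n) \<le> card (hits A (1/2) T)"
    using card_int_vecs_ge[of T, where 'n='n] assms unfolding hits_half by simp
  also have "\<dots> \<le> 6 ^ (CARD('m) + CARD('n)) * ((1/2) / r) ^ CARD('m) * (T / T) ^ CARD('n) * card (hits A r T)"
    using assms by (intro card_hits_scale) auto
  also have "\<dots> \<le> 6 ^ (CARD('m) + CARD('n)) * (1 / r) ^ CARD('m) * (T / T) ^ CARD('n) * card (hits A r T)"
    using assms by (intro mult_right_mono mult_left_mono power_mono divide_right_mono) auto
  finally show ?thesis using assms by (simp add: field_simps power_divide)
qed

lemma reach_minus: "x \<in> reach A r T \<Longrightarrow> - x \<in> reach A r T"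
proof -
  assume "x \<in> reach A r T"
  then obtain q where q: "q \<in> int_vecs" "infnorm q \<le> T" "lattice_norm (x - A *v q) \<le> r"
    unfolding reach_def by blast
  have "A *v (- q) = - (A *v q)"
    using matrix_vector_mult_diff_distrib[of A 0 q] by simp
  then have "- x - A *v (- q) = - (x - A *v q)" by simp
  then have "lattice_norm (- x - A *v (- q)) \<le> r"
    using q lattice_norm_minus by metis
  then show "- x \<in> reach A r T"
    unfolding reach_def using q by (intro CollectI bexI[of _ "- q"]) (auto simp: infnorm_neg int_vecs_minus)
qed

lemma infnorm_in_reach: "infnorm x \<le> r \<Longrightarrow> 0 \<le> T \<Longrightarrow> x \<in> reach A r T"
  unfolding reach_def using lattice_norm_le_infnorm[of x]
  by (intro CollectI bexI[of _ 0]) (auto simp: infnorm_0)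

text \<open>A multiple of the neighbourhood of \<open>0\<close> that stops growing is a subgroup with interior.\<close>

lemma reach_grows:
  fixes A :: "real ^ 'n ^ 'm" and r T :: real
  assumes "0 < r" "0 \<le> T" "reach A (real i * r) (real i * T) \<noteq> UNIV"
  shows "\<exists>x. x \<in> reach A (real (Suc i) * r) (real (Suc i) * T) \<and> x \<notin> reach A (real i * r) (real i * T)"
proof (rule ccontr)
  let ?H = "reach A (real i * r) (real i * T)"
  assume neg: "\<not> ?thesis"
  \<comment> \<open>If the next multiple adds nothing, \<open>?H\<close> is closed under adding the
    basic neighbourhood.\<close>
  have step: "x + y \<in> ?H" if "x \<in> ?H" "y \<in> reach A r T" for x y
    using reach_add[OF that] neg by (simp add: algebra_simps)
  have "x \<in> ?H" for x
  proof -
    \<comment> \<open>Any x is the sum of N copies of x/N, which lies in the basic neighbourhood;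
      adding them to 0 one at a time never leaves \<open>?H\<close>.\<close>
    obtain N :: nat where N: "infnorm x / r < real N" using reals_Archimedean2 by blast
    have Npos: "0 < real N"
      using N assms(1) infnorm_pos_le[of x] by (metis divide_nonneg_pos le_less_trans)
    have small: "(1 / real N) *\<^sub>R x \<in> reach A r T"
      using N Npos assms by (intro infnorm_in_reach) (auto simp: infnorm_mul field_simps)
    have "real k *\<^sub>R ((1 / real N) *\<^sub>R x) \<in> ?H" for k
    proof (induction k)
      case 0
      then show ?case using assms zero_in_reach[of "real i * r" "real i * T" A] by simp
    next
      case (Suc k)
      then show ?case using step[OF Suc small] by (simp only: of_nat_Suc scaleR_left.add scaleR_one add.commute)
    qed
    from this[of N] Npos show ?thesis by simp
  qed
  with assms(3) show False by blast
qed

text \<open>Taking every other witness of \<open>reach_grows\<close> gives a separated family of about \<open>J / 2\<close> points.\<close>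

lemma card_hits_not_dense:
  fixes A :: "real ^ 'n ^ 'm" and r r' T T' :: real
  assumes nd: "reach A r T \<noteq> UNIV" and r: "0 < r'" "real J * r' \<le> r" and T: "0 < T'" "real J * T' \<le> T"
    and J: "0 < J"
  shows "real J * card (hits A r T)
    \<le> 2 * (6 ^ (CARD('m) + CARD('n)) * (r / r') ^ CARD('m) * (T / T') ^ CARD('n) * card (hits A r' T'))"
proof -
  let ?R = "\<lambda>i. reach A (real i * r') (real i * T')"
  have mono: "?R i \<subseteq> ?R j" if "i \<le> j" for i j
    using that r(1) T(1) by (intro reach_mono mult_right_mono) auto
  have sub: "?R i \<subseteq> reach A r T" if "i \<le> J" for i
  proof -
    have "?R J \<subseteq> reach A r T" using r T by (intro reach_mono)
    with mono[OF that] show ?thesis by blast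
  qed
  have "\<forall>i<J. \<exists>x. x \<in> ?R (Suc i) \<and> x \<notin> ?R i"
    using reach_grows[of r' T' A] r(1) T(1) sub nd by (metis less_imp_le order_less_imp_le subset_UNIV subset_antisym)
  then obtain x where x: "\<And>i. i < J \<Longrightarrow> x i \<in> ?R (Suc i) \<and> x i \<notin> ?R i" by metis
  define K where "K = {..<(J + 1) div 2}"
  have K: "2 * k < J" if "k \<in> K" for k
    using that by (auto simp: K_def)
  \<comment> \<open>\<open>x j\<close> lies in multiple j + 1, so adding an element of the basic
    neighbourhood ends in multiple j + 2. This contradicts \<open>x i\<close> avoiding multiple i
    only when i is at least j + 2, which is why only even indices are kept.\<close>
  have sep: "x (2 * i) - x (2 * j) \<notin> reach A r' T'" if "i \<in> K" "j \<in> K" "j < i" for i j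
  proof
    assume "x (2 * i) - x (2 * j) \<in> reach A r' T'"
    with x[OF K[OF that(2)]] have "x (2 * j) + (x (2 * i) - x (2 * j)) \<in> reach A (real (Suc (2 * j)) * r' + r') (real (Suc (2 * j)) * T' + T')"
      by (intro reach_add) auto
    then have "x (2 * i) \<in> ?R (Suc (Suc (2 * j)))" by (simp add: algebra_simps)
    with mono[of "Suc (Suc (2 * j))" "2 * i"] that x[OF K[OF that(1)]] show False by auto
  qed
  have "real (card K) * card (hits A r T)
      \<le> 6 ^ (CARD('m) + CARD('n)) * (r / r') ^ CARD('m) * (T / T') ^ CARD('n) * card (hits A r' T')"
  proof (rule card_hits_packing[where x = "\<lambda>k. x (2 * k)"])
    show "finite K" by (simp add: K_def)
    show "x (2 * k) \<in> reach A r T" if "k \<in> K" for k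
      using x[OF K[OF that]] sub[of "Suc (2 * k)"] K[OF that] by auto
    show "x (2 * i) - x (2 * j) \<notin> reach A r' T'" if "i \<in> K" "j \<in> K" "i \<noteq> j" for i j
      using sep[of i j] sep[of j i] that reach_minus[of "x (2 * i) - x (2 * j)" A r' T']
      by (cases "j < i") auto
    have "1 * r' \<le> real J * r'" using J r by (intro mult_right_mono) linarith+
    with r show "r' \<le> r" by linarith
    have "1 * T' \<le> real J * T'" using J T by (intro mult_right_mono) linarith+
    with T show "T' \<le> T" by linarith
  qed (use r T in auto)
  moreover have "real J \<le> 2 * real (card K)" by (simp add: K_def)
  then have "real J * card (hits A r T) \<le> 2 * real (card K) * card (hits A r T)"
    by (intro mult_right_mono) auto
  ultimately show ?thesis by simp
qed

section \<open>Grids in a cube\<close>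

definition grid_point :: "real \<Rightarrow> nat \<Rightarrow> ('m::finite \<Rightarrow> nat) \<Rightarrow> real ^ 'm" where
  "grid_point \<delta> M g = (\<chi> i. \<delta> / real M * real (g i))"

definition grid :: "nat \<Rightarrow> ('m::finite \<Rightarrow> nat) set" where
  "grid M = (\<Pi>\<^sub>E i\<in>UNIV. {..<M})"

lemma finite_grid: "finite (grid M :: ('m::finite \<Rightarrow> nat) set)"
  unfolding grid_def by (intro finite_PiE) auto

lemma card_grid: "card (grid M :: ('m::finite \<Rightarrow> nat) set) = M ^ CARD('m)"
  unfolding grid_def by (simp add: card_PiE)

text \<open>Coordinates differ by at most \<delta> - \<delta>/M, which is at most 1 - \<delta>/M, so
  even with wrap-around in the torus opposite faces of the grid stay \<delta>/M apart.\<close>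

lemma grid_point_separated:
  fixes g h :: "'m::finite \<Rightarrow> nat"
  assumes "g \<in> grid M" "h \<in> grid M" "g \<noteq> h" "0 < \<delta>" "\<delta> \<le> 1" "0 < M"
  shows "\<delta> / M \<le> lattice_norm (grid_point \<delta> M g - grid_point \<delta> M h)"
proof -
  obtain i where i: "g i \<noteq> h i" using assms(3) by blast
  obtain p where p: "p \<in> int_vecs"
    "lattice_norm (grid_point \<delta> M g - grid_point \<delta> M h) = infnorm (grid_point \<delta> M g - grid_point \<delta> M h - p)"
    by (rule lattice_norm_attained)
  obtain z where z: "p $ i = of_int z" using p by (auto simp: int_vecs_def Ints_def)
  define d where "d = real (g i) - real (h i)"
  have lt: "g i < M" "h i < M" using assms(1,2) by (auto simp: grid_def)
  have d: "1 \<le> \<bar>d\<bar>" "\<bar>d\<bar> \<le> real M - 1" using i lt unfolding d_def by linarith+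
  have t: "\<bar>\<delta> / M * d\<bar> = \<delta> / M * \<bar>d\<bar>" using assms by (simp add: abs_mult)
  have t1: "\<delta> / M \<le> \<bar>\<delta> / M * d\<bar>" unfolding t using d assms mult_left_mono[of 1 "\<bar>d\<bar>" "\<delta> / M"] by simp
  have "\<delta> / M * \<bar>d\<bar> \<le> \<delta> / M * (real M - 1)" using d assms by (intro mult_left_mono) auto
  also have "\<dots> = \<delta> - \<delta> / M" using assms by (simp add: field_simps)
  finally have t2: "\<bar>\<delta> / M * d\<bar> \<le> 1 - \<delta> / M" unfolding t using assms by linarith
  have "\<delta> / M \<le> \<bar>\<delta> / M * d - of_int z\<bar>"
  proof (cases "z = 0")
    case False
    then have "1 \<le> \<bar>real_of_int z\<bar>" by linarith
    with t2 show ?thesis by linarith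
  qed (use t1 in simp)
  also have "\<dots> = \<bar>(grid_point \<delta> M g - grid_point \<delta> M h - p) $ i\<bar>"
    by (simp add: grid_point_def z d_def algebra_simps)
  also have "\<dots> \<le> infnorm (grid_point \<delta> M g - grid_point \<delta> M h - p)"
    by (rule component_le_infnorm_cart)
  finally show ?thesis using p by simp
qed

text \<open>The converse of the pigeonhole bound. If the neighbourhood is everything, all points of
  a grid of about \<open>(1/r) ^ CARD('m)\<close> points lie in it. Packing at height 1/2, where
  \<open>reach\<close> is just the r-ball around the lattice, then limits the number of
  hits.\<close>

lemma card_hits_dense:
  fixes A :: "real ^ 'n ^ 'm" and r r' T T' :: real
  assumes dense: "reach A r T = UNIV" and r: "0 < r" "r \<le> 1 / 2" and T: "1 / 2 \<le> T"
  shows "card (hits A r T) \<le> 6 ^ (CARD('m) + CARD('n)) * (4 * r) ^ CARD('m) * (2 * T) ^ CARD('n)"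
proof -
  \<comment> \<open>The spacing 1/M is at least 2r, so the grid is separated beyond r, while M is
    still at least 1/(4r).\<close>
  define M where "M = nat \<lfloor>1 / (2 * r)\<rfloor>"
  have y: "1 \<le> 1 / (2 * r)" using r by simp
  have M0: "0 < M" unfolding M_def using y by simp
  have Mle: "real M \<le> 1 / (2 * r)" unfolding M_def using y by linarith
  have Mge: "1 / (4 * r) \<le> real M"
  proof -
    have "1 \<le> \<lfloor>1 / (2 * r)\<rfloor>" using y by linarith
    moreover from this have "real M = of_int \<lfloor>1 / (2 * r)\<rfloor>" unfolding M_def by linarith
    moreover have "1 / (4 * r) = (1 / (2 * r)) / 2" by simp
    ultimately show ?thesis by linarith
  qed
  have gap: "r < 1 / real M" using Mle M0 r by (simp add: field_simps)
  have "real (card (grid M :: ('m \<Rightarrow> nat) set)) * card (hits A r T)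
      \<le> 6 ^ (CARD('m) + CARD('n)) * (r / r) ^ CARD('m) * (T / (1/2)) ^ CARD('n) * card (hits A r (1/2))"
  proof (rule card_hits_packing[where x = "grid_point 1 M"])
    fix g h :: "'m \<Rightarrow> nat" assume gh: "g \<in> grid M" "h \<in> grid M" "g \<noteq> h"
    show "grid_point 1 M g - grid_point 1 M h \<notin> reach A r (1/2)"
    proof
      assume "grid_point 1 M g - grid_point 1 M h \<in> reach A r (1/2)"
      then obtain q where q: "q \<in> int_vecs" "infnorm q \<le> 1/2"
        "lattice_norm (grid_point 1 M g - grid_point 1 M h - A *v q) \<le> r" by (auto simp: reach_def)
      then have "q = 0" by (intro int_vec_infnorm_less_1) auto
      then show False using q(3) grid_point_separated[OF gh, of 1] M0 gap by simp
    qed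
  qed (use r T finite_grid dense in auto)
  also have "\<dots> \<le> 6 ^ (CARD('m) + CARD('n)) * (r / r) ^ CARD('m) * (T / (1/2)) ^ CARD('n) * 1"
    using T r card_hits_le_1[of "1/2" A r] by (intro mult_left_mono) auto
  finally have 1: "real M ^ CARD('m) * card (hits A r T) \<le> 6 ^ (CARD('m) + CARD('n)) * (2 * T) ^ CARD('n)"
    using r by (simp add: card_grid mult.commute)
  have "(1 / (4 * r)) ^ CARD('m) * card (hits A r T) \<le> real M ^ CARD('m) * card (hits A r T)"
    using Mge r by (intro mult_right_mono power_mono) auto
  with 1 have "(1 / (4 * r)) ^ CARD('m) * card (hits A r T) \<le> 6 ^ (CARD('m) + CARD('n)) * (2 * T) ^ CARD('n)"
    by linarith
  then show ?thesis using r by (simp add: power_divide field_simps)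
qed

section \<open>Orbit points near a given point of the torus\<close>

definition near :: "real ^ 'n ^ 'm \<Rightarrow> real ^ 'n \<Rightarrow> real \<Rightarrow> real ^ 'm \<Rightarrow> real \<Rightarrow> (real ^ 'n) set" where
  "near A c T x r = {q \<in> int_vecs. infnorm (q - c) \<le> T \<and> lattice_norm (A *v q - x) \<le> r}"

lemma finite_near: "finite (near A c T x r)"
proof (rule finite_subset[OF _ finite_int_vecs_bounded[of "T + infnorm c"]])
  have "infnorm q \<le> infnorm (q - c) + infnorm c" for q
    using infnorm_triangle[of "q - c" c] by simp
  then show "near A c T x r \<subseteq> {q \<in> int_vecs. infnorm q \<le> T + infnorm c}"
    unfolding near_def by (smt (verit) Collect_mono)
qed

text \<open>Subtracting one fixed element turns all the others into hits of doubled size.\<close>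

lemma card_near_le: "card (near A c T x r) \<le> card (hits A (2 * r) (2 * T))"
proof (cases "near A c T x r = {}")
  case False
  then obtain p where p: "p \<in> near A c T x r" by blast
  have "(\<lambda>q. q - p) ` near A c T x r \<subseteq> hits A (2 * r) (2 * T)"
  proof clarify
    fix q assume q: "q \<in> near A c T x r"
    have "infnorm (q - p) \<le> infnorm (q - c) + infnorm (p - c)"
      using infnorm_diff_triangle[of "q - c" "p - c"] by simp
    moreover have "lattice_norm (A *v (q - p)) \<le> lattice_norm (A *v q - x) + lattice_norm (A *v p - x)"
      using lattice_norm_diff_triangle[of "A *v q" "A *v p" x] lattice_norm_minus_commute[of x "A *v p"]
      by (simp add: matrix_vector_mult_diff_distrib)
    ultimately show "q - p \<in> hits A (2 * r) (2 * T)"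
      using p q by (auto simp: near_def hits_def int_vecs_diff)
  qed
  moreover have "inj_on (\<lambda>q. q - p) (near A c T x r)" by (simp add: inj_on_def)
  ultimately show ?thesis
    using card_mono[OF finite_hits] card_image by metis
qed simp

text \<open>Density supplies p with \<open>A *v (c + p)\<close> close to x; translating the hits by
  c + p keeps them close to x.\<close>

lemma card_near_ge:
  assumes "reach A r T' = UNIV" "c \<in> int_vecs"
  shows "card (hits A r T) \<le> card (near A c (T + T') x (2 * r))"
proof -
  have "x - A *v c \<in> reach A r T'" using assms by simp
  then obtain p where p: "p \<in> int_vecs" "infnorm p \<le> T'" "lattice_norm (x - A *v c - A *v p) \<le> r"
    unfolding reach_def by blast
  have "(\<lambda>q. c + p + q) ` hits A r T \<subseteq> near A c (T + T') x (2 * r)"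
  proof clarify
    fix q assume q: "q \<in> hits A r T"
    have "A *v (c + p + q) - x = A *v q + - (x - A *v c - A *v p)"
      by (simp add: matrix_vector_right_distrib algebra_simps)
    then have "lattice_norm (A *v (c + p + q) - x) = lattice_norm (A *v q + - (x - A *v c - A *v p))"
      by (rule arg_cong)
    then have "lattice_norm (A *v (c + p + q) - x) \<le> 2 * r"
      using lattice_norm_triangle[of "A *v q" "- (x - A *v c - A *v p)"] p q
        lattice_norm_minus[of "x - A *v c - A *v p"] unfolding hits_def by auto
    moreover have "infnorm (c + p + q - c) \<le> T + T'"
      using infnorm_triangle[of p q] p q by (simp add: hits_def)
    ultimately show "c + p + q \<in> near A c (T + T') x (2 * r)"
      using p q assms by (auto simp: near_def hits_def int_vecs_add)
  qed
  moreover have "inj_on (\<lambda>q. c + p + q) (hits A r T)" by (simp add: inj_on_def)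
  ultimately show ?thesis
    using card_mono[OF finite_near] card_image by metis
qed

section \<open>Frostman measures and Hausdorff measure\<close>

text \<open>T collects the points whose kernel can charge S. For a ball S it is the concentric ball
  enlarged by the range of the kernel.\<close>

lemma measure_bind_pmf_le:
  fixes p :: "'a pmf" and N :: "'a \<Rightarrow> 'b pmf"
  assumes fin: "finite (set_pmf p)"
    and le: "\<And>x. x \<in> set_pmf p \<Longrightarrow> measure (N x) S \<le> b"
    and zero: "\<And>x. x \<in> set_pmf p \<Longrightarrow> x \<notin> T \<Longrightarrow> measure (N x) S = 0"
    and b: "0 \<le> b"
  shows "measure (bind_pmf p N) S \<le> b * measure p T"
proof -
  have "ennreal (measure (bind_pmf p N) S) = emeasure (bind_pmf p N) S"
    by (simp add: measure_pmf.emeasure_eq_measure)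
  also have "\<dots> = (\<integral>\<^sup>+x. emeasure (N x) S \<partial>p)" by simp
  also have "\<dots> \<le> (\<integral>\<^sup>+x. ennreal b * indicator T x \<partial>p)"
  proof (rule nn_integral_mono_AE, rule AE_pmfI)
    fix x assume "x \<in> set_pmf p"
    then show "emeasure (N x) S \<le> ennreal b * indicator T x"
      using le[of x] zero[of x] by (auto simp: measure_pmf.emeasure_eq_measure indicator_def intro: ennreal_leI)
  qed
  also have "\<dots> = ennreal b * emeasure p T" by (simp add: nn_integral_cmult)
  also have "\<dots> = ennreal (b * measure p T)"
    using b by (simp add: measure_pmf.emeasure_eq_measure ennreal_mult)
  finally show ?thesis using b by (simp add: ennreal_le_iff)
qed

lemma measure_pmf_eq_0_if_disjoint: "set_pmf p \<inter> S = {} \<Longrightarrow> measure (measure_pmf p) S = 0"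
  by (simp add: measure_pmf_zero_iff)

lemma ex_large_factor:
  fixes t t' m D :: real
  assumes "0 < t" "t < t'"
  shows "\<exists>H\<ge>2. D \<le> H \<and> t * (1 + 1 / (H - 1)) powr m \<le> t'"
proof -
  have "filterlim (\<lambda>H :: real. - 1 + H) at_infinity at_top"
    by (intro filterlim_at_top_imp_at_infinity filterlim_tendsto_add_at_top[OF tendsto_const filterlim_ident])
  then have "((\<lambda>H. 1 / (- 1 + H)) \<longlongrightarrow> (0 :: real)) at_top"
    by (rule tendsto_divide_0[OF tendsto_const])
  then have "((\<lambda>H. 1 / (H - 1)) \<longlongrightarrow> (0 :: real)) at_top"
    by (simp add: add.commute)
  then have "((\<lambda>H. t * (1 + 1 / (H - 1)) powr m) \<longlongrightarrow> t * (1 + 0) powr m) at_top"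
    by (intro tendsto_mult tendsto_powr tendsto_add tendsto_const) auto
  then have "\<forall>\<^sub>F H in at_top. t * (1 + 1 / (H - 1)) powr m < t'"
    using assms by (intro order_tendstoD) auto
  then have "\<forall>\<^sub>F H in at_top. t * (1 + 1 / (H - 1)) powr m < t' \<and> 2 \<le> H \<and> D \<le> H"
    by (intro eventually_conj eventually_ge_at_top)
  then obtain H where "t * (1 + 1 / (H - 1)) powr m < t' \<and> 2 \<le> H \<and> D \<le> H"
    using eventually_happens'[OF trivial_limit_at_top_linorder] by blast
  then show ?thesis by auto
qed

text \<open>Only \<open>t\<close> deteriorates: at scales below \<open>\<eta>\<close> the factor \<open>C0\<close> is absorbed by the smallness of the \<open>p\<close>-mass
  of balls of radius \<open>H * \<eta>\<close>, and at scales above \<open>(H - 1) * \<eta>\<close> each ball is enlarged by a factor close to 1.\<close>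

lemma frostman_step:
  fixes p :: "'a::metric_space pmf" and E :: "'a set" and s m t t' e C C0 H H' \<eta> :: real
  assumes s: "0 < s" "s < m" and e: "0 < e" and C: "0 \<le> C" and C0: "0 \<le> C0"
    and H: "2 \<le> H" "C0 \<le> e * H" "1 \<le> e * H" "t * (1 + 1 / (H - 1)) powr m \<le> t'" and t: "1 \<le> t" "t \<le> t'"
    and \<eta>: "0 < \<eta>" and \<eta>': "0 < \<eta>'" "\<eta>' \<le> \<eta>"
    and fin: "finite (set_pmf p)"
    and large: "\<And>y d. \<eta> \<le> d \<Longrightarrow> measure p (cball y d) \<le> t * (e * d powr s + C * d powr m)"
    and small: "\<And>y. measure p (cball y (H * \<eta>)) \<le> \<eta> powr s / H"
    and N1: "\<And>x z. x \<in> set_pmf p \<Longrightarrow> z \<in> set_pmf (N x) \<Longrightarrow> dist x z \<le> \<eta>"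
    and N2: "\<And>x y d. x \<in> set_pmf p \<Longrightarrow> \<eta>' \<le> d \<Longrightarrow> d \<le> \<eta> \<Longrightarrow> measure (N x) (cball y d) \<le> C0 * (d / \<eta>) powr s"
    and d: "\<eta>' \<le> d"
  shows "measure (bind_pmf p N) (cball y d) \<le> t' * (e * d powr s + C * d powr m)"
proof -
  let ?G = "\<lambda>d. e * d powr s + C * d powr m"
  have d0: "0 < d" using d \<eta>' by linarith
  have zero: "measure (N x) (cball y d) = 0" if "x \<in> set_pmf p" "x \<notin> cball y (d + \<eta>)" for x
  proof (rule measure_pmf_eq_0_if_disjoint, rule ccontr)
    assume "set_pmf (N x) \<inter> cball y d \<noteq> {}"
    then obtain z where z: "z \<in> set_pmf (N x)" "dist y z \<le> d" by auto
    have "dist y x \<le> d + \<eta>"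
      using N1[OF that(1) z(1)] z(2) dist_triangle[of y x z] by (simp add: dist_commute)
    with that show False by simp
  qed
  have triv: "measure (bind_pmf p N) (cball y d) \<le> measure p (cball y (d + \<eta>))"
    using measure_bind_pmf_le[OF fin, of N "cball y d" 1 "cball y (d + \<eta>)"] zero by simp
  have G0: "e * d powr s \<le> t' * ?G d"
  proof -
    have "e * d powr s \<le> 1 * ?G d" using C by simp
    also have "\<dots> \<le> t' * ?G d" using t e C by (intro mult_right_mono) auto
    finally show ?thesis .
  qed
  have inner: "measure p (cball y (d + \<eta>)) \<le> \<eta> powr s / H" if "d + \<eta> \<le> H * \<eta>"
  proof -
    have "measure p (cball y (d + \<eta>)) \<le> measure p (cball y (H * \<eta>))"
      using that by (intro measure_pmf.finite_measure_mono) auto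
    with small[of y] show ?thesis by linarith
  qed
  \<comment> \<open>In the first two cases the enlarged ball fits into radius H * \<eta>, where p is
    thin. This beats the factor \<open>C0\<close> at scales below \<eta>, since
    \<open>C0 / H \<le> e\<close>, and alone suffices at intermediate scales, since
    \<open>1 / H \<le> e\<close>.\<close>
  consider "d \<le> \<eta>" | "\<eta> < d" "d + \<eta> \<le> H * \<eta>" | "\<eta> < d" "H * \<eta> < d + \<eta>" by linarith
  then show ?thesis
  proof cases
    case 1
    have "2 * \<eta> \<le> H * \<eta>" using H \<eta> by (intro mult_right_mono) auto
    then have "d + \<eta> \<le> H * \<eta>" using 1 by linarith
    from inner[OF this] have "C0 * (d / \<eta>) powr s * measure p (cball y (d + \<eta>))
        \<le> C0 * (d / \<eta>) powr s * (\<eta> powr s / H)"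
      using C0 by (intro mult_left_mono) auto
    also have "\<dots> = C0 / H * d powr s"
      using d0 \<eta> by (simp add: powr_divide)
    also have "\<dots> \<le> e * d powr s"
      using H by (intro mult_right_mono) (auto simp: divide_le_eq)
    finally have "C0 * (d / \<eta>) powr s * measure p (cball y (d + \<eta>)) \<le> e * d powr s" .
    moreover have "measure (bind_pmf p N) (cball y d) \<le> C0 * (d / \<eta>) powr s * measure p (cball y (d + \<eta>))"
      using C0 N2[OF _ d 1] zero by (intro measure_bind_pmf_le[OF fin]) auto
    ultimately show ?thesis using G0 by linarith
  next
    case 2
    have "measure (bind_pmf p N) (cball y d) \<le> \<eta> powr s / H"
      using triv inner[OF 2(2)] by linarith
    also have "\<dots> \<le> d powr s / H"
      using 2 H \<eta> s by (intro divide_right_mono powr_mono2) auto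
    also have "\<dots> = 1 / H * d powr s" by simp
    also have "\<dots> \<le> e * d powr s"
      using H by (intro mult_right_mono) (auto simp: divide_le_eq)
    finally show ?thesis using G0 by linarith
  next
    case 3
    \<comment> \<open>Now \<eta> is at most d/(H - 1), so passing from d to d + \<eta> multiplies
      the radius by at most l, and \<open>l powr m\<close> dominates the loss in both terms of the
      bound.\<close>
    define l where "l = 1 + 1 / (H - 1)"
    have l: "1 \<le> l" using H by (simp add: l_def)
    have "(H - 1) * \<eta> \<le> d" using 3 by (simp add: algebra_simps)
    then have "\<eta> \<le> d / (H - 1)" using H by (simp add: field_simps)
    then have ld: "d + \<eta> \<le> l * d" by (simp add: l_def algebra_simps)
    have "measure (bind_pmf p N) (cball y d) \<le> measure p (cball y (l * d))"
    proof -
      have "measure p (cball y (d + \<eta>)) \<le> measure p (cball y (l * d))"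
        using subset_cball[OF ld, of y] by (intro measure_pmf.finite_measure_mono) auto
      with triv show ?thesis by linarith
    qed
    also have "\<dots> \<le> t * ?G (l * d)" using ld d0 by (intro large) linarith
    also have "\<dots> \<le> t * (l powr m * ?G d)"
    proof -
      have "l powr s \<le> l powr m" using l s by (intro powr_mono) auto
      then have "e * (l powr s * d powr s) \<le> e * (l powr m * d powr s)"
        using e by (intro mult_left_mono mult_right_mono) auto
      then have "?G (l * d) \<le> l powr m * ?G d"
        using l d0 by (simp add: powr_mult algebra_simps)
      then show ?thesis using t by (intro mult_left_mono) auto
    qed
    also have "\<dots> = t * l powr m * ?G d" by simp
    also have "\<dots> \<le> t' * ?G d"
      using H(4) e C unfolding l_def by (intro mult_right_mono) auto
    finally show ?thesis .
  qed
qed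

lemma powr_tendsto_0_at_right:
  fixes a :: real
  assumes "0 < a" shows "((\<lambda>x. x powr a) \<longlongrightarrow> 0) (at_right 0)"
  using assms by (intro tendsto_zero_powrI[OF tendsto_ident_at tendsto_const] eventually_mono[OF eventually_at_right_less]) auto

text \<open>Lets a covering set of diameter d, possibly 0, be put into an open ball of positive
  radius while the s-th power grows by at most \<tau>.\<close>

lemma ex_larger_radius:
  fixes d s \<tau> b :: real
  assumes "0 \<le> d" "d < b" "0 < s" "0 < \<tau>"
  shows "\<exists>r>d. r \<le> b \<and> r powr s \<le> d powr s + \<tau>"
proof -
  have "((\<lambda>r. r powr s) \<longlongrightarrow> d powr s) (at_right d)"
  proof (cases "d = 0")
    case True
    have "((\<lambda>r. r powr s) \<longlongrightarrow> 0 powr s) (at_right 0)"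
      using powr_tendsto_0_at_right[OF assms(3)] assms by simp
    then show ?thesis using True by simp
  next
    case False
    then show ?thesis by (intro tendsto_intros) auto
  qed
  then have "\<forall>\<^sub>F r in at_right d. r powr s < d powr s + \<tau>"
    using assms by (intro order_tendstoD) auto
  moreover have "\<forall>\<^sub>F r in at_right d. r < b"
    using assms(2) by (rule order_tendstoD(2)[OF tendsto_ident_at])
  moreover have "\<forall>\<^sub>F r in at_right d. d < r"
    by (rule eventually_at_right_less)
  ultimately have "\<forall>\<^sub>F r in at_right d. r powr s < d powr s + \<tau> \<and> r < b \<and> d < r"
    by (intro eventually_conj)
  then show ?thesis
    using eventually_happens'[OF trivial_limit_at_right_real] by (force intro: less_imp_le)
qed

text \<open>The Frostman bound is needed only at scales above \<open>\<eta> j\<close>, because a finite subcover has a smallest radius. No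
  limit measure is formed.\<close>

lemma hausdorff_content_ge:
  fixes E :: "nat \<Rightarrow> 'a::metric_space set" and p :: "nat \<Rightarrow> 'a pmf" and \<eta> :: "nat \<Rightarrow> real" and B s \<delta> :: real
  assumes comp: "compact (UNIV :: 'a set)" and s: "0 < s" and \<delta>: "0 < \<delta>" and B: "0 < B"
    and fin: "\<And>j. finite (set_pmf (p j))"
    and \<eta>: "\<And>j. 0 < \<eta> j" "\<eta> \<longlonglongrightarrow> 0"
    and nest: "\<And>j z. z \<in> set_pmf (p (Suc j)) \<Longrightarrow> \<exists>x\<in>set_pmf (p j). cball z (\<eta> (Suc j)) \<subseteq> cball x (\<eta> j) \<inter> E j"
    and frost: "\<And>j y d. \<eta> j \<le> d \<Longrightarrow> d \<le> 2 * \<delta> \<Longrightarrow> measure (p j) (cball y d) \<le> B * d powr s"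
  shows "ennreal (1 / B) \<le> hausdorff_content \<delta> s (\<Inter>k. E k)"
  unfolding hausdorff_content_def
proof (rule INF_greatest, rule ccontr)
  fix U :: "nat \<Rightarrow> 'a set"
  assume "U \<in> {U. (\<Inter>k. E k) \<subseteq> (\<Union>i. U i) \<and> (\<forall>i. bounded (U i) \<and> diameter (U i) \<le> \<delta>)}"
  then have cover: "(\<Inter>k. E k) \<subseteq> (\<Union>i. U i)" and bd: "\<And>i. bounded (U i)" and diam: "\<And>i. diameter (U i) \<le> \<delta>"
    by auto
  let ?d = "\<lambda>i. diameter (U i)"
  assume "\<not> ennreal (1 / B) \<le> (\<Sum>i. ennreal (?d i powr s))"
  then have lt: "(\<Sum>i. ennreal (?d i powr s)) < ennreal (1 / B)" by simp
  have "(\<Sum>i. ennreal (?d i powr s)) \<noteq> top"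
    using less_trans[OF lt ennreal_less_top] by (simp only: less_top)
  then have summ: "summable (\<lambda>i. ?d i powr s)"
    by (rule summable_suminf_not_top[rotated]) (rule powr_ge_zero)
  have "ennreal (\<Sum>i. ?d i powr s) < ennreal (1 / B)"
    using lt suminf_ennreal2[OF powr_ge_zero summ] by (simp only:)
  then have lt': "(\<Sum>i. ?d i powr s) < 1 / B"
    using suminf_nonneg[OF summ powr_ge_zero] by (simp only: ennreal_less_iff)
  define \<tau> where "\<tau> = 1 / B - (\<Sum>i. ?d i powr s)"
  have \<tau>: "0 < \<tau>" using lt' by (simp add: \<tau>_def)
  \<comment> \<open>The slack \<tau> is shared out among the covering sets; in total only \<tau>/2
    is spent, so the inequality stays strict.\<close>
  have geom: "(\<lambda>i. \<tau> * (1 / 2) ^ (i + 2)) sums (\<tau> / 2)"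
    using sums_mult[OF geometric_sums[of "1 / 2 :: real"], of "\<tau> / 4"] by (simp add: power_add mult_ac)
  have "\<exists>r>?d i. r \<le> 2 * \<delta> \<and> r powr s \<le> ?d i powr s + \<tau> * (1 / 2) ^ (i + 2)" for i
    using diam[of i] \<delta> s \<tau> bd[of i] by (intro ex_larger_radius diameter_ge_0) auto
  then obtain r where r: "\<And>i. ?d i < r i" "\<And>i. r i \<le> 2 * \<delta>"
    "\<And>i. r i powr s \<le> ?d i powr s + \<tau> * (1 / 2) ^ (i + 2)" by metis
  have r0: "0 < r i" for i using r(1)[of i] diameter_ge_0[OF bd[of i]] by linarith
  have "\<exists>y. U i \<subseteq> ball y (r i)" for i
  proof (cases "U i = {}")
    case False
    then obtain y where y: "y \<in> U i" by blast
    have "U i \<subseteq> ball y (r i)"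
      using diameter_bounded_bound[OF bd y] r(1)[of i] by (force simp: mem_ball)
    then show ?thesis ..
  qed simp
  then obtain y where y: "\<And>i. U i \<subseteq> ball (y i) (r i)" by metis
  define K where "K j = (\<Union>x\<in>set_pmf (p j). cball x (\<eta> j))" for j
  have K_step: "K (Suc j) \<subseteq> K j \<inter> E j" for j
  proof
    fix b assume "b \<in> K (Suc j)"
    then obtain z where z: "z \<in> set_pmf (p (Suc j))" "b \<in> cball z (\<eta> (Suc j))"
      by (auto simp: K_def)
    from nest[OF z(1)] z(2) show "b \<in> K j \<inter> E j" by (fastforce simp: K_def)
  qed
  have K_anti: "K n \<subseteq> K j" if "j \<le> n" for j n
    using that
  proof (induction rule: dec_induct)
    case (step i)
    with K_step[of i] show ?case by blast
  qed simp
  have K_closed: "closed (K j)" for j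
    unfolding K_def using fin by (intro closed_UN) auto
  define V where "V = (\<Union>i. ball (y i) (r i))"
  have compact: "compact S" if "closed S" for S :: "'a set"
    using closed_Int_compact[OF that comp] by (simp only: Int_UNIV_right)
  have UV: "(\<Union>i. U i) \<subseteq> V"
    unfolding V_def using y by (rule UN_mono[OF subset_refl])
  \<comment> \<open>Otherwise the closed sets \<open>K j - V\<close> have the finite intersection
    property. A common point lies in every \<open>E j\<close>, as \<open>K (Suc j)\<close> is inside
    \<open>E j\<close>, yet escapes the cover.\<close>
  have "\<exists>j. K j \<subseteq> V"
  proof (rule ccontr)
    assume neg: "\<nexists>j. K j \<subseteq> V"
    have "UNIV \<inter> (\<Inter>j\<in>UNIV. K j - V) \<noteq> {}"
    proof (rule compact_imp_fip_image[OF comp])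
      show "closed (K j - V)" for j
        unfolding V_def by (intro closed_Diff K_closed open_UN ballI open_ball)
      fix J :: "nat set" assume J: "finite J"
      obtain b where b: "b \<in> K (Max (insert 0 J))" "b \<notin> V" using neg by blast
      have "b \<in> K j" if "j \<in> J" for j
        using K_anti[of j "Max (insert 0 J)"] that J b(1) by auto
      with b(2) show "UNIV \<inter> (\<Inter>j\<in>J. K j - V) \<noteq> {}" by blast
    qed
    then obtain b where b: "\<And>j. b \<in> K j" "b \<notin> V" by blast
    have "b \<in> E j" for j using b(1)[of "Suc j"] K_step[of j] by blast
    then have "b \<in> (\<Inter>k. E k)" by blast
    with cover UV b(2) show False by blast
  qed
  then obtain j0 where j0: "K j0 \<subseteq> V" by blast
  obtain F where F: "finite F" "K j0 \<subseteq> (\<Union>i\<in>F. ball (y i) (r i))"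
    using compactE_image[OF compact[OF K_closed[of j0]], of UNIV "\<lambda>i. ball (y i) (r i)"] j0
    unfolding V_def by (metis open_ball)
  have "\<forall>\<^sub>F j in sequentially. \<forall>i\<in>F. \<eta> j \<le> r i"
  proof (intro eventually_ball_finite F(1) ballI)
    fix i
    show "\<forall>\<^sub>F j in sequentially. \<eta> j \<le> r i"
      using order_tendstoD(2)[OF \<eta>(2) r0[of i]] by eventually_elim simp
  qed
  then obtain j1 where j1: "\<And>j. j1 \<le> j \<Longrightarrow> \<forall>i\<in>F. \<eta> j \<le> r i"
    unfolding eventually_sequentially by blast
  \<comment> \<open>From \<open>j0\<close> on the support lies in the finite subcover, and from
    \<open>j1\<close> on the scale is below all of its radii, so the Frostman bound applies to each
    ball.\<close>
  define j where "j = max j0 j1"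
  have "set_pmf (p j) \<subseteq> K j" unfolding K_def using \<eta>(1)[of j] by (auto intro: less_imp_le)
  also have "\<dots> \<subseteq> K j0" by (intro K_anti) (simp add: j_def)
  finally have "set_pmf (p j) \<subseteq> (\<Union>i\<in>F. cball (y i) (r i))" using F(2) by force
  then have "AE x in p j. x \<in> (\<Union>i\<in>F. cball (y i) (r i))"
    unfolding AE_measure_pmf_iff by blast
  then have "1 \<le> measure (p j) (\<Union>i\<in>F. cball (y i) (r i))"
    by (simp add: measure_pmf.prob_eq_1[THEN iffD2])
  also have "\<dots> \<le> (\<Sum>i\<in>F. measure (p j) (cball (y i) (r i)))"
    using F(1) by (intro measure_pmf.finite_measure_subadditive_finite) auto
  also have "\<dots> \<le> (\<Sum>i\<in>F. B * r i powr s)"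
    using j1[of j] r(2) by (intro sum_mono frost) (auto simp: j_def)
  also have "\<dots> = B * (\<Sum>i\<in>F. r i powr s)" by (simp add: sum_distrib_left)
  also have "(\<Sum>i\<in>F. r i powr s) \<le> (\<Sum>i\<in>F. ?d i powr s + \<tau> * (1 / 2) ^ (i + 2))"
    by (intro sum_mono r)
  also have "\<dots> \<le> (\<Sum>i. ?d i powr s + \<tau> * (1 / 2) ^ (i + 2))"
    using summ \<tau> F(1) by (intro sum_le_suminf summable_add sums_summable[OF geom]) auto
  also have "\<dots> = (\<Sum>i. ?d i powr s) + \<tau> / 2"
    using suminf_add[OF summ sums_summable[OF geom]] sums_unique[OF geom] by simp
  finally have "1 \<le> B * ((\<Sum>i. ?d i powr s) + \<tau> / 2)" using B by simp
  moreover have "B * ((\<Sum>i. ?d i powr s) + \<tau> / 2) < B * (1 / B)"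
    using B \<tau> by (intro mult_strict_left_mono) (auto simp: \<tau>_def field_simps)
  ultimately show False using B by simp
qed

text \<open>Every atom of the current measure is replaced by a local measure from
  \<open>loc\<close>. The scale \<sigma> there precedes the quantifier over x, so all atoms of one
  stage share it. Each \<open>frostman_step\<close> absorbs \<open>C0\<close>, and the final bound
  involves only e and C.\<close>

lemma hausdorff_content_limsup_ge:
  fixes E :: "nat \<Rightarrow> 'a::metric_space set" and s m C C0 \<eta>0 e \<delta> :: real
  assumes comp: "compact (UNIV :: 'a set)" and s: "0 < s" "s < m" and C: "0 \<le> C" "0 \<le> C0" and \<eta>0: "0 < \<eta>0"
    and init: "\<And>\<epsilon>. 0 < \<epsilon> \<Longrightarrow> \<exists>\<eta> p. 0 < \<eta> \<and> \<eta> < \<epsilon> \<and> finite (set_pmf p) \<and>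
        (\<forall>y::'a. \<forall>d\<ge>\<eta>. measure (measure_pmf p) (cball y d) \<le> C * d powr m)"
    and loc: "\<And>\<eta> H k. 0 < \<eta> \<Longrightarrow> \<eta> < \<eta>0 \<Longrightarrow> 1 \<le> H \<Longrightarrow> \<exists>\<sigma>>0. \<sigma> \<le> \<eta> / 2 \<and> (\<forall>x. \<exists>\<nu>. finite (set_pmf \<nu>) \<and>
        (\<forall>z\<in>set_pmf \<nu>. cball z \<sigma> \<subseteq> cball x \<eta> \<inter> E k) \<and>
        (\<forall>y d. \<sigma> \<le> d \<longrightarrow> d \<le> \<eta> \<longrightarrow> measure (measure_pmf \<nu>) (cball y d) \<le> C0 * (d / \<eta>) powr s) \<and>
        (\<forall>y. measure (measure_pmf \<nu>) (cball y (H * \<sigma>)) \<le> \<sigma> powr s / H))"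
    and e: "0 < e" and \<delta>: "0 < \<delta>"
  shows "ennreal (1 / (2 * (e + C * (2 * \<delta>) powr (m - s)))) \<le> hausdorff_content \<delta> s (\<Inter>k. E k)"
proof -
  \<comment> \<open>Strictly increasing from 1, so each step has room to lose a factor above 1, but
    bounded by 2, the constant of the conclusion.\<close>
  define t where "t j = 2 - 1 / real (Suc j)" for j
  have t: "1 \<le> t j" "t j < t (Suc j)" "t j \<le> 2" for j by (auto simp: t_def field_simps)
  \<comment> \<open>All \<open>H j\<close> are fixed in advance: the measure built at stage j must
    already be thin at the radius that the factor \<open>H (Suc j)\<close> of the next stage
    prescribes.\<close>
  have "\<forall>j. \<exists>H\<ge>2. max (C0 / e) (1 / e) \<le> H \<and> t j * (1 + 1 / (H - 1)) powr m \<le> t (Suc j)"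
    using t by (intro allI ex_large_factor) (auto intro: less_le_trans[of 0 1])
  then obtain H where H': "\<And>j. 2 \<le> H j" "\<And>j. max (C0 / e) (1 / e) \<le> H j"
    "\<And>j. t j * (1 + 1 / (H j - 1)) powr m \<le> t (Suc j)" by metis
  have H: "C0 \<le> e * H j" "1 \<le> e * H j" for j
    using H'(2)[of j] e by (auto simp: field_simps)
  define P where "P j = (\<lambda>(\<eta>, p :: 'a pmf). 0 < \<eta> \<and> \<eta> < \<eta>0 \<and> finite (set_pmf p) \<and>
    (\<forall>y d. \<eta> \<le> d \<longrightarrow> measure p (cball y d) \<le> t j * (e * d powr s + C * d powr m)) \<and>
    (\<forall>y. measure p (cball y (H j * \<eta>)) \<le> \<eta> powr s / H j))" for j
  define Q where "Q j = (\<lambda>(\<eta>, p :: 'a pmf) (\<eta>', p'). \<eta>' \<le> \<eta> / 2 \<and>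
    (\<forall>z\<in>set_pmf p'. \<exists>x\<in>set_pmf p. cball z \<eta>' \<subseteq> cball x \<eta> \<inter> E j))" for j
  \<comment> \<open>Since m > s, the uniform bound \<open>C * (H 0 * \<eta>) powr m\<close> falls
    below \<open>\<eta> powr s / H 0\<close> once \<eta> is small.\<close>
  have base: "\<exists>f. P 0 f"
  proof -
    let ?h = "H 0"
    have h: "0 < ?h" using H'(1)[of 0] by linarith
    have "((\<lambda>\<eta>. C * ?h powr m * ?h * \<eta> powr (m - s)) \<longlongrightarrow> C * ?h powr m * ?h * 0) (at_right 0)"
      using s by (intro tendsto_mult tendsto_const powr_tendsto_0_at_right) simp
    then have "\<forall>\<^sub>F \<eta> in at_right 0. C * ?h powr m * ?h * \<eta> powr (m - s) < 1"
      by (intro order_tendstoD) auto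
    then obtain \<epsilon> where \<epsilon>: "0 < \<epsilon>" "\<And>\<eta>. 0 < \<eta> \<Longrightarrow> \<eta> < \<epsilon> \<Longrightarrow> C * ?h powr m * ?h * \<eta> powr (m - s) < 1"
      unfolding eventually_at_right_field by auto
    have "0 < min \<epsilon> \<eta>0" using \<epsilon>(1) \<eta>0 by simp
    from init[OF this] obtain \<eta> p where p0: "0 < \<eta> \<and> \<eta> < min \<epsilon> \<eta>0 \<and> finite (set_pmf p) \<and>
        (\<forall>y::'a. \<forall>d\<ge>\<eta>. measure (measure_pmf p) (cball y d) \<le> C * d powr m)"
      by (elim exE)
    then have p: "0 < \<eta>" "\<eta> < min \<epsilon> \<eta>0" "finite (set_pmf p)"
      "\<And>y d. \<eta> \<le> d \<Longrightarrow> measure (measure_pmf p) (cball y d) \<le> C * d powr m"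
      by simp_all
    have "measure p (cball y d) \<le> t 0 * (e * d powr s + C * d powr m)" if "\<eta> \<le> d" for y d
      using p(4)[OF that, of y] e by (simp add: t_def add_increasing)
    moreover have "measure p (cball y (?h * \<eta>)) \<le> \<eta> powr s / ?h" for y
    proof -
      have "1 * \<eta> \<le> ?h * \<eta>" using p(1) H'(1)[of 0] by (intro mult_right_mono) auto
      then have "measure p (cball y (?h * \<eta>)) \<le> C * (?h * \<eta>) powr m" by (intro p(4)) simp
      also have "\<dots> = (C * ?h powr m * ?h * \<eta> powr (m - s)) * (\<eta> powr s / ?h)"
        using p(1) h by (simp add: powr_mult powr_diff field_simps)
      also have "\<dots> \<le> 1 * (\<eta> powr s / ?h)"
        using \<epsilon>(2)[of \<eta>] p(1,2) h by (intro mult_right_mono) auto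
      finally show ?thesis by simp
    qed
    ultimately show ?thesis using p by (intro exI[of _ "(\<eta>, p)"]) (auto simp: P_def)
  qed
  have step: "\<exists>g. P (Suc j) g \<and> Q j f g" if "P j f" for f j
  proof -
    obtain \<eta> p where f: "f = (\<eta>, p)" by (cases f) blast
    from that have p: "0 < \<eta>" "\<eta> < \<eta>0" "finite (set_pmf p)"
      "\<And>y d. \<eta> \<le> d \<Longrightarrow> measure p (cball y d) \<le> t j * (e * d powr s + C * d powr m)"
      "\<And>y. measure p (cball y (H j * \<eta>)) \<le> \<eta> powr s / H j"
      by (auto simp: P_def f)
    have H1: "1 \<le> H (Suc j)" using H'(1)[of "Suc j"] by linarith
    from loc[OF p(1,2) H1, of j] obtain \<sigma> where \<sigma>: "0 < \<sigma>" "\<sigma> \<le> \<eta> / 2" and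
      "\<forall>x. \<exists>\<nu>. finite (set_pmf \<nu>) \<and>
      (\<forall>z\<in>set_pmf \<nu>. cball z \<sigma> \<subseteq> cball x \<eta> \<inter> E j) \<and>
      (\<forall>y d. \<sigma> \<le> d \<longrightarrow> d \<le> \<eta> \<longrightarrow> measure (measure_pmf \<nu>) (cball y d) \<le> C0 * (d / \<eta>) powr s) \<and>
      (\<forall>y. measure (measure_pmf \<nu>) (cball y (H (Suc j) * \<sigma>)) \<le> \<sigma> powr s / H (Suc j))"
      by blast
    then obtain N where N: "\<And>x. finite (set_pmf (N x))"
      "\<And>x z. z \<in> set_pmf (N x) \<Longrightarrow> cball z \<sigma> \<subseteq> cball x \<eta> \<inter> E j"
      "\<And>x y d. \<sigma> \<le> d \<Longrightarrow> d \<le> \<eta> \<Longrightarrow> measure (measure_pmf (N x)) (cball y d) \<le> C0 * (d / \<eta>) powr s"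
      "\<And>x y. measure (measure_pmf (N x)) (cball y (H (Suc j) * \<sigma>)) \<le> \<sigma> powr s / H (Suc j)"
      by metis
    let ?p = "bind_pmf p N"
    have near: "dist x z \<le> \<eta>" if "z \<in> set_pmf (N x)" for x z
    proof -
      have "z \<in> cball z \<sigma>" using \<sigma>(1) by simp
      with N(2)[OF that] show ?thesis by (auto simp only: Int_subset_iff subset_iff mem_cball)
    qed
    have \<sigma>': "\<sigma> \<le> \<eta>" using \<sigma> by linarith
    have "measure ?p (cball y d) \<le> t (Suc j) * (e * d powr s + C * d powr m)" if "\<sigma> \<le> d" for y d
      by (rule frostman_step[OF s e C H'(1) H H'(3) t(1) less_imp_le[OF t(2)] p(1) \<sigma>(1) \<sigma>' p(3) p(4) p(5) near N(3) that])
    moreover have "measure ?p (cball y (H (Suc j) * \<sigma>)) \<le> \<sigma> powr s / H (Suc j)" for y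
      using measure_bind_pmf_le[OF p(3), of N "cball y (H (Suc j) * \<sigma>)" "\<sigma> powr s / H (Suc j)" UNIV] N(4) H1
      by simp
    ultimately have "P (Suc j) (\<sigma>, ?p)" using p \<sigma> N(1) by (auto simp: P_def)
    moreover have "Q j f (\<sigma>, ?p)" using \<sigma> N(2) by (force simp: Q_def f)
    ultimately show ?thesis by blast
  qed
  have "\<exists>f. \<forall>j. P j (f j) \<and> Q j (f j) (f (Suc j))"
    by (rule dependent_nat_choice) (rule base, rule step)
  then obtain f where f: "\<And>j. P j (f j)" "\<And>j. Q j (f j) (f (Suc j))" by metis
  define \<eta> where "\<eta> j = fst (f j)" for j
  define p where "p j = snd (f j)" for j
  have fj: "f j = (\<eta> j, p j)" for j by (simp add: \<eta>_def p_def)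
  have P: "0 < \<eta> j" "finite (set_pmf (p j))"
    "\<And>y d. \<eta> j \<le> d \<Longrightarrow> measure (p j) (cball y d) \<le> t j * (e * d powr s + C * d powr m)" for j
    using f(1)[of j] unfolding P_def fj by auto
  have Q: "\<eta> (Suc j) \<le> \<eta> j / 2" "\<And>z. z \<in> set_pmf (p (Suc j)) \<Longrightarrow> \<exists>x\<in>set_pmf (p j). cball z (\<eta> (Suc j)) \<subseteq> cball x (\<eta> j) \<inter> E j" for j
    using f(2)[of j] unfolding Q_def fj by auto
  have \<eta>_le: "\<eta> j \<le> \<eta> 0 * (1 / 2) ^ j" for j
  proof (induction j)
    case (Suc j)
    then show ?case using Q(1)[of j] by simp
  qed simp
  have "(\<lambda>j. \<eta> 0 * (1 / 2) ^ j) \<longlonglongrightarrow> \<eta> 0 * 0"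
    by (intro tendsto_mult tendsto_const LIMSEQ_power_zero) simp
  then have lim: "\<eta> \<longlonglongrightarrow> 0"
    using P(1) \<eta>_le by (intro tendsto_sandwich[of "\<lambda>_. 0" \<eta> sequentially "\<lambda>j. \<eta> 0 * (1 / 2) ^ j"])
      (auto intro!: always_eventually less_imp_le)
  show ?thesis
  proof (rule hausdorff_content_ge[OF comp s(1) \<delta> _ P(2) P(1) lim Q(2)])
    show "0 < 2 * (e + C * (2 * \<delta>) powr (m - s))"
      using e C by (intro mult_pos_pos add_pos_nonneg) auto
    fix j y d assume d: "\<eta> j \<le> d" "d \<le> 2 * \<delta>"
    have d0: "0 < d" using d P(1)[of j] by linarith
    have "measure (p j) (cball y d) \<le> t j * (e * d powr s + C * d powr m)" by (rule P(3)[OF d(1)])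
    also have "\<dots> \<le> 2 * (e * d powr s + C * d powr m)"
      using t(3)[of j] e C by (intro mult_right_mono) auto
    also have "d powr m = d powr (m - s) * d powr s"
      using d0 by (simp flip: powr_add)
    also have "2 * (e * d powr s + C * (d powr (m - s) * d powr s)) \<le> 2 * (e * d powr s + C * ((2 * \<delta>) powr (m - s) * d powr s))"
      using d d0 s C by (intro mult_left_mono add_mono mult_right_mono powr_mono2) auto
    finally show "measure (p j) (cball y d) \<le> 2 * (e + C * (2 * \<delta>) powr (m - s)) * d powr s"
      by (simp add: algebra_simps)
  qed
qed

text \<open>Both e and, because s < m, the power of \<delta> can be made arbitrarily small, so the
  lower bound for the content is unbounded. Each e comes with its own sequence of measures.\<close>

lemma hausdorff_measure_eq_infinity:
  fixes E :: "nat \<Rightarrow> 'a::metric_space set" and s m C C0 \<eta>0 :: real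
  assumes comp: "compact (UNIV :: 'a set)" and s: "0 < s" "s < m" and C: "0 \<le> C" "0 \<le> C0" and \<eta>0: "0 < \<eta>0"
    and init: "\<And>\<epsilon>. 0 < \<epsilon> \<Longrightarrow> \<exists>\<eta> p. 0 < \<eta> \<and> \<eta> < \<epsilon> \<and> finite (set_pmf p) \<and>
        (\<forall>y::'a. \<forall>d\<ge>\<eta>. measure (measure_pmf p) (cball y d) \<le> C * d powr m)"
    and loc: "\<And>\<eta> H k. 0 < \<eta> \<Longrightarrow> \<eta> < \<eta>0 \<Longrightarrow> 1 \<le> H \<Longrightarrow> \<exists>\<sigma>>0. \<sigma> \<le> \<eta> / 2 \<and> (\<forall>x. \<exists>\<nu>. finite (set_pmf \<nu>) \<and>
        (\<forall>z\<in>set_pmf \<nu>. cball z \<sigma> \<subseteq> cball x \<eta> \<inter> E k) \<and>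
        (\<forall>y d. \<sigma> \<le> d \<longrightarrow> d \<le> \<eta> \<longrightarrow> measure (measure_pmf \<nu>) (cball y d) \<le> C0 * (d / \<eta>) powr s) \<and>
        (\<forall>y. measure (measure_pmf \<nu>) (cball y (H * \<sigma>)) \<le> \<sigma> powr s / H))"
  shows "hausdorff_measure s (\<Inter>k. E k) = \<infinity>"
proof -
  have content: "ennreal (1 / (2 * (e + C * (2 * \<delta>) powr (m - s)))) \<le> hausdorff_content \<delta> s (\<Inter>k. E k)"
    if "0 < e" "0 < \<delta>" for e \<delta>
    using comp s C \<eta>0 init loc that by (rule hausdorff_content_limsup_ge)
  have large: "ennreal (real n) \<le> hausdorff_measure s (\<Inter>k. E k)" for n
  proof -
    \<comment> \<open>Once \<delta> makes the second term smaller than e, the content is at least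
      1/(4e) = n + 1.\<close>
    define e where "e = 1 / (4 * (real n + 1))"
    have e: "0 < e" by (simp add: e_def)
    have "((\<lambda>\<delta>. C * 2 powr (m - s) * \<delta> powr (m - s)) \<longlongrightarrow> C * 2 powr (m - s) * 0) (at_right 0)"
      using s by (intro tendsto_mult tendsto_const powr_tendsto_0_at_right) simp
    then have "\<forall>\<^sub>F \<delta> in at_right 0. C * 2 powr (m - s) * \<delta> powr (m - s) < e"
      using e by (intro order_tendstoD) auto
    then have "\<forall>\<^sub>F \<delta> in at_right 0. C * 2 powr (m - s) * \<delta> powr (m - s) < e \<and> 0 < \<delta>"
      by (intro eventually_conj eventually_at_right_less)
    then obtain \<delta> where "C * 2 powr (m - s) * \<delta> powr (m - s) < e" and \<delta>0: "0 < \<delta>"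
      using eventually_happens'[OF trivial_limit_at_right_real] by blast
    then have \<delta>: "C * (2 * \<delta>) powr (m - s) < e" "0 < \<delta>"
      by (auto simp: powr_mult mult.assoc)
    have pos: "0 < e + C * (2 * \<delta>) powr (m - s)" using e C by (intro add_pos_nonneg) auto
    have "real n \<le> 1 / (4 * e)" by (simp add: e_def)
    also have "\<dots> \<le> 1 / (2 * (e + C * (2 * \<delta>) powr (m - s)))"
      using \<delta>(1) pos by (intro divide_left_mono) auto
    finally have "ennreal (real n) \<le> ennreal (1 / (2 * (e + C * (2 * \<delta>) powr (m - s))))"
      by (rule ennreal_leI)
    also have "\<dots> \<le> hausdorff_content \<delta> s (\<Inter>k. E k)" by (rule content[OF e \<delta>(2)])
    also have "\<dots> \<le> hausdorff_measure s (\<Inter>k. E k)"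
      unfolding hausdorff_measure_def using \<delta>(2) by (intro SUP_upper) auto
    finally show ?thesis .
  qed
  have "(SUP n. of_nat n :: ennreal) \<le> hausdorff_measure s (\<Inter>k. E k)"
    using large by (intro SUP_least) (simp add: ennreal_of_nat_eq_real_of_nat)
  then show ?thesis by (simp add: ennreal_SUP_of_nat_eq_top top_unique)
qed

section \<open>Uniform measures on the torus\<close>

lemma torus_cases:
  obtains b where "y = to_torus b"
  using Quotient3_abs_rep[OF Quotient3_torus, of y] by metis

text \<open>Integer shifts lift the points near y into a cube of the vector space, where separation
  allows at most one of them per cell of side \<sigma>.\<close>

lemma card_separated_le:
  fixes x :: "'i \<Rightarrow> real ^ 'm" and \<sigma> d :: real
  assumes "finite I" and sep: "\<And>i j. i \<in> I \<Longrightarrow> j \<in> I \<Longrightarrow> i \<noteq> j \<Longrightarrow> \<sigma> < lattice_norm (x i - x j)"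
    and \<sigma>: "0 < \<sigma>" "\<sigma> \<le> d"
  shows "card {i \<in> I. lattice_norm (x i - y) \<le> d} \<le> (6 * d / \<sigma>) ^ CARD('m)"
proof -
  let ?S = "{i \<in> I. lattice_norm (x i - y) \<le> d}"
  have "\<forall>i\<in>?S. \<exists>p. p \<in> int_vecs \<and> infnorm (x i - y - p) \<le> d"
    unfolding lattice_norm_le_iff by blast
  from bchoice[OF this] obtain P where
    P: "\<And>i. i \<in> ?S \<Longrightarrow> P i \<in> int_vecs \<and> infnorm (x i - y - P i) \<le> d" by blast
  define f where "f i = cell \<sigma> (x i - y - P i)" for i
  have "inj_on f ?S"
  proof (rule inj_onI, rule ccontr)
    fix i j assume ij: "i \<in> ?S" "j \<in> ?S" "f i = f j" "i \<noteq> j"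
    have "infnorm ((x i - y - P i) - (x j - y - P j)) \<le> \<sigma>"
      using ij(3) \<sigma> unfolding f_def by (intro cell_eq_imp_close)
    moreover have "(x i - y - P i) - (x j - y - P j) = x i - x j - (P i - P j)" by simp
    ultimately have "infnorm (x i - x j - (P i - P j)) \<le> \<sigma>" by (simp only:)
    moreover have "P i - P j \<in> int_vecs" using P ij by (intro int_vecs_diff) auto
    ultimately have "lattice_norm (x i - x j) \<le> \<sigma>"
      unfolding lattice_norm_le_iff by blast
    with sep[of i j] ij show False by auto
  qed
  moreover have "f ` ?S \<subseteq> cells (2 * d) \<sigma>"
  proof clarify
    fix i assume "i \<in> I" "lattice_norm (x i - y) \<le> d"
    then have "infnorm (x i - y - P i) \<le> d" using P[of i] by blast
    then have "infnorm (x i - y - P i) \<le> 2 * d" using \<sigma> by linarith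
    then show "f i \<in> cells (2 * d) \<sigma>" using \<sigma> unfolding f_def by (intro cell_in_cells)
  qed
  ultimately have "card ?S \<le> card (cells (2 * d) \<sigma> :: ('m \<Rightarrow> int) set)"
    using card_inj_on_le finite_cells by blast
  then show ?thesis
    using card_cells_le[OF \<sigma>, where 'k = 'm] by linarith
qed

text \<open>A discrete stand-in for normalised volume on a cube of side \<delta> with corner c,
  accurate at scales not below the grid spacing.\<close>

lemma ex_uniform_pmf:
  fixes c :: "real ^ 'm" and \<delta> :: real
  assumes \<delta>: "0 < \<delta>" "\<delta> \<le> 1" and M: "0 < M"
  obtains p where "finite (set_pmf p)" "\<And>z. z \<in> set_pmf p \<Longrightarrow> dist (to_torus c) z \<le> \<delta>"
    "\<And>y d. \<delta> / real M \<le> d \<Longrightarrow> measure (measure_pmf p) (cball y d) \<le> (12 * d / \<delta>) ^ CARD('m)"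
proof
  define f where "f g = to_torus (c + grid_point \<delta> M g)" for g :: "'m \<Rightarrow> nat"
  define p where "p = map_pmf f (pmf_of_set (grid M))"
  have ne: "(grid M :: ('m \<Rightarrow> nat) set) \<noteq> {}"
    using card_grid[of M, where 'm = 'm] M by (metis card.empty less_nat_zero_code power_eq_0_iff)
  have set: "set_pmf p = f ` grid M"
    unfolding p_def by (simp add: set_pmf_of_set[OF ne finite_grid])
  then show "finite (set_pmf p)" by (simp only: finite_imageI[OF finite_grid])
  show "dist (to_torus c) z \<le> \<delta>" if "z \<in> set_pmf p" for z
  proof -
    from that obtain g where g: "g \<in> grid M" "z = f g" unfolding set by (rule imageE)
    have "\<bar>grid_point \<delta> M g $ i\<bar> \<le> \<delta>" for i
    proof -
      have "g i < M" using PiE_mem[OF g(1)[unfolded grid_def], of i] by simp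
      moreover have "0 \<le> \<delta> / real M" using \<delta> by simp
      ultimately have "\<delta> / real M * real (g i) \<le> \<delta> / real M * real M"
        by (intro mult_left_mono) simp_all
      then have "\<delta> / real M * real (g i) \<le> \<delta>" using M by simp
      moreover have "0 \<le> \<delta> / real M * real (g i)" using \<delta> by simp
      ultimately show ?thesis unfolding grid_point_def by simp
    qed
    then have "infnorm (grid_point \<delta> M g) \<le> \<delta>" by (simp add: infnorm_le_iff)
    then have "lattice_norm (c - (c + grid_point \<delta> M g)) \<le> \<delta>"
      using lattice_norm_le_infnorm[of "grid_point \<delta> M g"] lattice_norm_minus_commute[of c "c + grid_point \<delta> M g"]
      by (simp only: add_diff_cancel_left')
    then show ?thesis unfolding g f_def dist_to_torus .
  qed
  show "measure (measure_pmf p) (cball y d) \<le> (12 * d / \<delta>) ^ CARD('m)" if d: "\<delta> / real M \<le> d" for y d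
  proof -
    obtain b where b: "y = to_torus b" by (rule torus_cases)
    let ?S = "{g \<in> grid M. lattice_norm (c + grid_point \<delta> M g - b) \<le> d}"
    have "measure (measure_pmf p) (cball y d) = card (grid M \<inter> f -` cball y d) / card (grid M :: ('m \<Rightarrow> nat) set)"
      unfolding p_def measure_map_pmf by (rule measure_pmf_of_set[OF ne finite_grid])
    also have "grid M \<inter> f -` cball y d = ?S"
      unfolding f_def b vimage_def mem_cball dist_to_torus lattice_norm_minus_commute[of b]
      by (simp only: Int_def mem_Collect_eq)
    finally have eq: "measure (measure_pmf p) (cball y d) = card ?S / real M ^ CARD('m)"
      by (simp add: card_grid)
    \<comment> \<open>\<open>card_separated_le\<close> asks for strict separation, so half the
      spacing is used; this doubles its constant 6 to 12.\<close>
    have M': "0 < \<delta> / (2 * real M)" using \<delta> M by simp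
    have half: "\<delta> / (2 * real M) < \<delta> / real M" using \<delta> M by (intro divide_strict_left_mono) auto
    have "card ?S \<le> (6 * d / (\<delta> / (2 * real M))) ^ CARD('m)"
    proof (rule card_separated_le[OF finite_grid])
      fix g h :: "'m \<Rightarrow> nat" assume "g \<in> grid M" "h \<in> grid M" "g \<noteq> h"
      from grid_point_separated[OF this \<delta> M]
      have "\<delta> / real M \<le> lattice_norm (c + grid_point \<delta> M g - (c + grid_point \<delta> M h))" by simp
      with half show "\<delta> / (2 * real M) < lattice_norm (c + grid_point \<delta> M g - (c + grid_point \<delta> M h))"
        by linarith
    qed (use M' half d in linarith)+
    also have "6 * d / (\<delta> / (2 * real M)) = 12 * d / \<delta> * real M" by simp
    finally have "real (card ?S) \<le> (12 * d / \<delta>) ^ CARD('m) * real M ^ CARD('m)"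
      by (simp only: power_mult_distrib)
    then show ?thesis unfolding eq using M by (simp only: pos_divide_le_eq zero_less_power of_nat_0_less_iff)
  qed
qed

lemma compact_UNIV_torus: "compact (UNIV :: ('m::finite) torus set)"
proof -
  have "continuous_on UNIV (to_torus :: real ^ 'm \<Rightarrow> 'm torus)"
  proof (rule continuous_onI)
    fix x :: "real ^ 'm" and e :: real assume "0 < e"
    have "dist (to_torus x') (to_torus x) \<le> dist x' x" for x' :: "real ^ 'm"
      unfolding dist_to_torus dist_norm
      using lattice_norm_le_infnorm[of "x' - x"] infnorm_le_norm[of "x' - x"] by linarith
    then show "\<exists>d>0. \<forall>x'\<in>UNIV. dist x' x < d \<longrightarrow> dist (to_torus x') (to_torus x) \<le> e"
      using \<open>0 < e\<close> by (intro exI[of _ e]) (meson less_imp_le order_trans)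
  qed
  moreover have "to_torus ` (cbox 0 1 :: (real ^ 'm) set) = UNIV"
  proof -
    have "y \<in> to_torus ` (cbox 0 1 :: (real ^ 'm) set)" for y :: "'m torus"
    proof -
      obtain b where b: "y = to_torus b" by (rule torus_cases)
      define b' :: "real ^ 'm" where "b' = (\<chi> i. frac (b $ i))"
      have "b - b' \<in> int_vecs" by (simp add: b'_def int_vecs_def frac_def)
      then have "y = to_torus b'" unfolding b by (simp add: torus.abs_eq_iff)
      moreover have "b' \<in> cbox 0 1"
        by (auto simp: b'_def mem_box_cart less_imp_le[OF frac_lt_1])
      ultimately show ?thesis by blast
    qed
    then show ?thesis by blast
  qed
  ultimately show ?thesis
    by (metis compact_cbox compact_continuous_image continuous_on_subset subset_UNIV)
qed

section \<open>Geometric sums over finite sets of levels, and finitely supported measures\<close>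

lemma sum_geometric_decreasing:
  fixes f :: "nat \<Rightarrow> real"
  assumes K: "finite K" and \<rho>: "0 \<le> \<rho>" "\<rho> < 1" and r: "0 \<le> r"
    and f: "\<And>k l. k \<in> K \<Longrightarrow> l \<in> K \<Longrightarrow> k \<le> l \<Longrightarrow> f l \<le> \<rho> ^ (l - k) * f k" "\<And>k. k \<in> K \<Longrightarrow> f k \<le> r"
  shows "sum f K \<le> r / (1 - \<rho>)"
proof (cases "K = {}")
  case False
  define k0 where "k0 = Min K"
  have k0: "k0 \<in> K" "\<And>l. l \<in> K \<Longrightarrow> k0 \<le> l" using K False by (auto simp: k0_def)
  have "sum f K \<le> (\<Sum>l\<in>K. r * \<rho> ^ (l - k0))"
  proof (rule sum_mono)
    fix l assume l: "l \<in> K"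
    have "f l \<le> \<rho> ^ (l - k0) * f k0" using f(1)[OF k0(1) l] k0(2)[OF l] by simp
    also have "\<dots> \<le> \<rho> ^ (l - k0) * r" using f(2)[OF k0(1)] \<rho> by (intro mult_left_mono) auto
    finally show "f l \<le> r * \<rho> ^ (l - k0)" by (simp add: mult.commute)
  qed
  also have "\<dots> = r * (\<Sum>j\<in>(\<lambda>l. l - k0) ` K. \<rho> ^ j)"
    using k0(2) by (subst sum.reindex) (auto simp: inj_on_def sum_distrib_left eq_diff_iff)
  also have "\<dots> \<le> r * (\<Sum>j. \<rho> ^ j)"
    using \<rho> r K by (intro mult_left_mono sum_le_suminf summable_geometric) auto
  also have "\<dots> = r / (1 - \<rho>)" using \<rho> by (simp add: suminf_geometric)
  finally show ?thesis .
qed (use \<rho> r in auto)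

text \<open>Reflecting K in its maximum reduces this to the decreasing case.\<close>

lemma sum_geometric_increasing:
  fixes f :: "nat \<Rightarrow> real"
  assumes K: "finite K" and \<rho>: "0 \<le> \<rho>" "\<rho> < 1" and r: "0 \<le> r"
    and f: "\<And>k l. k \<in> K \<Longrightarrow> l \<in> K \<Longrightarrow> k \<le> l \<Longrightarrow> f k \<le> \<rho> ^ (l - k) * f l" "\<And>k. k \<in> K \<Longrightarrow> f k \<le> r"
  shows "sum f K \<le> r / (1 - \<rho>)"
proof (cases "K = {}")
  case False
  define k1 where "k1 = Max K"
  have k1: "k1 \<in> K" "\<And>l. l \<in> K \<Longrightarrow> l \<le> k1" using K False by (auto simp: k1_def)
  have inj: "inj_on (\<lambda>l. k1 - l) K"
    using k1(2) by (intro inj_onI) (metis diff_diff_cancel)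
  have "sum f ((\<lambda>l. k1 - l) ` ((\<lambda>l. k1 - l) ` K)) \<le> r / (1 - \<rho>)"
  proof -
    have "(\<lambda>l. k1 - l) ` ((\<lambda>l. k1 - l) ` K) = K"
      using k1(2) by (force simp: image_image image_iff)
    moreover have "sum f K = (\<Sum>j\<in>(\<lambda>l. k1 - l) ` K. f (k1 - j))"
      using k1(2) by (subst sum.reindex[OF inj]) (auto intro!: sum.cong)
    moreover have "(\<Sum>j\<in>(\<lambda>l. k1 - l) ` K. f (k1 - j)) \<le> r / (1 - \<rho>)"
    proof (rule sum_geometric_decreasing[OF _ \<rho> r])
      fix i j assume "i \<in> (\<lambda>l. k1 - l) ` K" "j \<in> (\<lambda>l. k1 - l) ` K" and le: "i \<le> j"
      then obtain k l where kl: "k \<in> K" "l \<in> K" "i = k1 - k" "j = k1 - l" by blast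
      then have "l \<le> k" "k \<le> k1" "l \<le> k1" using le k1(2)[of k] k1(2)[of l] by linarith+
      then show "f (k1 - j) \<le> \<rho> ^ (j - i) * f (k1 - i)"
        using f(1)[OF kl(2,1)] kl by simp
    next
      fix i assume "i \<in> (\<lambda>l. k1 - l) ` K"
      then show "f (k1 - i) \<le> r" using f(2) k1(2) by auto
    qed (use K in auto)
    ultimately show ?thesis by simp
  qed
  moreover have "(\<lambda>l. k1 - l) ` ((\<lambda>l. k1 - l) ` K) = K"
    using k1(2) by (force simp: image_image image_iff)
  ultimately show ?thesis by simp
qed (use \<rho> r in auto)

lemma ex_weighted_pmf:
  fixes w :: "'i \<Rightarrow> real"
  assumes I: "finite I" "I \<noteq> {}" and w: "\<And>i. i \<in> I \<Longrightarrow> 0 < w i"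
  obtains p where "set_pmf p = I" "\<And>i. i \<in> I \<Longrightarrow> pmf p i = w i / sum w I"
proof -
  have pos: "0 < sum w I" using I w by (intro sum_pos) auto
  define f where "f i = (if i \<in> I then w i / sum w I else 0)" for i
  have nn: "0 \<le> f i" for i
    using w[of i] pos by (cases "i \<in> I") (simp_all add: f_def)
  have "(\<integral>\<^sup>+ i. ennreal (f i) \<partial>count_space UNIV) = (\<Sum>i\<in>I. ennreal (f i))"
    using I by (intro nn_integral_count_space') (auto simp: f_def)
  also have "\<dots> = ennreal (\<Sum>i\<in>I. f i)" using nn by (simp add: sum_ennreal)
  also have "(\<Sum>i\<in>I. f i) = 1"
    using pos by (simp add: f_def flip: sum_divide_distrib)
  finally have one: "(\<integral>\<^sup>+ i. ennreal (f i) \<partial>count_space UNIV) = 1" by simp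
  have "pmf (embed_pmf f) i = f i" for i by (rule pmf_embed_pmf[OF nn one])
  then have pmf: "pmf (embed_pmf f) i = w i / sum w I" if "i \<in> I" for i
    using that by (simp add: f_def)
  have "f i \<noteq> 0 \<longleftrightarrow> i \<in> I" for i
    using w[of i] pos by (cases "i \<in> I") (simp_all add: f_def)
  then have "set_pmf (embed_pmf f) = I"
    using set_embed_pmf[OF nn one] by simp
  from that[OF this pmf] show ?thesis .
qed

lemma measure_bind_pmf_finite:
  assumes "finite (set_pmf p)"
  shows "measure (measure_pmf (bind_pmf p N)) S = (\<Sum>i\<in>set_pmf p. pmf p i * measure (measure_pmf (N i)) S)"
proof -
  have "ennreal (measure (measure_pmf (bind_pmf p N)) S) = (\<integral>\<^sup>+x. emeasure (N x) S \<partial>p)"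
    by (simp only: measure_pmf.emeasure_eq_measure[symmetric] emeasure_bind_pmf)
  also have "\<dots> = (\<Sum>i\<in>set_pmf p. emeasure (N i) S * ennreal (pmf p i))"
    by (rule nn_integral_measure_pmf_finite[OF assms]) simp
  also have "\<dots> = (\<Sum>i\<in>set_pmf p. ennreal (pmf p i * measure (N i) S))"
    by (simp add: measure_pmf.emeasure_eq_measure ennreal_mult mult.commute)
  also have "\<dots> = ennreal (\<Sum>i\<in>set_pmf p. pmf p i * measure (N i) S)"
    by (rule sum_ennreal) simp
  finally show ?thesis
    by (subst (asm) ennreal_inj) (simp_all add: sum_nonneg)
qed

section \<open>The divergence case\<close>

text \<open>In the application \<open>D k = \<psi>(2\<^sup>k)\<close>, \<open>F k = \<psi>(2\<^sup>k)\<^bsup>s/m\<^esup>\<close>, \<open>\<beta> k\<close> is the mass of an orbit point of level \<open>k\<close>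
  and \<open>a k\<close> is the general term of the divergent series.\<close>

locale dyadic_scales =
  fixes A :: "real ^ 'n ^ 'm" and D :: "nat \<Rightarrow> real" and s \<rho> :: real and k0 :: nat
  assumes D_pos: "\<And>k. 0 < D k"
    and rho: "0 < \<rho>" "\<rho> < 1"
    and s: "0 < s" "s < CARD('m)"
    and D_decay: "\<And>k. k0 \<le> k \<Longrightarrow> D (Suc k) \<le> \<rho> * D k"
    and D_small: "\<And>k. k0 \<le> k \<Longrightarrow> D k powr (s / CARD('m)) \<le> 1 / 2"
begin

definition \<theta> :: real where "\<theta> = s / CARD('m)"

definition F :: "nat \<Rightarrow> real" where "F k = D k powr \<theta>"

definition N :: "nat \<Rightarrow> real" where "N k = card (hits A (F k) (2 ^ k))"

definition \<beta> :: "nat \<Rightarrow> real" where "\<beta> k = D k powr s / N k"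

definition a :: "nat \<Rightarrow> real" where "a k = \<beta> k * (2 ^ k) ^ CARD('n)"

text \<open>The constant of \<open>card_hits_packing\<close>, inherited by all scaling
  bounds.\<close>

definition c6 :: real where "c6 = 6 ^ (CARD('m) + CARD('n))"

lemma c6: "1 \<le> c6" unfolding c6_def by simp

lemma theta: "0 < \<theta>" "\<theta> < 1" using s unfolding \<theta>_def by simp_all

lemma F_pos: "0 < F k" unfolding F_def using D_pos[of k] by simp

lemma F_half: "k0 \<le> k \<Longrightarrow> F k \<le> 1 / 2" unfolding F_def \<theta>_def by (rule D_small)

text \<open>The source of the exponent s/m: the volume of a ball of radius \<open>F k\<close> is, up
  to constants, the s-mass of a ball of radius \<open>D k\<close>.\<close>

lemma F_pow: "F k ^ CARD('m) = D k powr s"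
proof -
  have "F k ^ CARD('m) = F k powr CARD('m)" using F_pos[of k] by (simp add: powr_realpow)
  also have "\<dots> = D k powr s" unfolding F_def \<theta>_def by (simp add: powr_powr)
  finally show ?thesis .
qed

lemma D_le_F: "k0 \<le> k \<Longrightarrow> D k \<le> F k"
proof -
  assume k: "k0 \<le> k"
  have "D k \<le> 1"
  proof (rule ccontr)
    assume "\<not> D k \<le> 1"
    then have "1 \<le> D k powr \<theta>" using theta by (intro ge_one_powr_ge_zero) auto
    with F_half[OF k] show False unfolding F_def by simp
  qed
  then have "D k powr 1 \<le> D k powr \<theta>"
    using theta D_pos[of k] by (intro powr_mono') auto
  then show ?thesis unfolding F_def using D_pos[of k] by simp
qed

lemma N_pos: "0 < N k"
  unfolding N_def using card_hits_pos[of "F k" "2 ^ k" A] F_pos[of k] by simp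

lemma beta_pos: "0 < \<beta> k" unfolding \<beta>_def using N_pos[of k] D_pos[of k] by simp

lemma beta_N: "\<beta> k * N k = D k powr s" unfolding \<beta>_def using N_pos[of k] by simp

lemma a_pos: "0 < a k" unfolding a_def using beta_pos[of k] by simp

lemma D_decay':
  assumes "k0 \<le> k" "k \<le> l" shows "D l \<le> \<rho> ^ (l - k) * D k"
  using assms(2)
proof (induction l rule: dec_induct)
  case (step l)
  have "D (Suc l) \<le> \<rho> * D l" using step assms(1) by (intro D_decay) simp
  also have "\<dots> \<le> \<rho> * (\<rho> ^ (l - k) * D k)" using step rho by (intro mult_left_mono) auto
  also have "\<dots> = \<rho> ^ (Suc l - k) * D k" using step by (simp add: Suc_diff_le)
  finally show ?case .
qed simp

lemma D_powr_decay:
  assumes "0 \<le> e" "k0 \<le> k" "k \<le> l" shows "D l powr e \<le> (\<rho> powr e) ^ (l - k) * D k powr e"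
proof -
  have "D l powr e \<le> (\<rho> ^ (l - k) * D k) powr e"
    using D_decay'[OF assms(2,3)] D_pos[of l] assms(1) by (intro powr_mono2) auto
  also have "\<dots> = (\<rho> ^ (l - k)) powr e * D k powr e"
    by (rule powr_mult)
  also have "(\<rho> ^ (l - k)) powr e = (\<rho> powr e) ^ (l - k)"
    using rho by (simp add: powr_powr mult.commute flip: powr_realpow)
  finally show ?thesis .
qed

lemma card_le_N:
  assumes "F k \<le> r" "1 \<le> c" "0 < c"
  shows "card (hits A r (c * 2 ^ k)) \<le> c6 * (r / F k) ^ CARD('m) * c ^ CARD('n) * N k"
  using card_hits_scale[of "F k" r "2 ^ k" "c * 2 ^ k" A] assms F_pos[of k]
  by (simp add: c6_def N_def)

text \<open>About J copies of the neighbourhood of size \<open>(F k, 2 ^ k)\<close> add up inside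
  the one of size \<open>(r, 2 ^ l)\<close>. As the latter is not everything,
  \<open>card_hits_not_dense\<close> gains a factor J over volume scaling. Against the pigeonhole
  lower bound for the same count this leaves J * \<open>a k\<close> bounded, because
  \<open>N k / (F k ^ CARD('m) * (2 ^ k) ^ CARD('n))\<close> is the inverse of
  \<open>a k\<close>.\<close>

lemma a_le_not_dense:
  assumes k: "k0 \<le> k" "k \<le> l" and r: "F k \<le> r" "r \<le> 1 / 2" and nd: "reach A r (2 ^ l) \<noteq> UNIV"
  shows "a k \<le> 4 * c6\<^sup>2 * max (F k / r) (2 ^ k / 2 ^ l)"
proof -
  let ?T = "(2::real) ^ l" and ?T' = "(2::real) ^ k"
  have r0: "0 < r" using r F_pos[of k] by linarith
  \<comment> \<open>The largest admissible multiple, limited by radius and by height. Its floor J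
    satisfies \<mu> \<le> 2J, which accounts for one factor 2 of the 4; the other comes from
    \<open>card_hits_not_dense\<close>.\<close>
  define \<mu> where "\<mu> = min (r / F k) (?T / ?T')"
  have mu1: "1 \<le> \<mu>" unfolding \<mu>_def using r F_pos[of k] k by (simp add: power_increasing)
  define J where "J = nat \<lfloor>\<mu>\<rfloor>"
  have fl: "1 \<le> \<lfloor>\<mu>\<rfloor>" using mu1 by linarith
  then have Jreal: "real J = of_int \<lfloor>\<mu>\<rfloor>" unfolding J_def by linarith
  have J: "0 < J" "real J \<le> \<mu>" "\<mu> \<le> 2 * real J"
    using fl Jreal by linarith+
  have "real J \<le> r / F k" "real J \<le> ?T / ?T'" using J(2) unfolding \<mu>_def by linarith+
  then have "real J * F k \<le> r" "real J * ?T' \<le> ?T" using F_pos[of k] by (simp_all add: pos_le_divide_eq)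
  then have "real J * card (hits A r ?T)
      \<le> 2 * (6 ^ (CARD('m) + CARD('n)) * (r / F k) ^ CARD('m) * (?T / ?T') ^ CARD('n) * card (hits A (F k) ?T'))"
    using nd F_pos[of k] J by (intro card_hits_not_dense) simp_all
  then have 1: "real J * card (hits A r ?T) \<le> 2 * (c6 * (r / F k) ^ CARD('m) * (?T / ?T') ^ CARD('n) * N k)"
    unfolding c6_def N_def .
  have 2: "r ^ CARD('m) * ?T ^ CARD('n) \<le> c6 * card (hits A r ?T)"
    unfolding c6_def using r r0 by (intro card_hits_lower) simp_all
  let ?V = "r ^ CARD('m) * ?T ^ CARD('n)"
  have V: "0 < ?V" using r0 by simp
  have "real J * ?V \<le> real J * (c6 * card (hits A r ?T))"
    using 2 by (intro mult_left_mono) simp_all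
  also have "\<dots> = c6 * (real J * card (hits A r ?T))" by simp
  also have "\<dots> \<le> c6 * (2 * (c6 * (r / F k) ^ CARD('m) * (?T / ?T') ^ CARD('n) * N k))"
    using 1 c6 by (intro mult_left_mono) simp_all
  also have "\<dots> = 2 * c6\<^sup>2 * (?V * (N k / (F k ^ CARD('m) * ?T' ^ CARD('n))))"
    by (simp add: power_divide power2_eq_square)
  also have "\<dots> = ?V * (2 * c6\<^sup>2 * (N k / (F k ^ CARD('m) * ?T' ^ CARD('n))))"
    by simp
  finally have "?V * real J \<le> ?V * (2 * c6\<^sup>2 * (N k / (F k ^ CARD('m) * ?T' ^ CARD('n))))"
    by (simp only: mult.commute)
  then have "real J \<le> 2 * c6\<^sup>2 * (N k / (F k ^ CARD('m) * ?T' ^ CARD('n)))"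
    using V by (simp only: mult_le_cancel_left_pos)
  also have "N k / (F k ^ CARD('m) * ?T' ^ CARD('n)) = 1 / a k"
    using N_pos[of k] D_pos[of k] by (simp add: a_def \<beta>_def F_pow)
  finally have "real J * a k \<le> 2 * c6\<^sup>2"
    using a_pos[of k] by (simp add: pos_le_divide_eq)
  moreover have "\<mu> * a k \<le> 2 * real J * a k" using J a_pos[of k] by (intro mult_right_mono) simp_all
  ultimately have "\<mu> * a k \<le> 4 * c6\<^sup>2" by linarith
  then have "a k \<le> 4 * c6\<^sup>2 * (1 / \<mu>)" using mu1 by (simp add: pos_le_divide_eq mult.commute)
  also have "1 / \<mu> = max (F k / r) (?T' / ?T)"
  proof -
    have inv: "1 / (r / F k) = F k / r" "1 / (?T / ?T') = ?T' / ?T" by simp_all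
    have pos: "0 < r / F k" "0 < ?T / ?T'" using r0 F_pos[of k] by simp_all
    show ?thesis
    proof (cases "r / F k \<le> ?T / ?T'")
      case True
      then have "1 / (?T / ?T') \<le> 1 / (r / F k)"
        by (rule divide_left_mono[OF _ _ mult_pos_pos[OF pos(2,1)]]) simp
      with True show ?thesis unfolding \<mu>_def inv by (simp add: min_def max_def)
    next
      case False
      then have "1 / (r / F k) \<le> 1 / (?T / ?T')"
        by (intro divide_left_mono[OF _ _ mult_pos_pos[OF pos(1,2)]]) simp_all
      with False show ?thesis unfolding \<mu>_def inv by (simp add: min_def max_def)
    qed
  qed
  finally show ?thesis .
qed

lemma F_powr: "F k powr e = D k powr (\<theta> * e)"
  unfolding F_def by (simp add: powr_powr)

text \<open>Product of the constants of \<open>card_hits_upper\<close> and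
  \<open>a_le_not_dense\<close>.\<close>

definition C1 :: real where "C1 = 4 * c6 ^ 3 * 2 ^ CARD('n)"

text \<open>The two summands are the sums of the geometric series arising from the two entries of
  the maximum in \<open>a_le_not_dense\<close>, raised to the power 1 - \<theta>.\<close>

definition C2 :: real where
  "C2 = C1 * (1 / (1 - \<rho> powr (\<theta> * (1 - \<theta>))) + 1 / (1 - (1 / 2) powr (1 - \<theta>)))"

lemma rho_powr: "0 < e \<Longrightarrow> 0 \<le> \<rho> powr e \<and> \<rho> powr e < 1"
  using rho powr_less_mono'[of \<rho> 0 e] by simp

lemma c6_le_C1: "c6 \<le> C1"
proof -
  have "c6 \<le> c6 ^ 3" using c6 power_increasing[of 1 3 c6] by simp
  moreover have "1 * c6 ^ 3 \<le> (4 * 2 ^ CARD('n)) * c6 ^ 3"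
  proof (rule mult_right_mono)
    show "1 \<le> 4 * (2 :: real) ^ CARD('n)"
      using one_le_power[of "2::real" "CARD('n)"] by linarith
  qed (use c6 in simp)
  ultimately have "c6 \<le> 4 * 2 ^ CARD('n) * c6 ^ 3" by simp
  then show ?thesis unfolding C1_def by (simp only: mult_ac)
qed

lemma C2_nonneg: "0 \<le> C2"
proof -
  have "\<rho> powr (\<theta> * (1 - \<theta>)) < 1" using rho_powr[of "\<theta> * (1 - \<theta>)"] theta by simp
  moreover have "((1 / 2) powr (1 - \<theta>) :: real) < 1"
    using theta powr_less_mono'[of "1/2" 0 "1 - \<theta>"] by simp
  moreover have "0 \<le> C1" using c6 c6_le_C1 by linarith
  ultimately show ?thesis unfolding C2_def by simp
qed

text \<open>Each summand is bounded both by \<open>r\<^sup>m\<close> and by the geometrically varying \<open>u k\<close>; the product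
  \<open>(r\<^sup>m)\<^bsup>\<theta>\<^esup> (u k)\<^bsup>1 - \<theta>\<^esup>\<close> of powers, with \<open>\<theta> = s / m\<close>, sums geometrically to a multiple of \<open>r\<^sup>s\<close>.\<close>

lemma sum_not_dense_le:
  assumes K: "finite K" "\<And>k. k \<in> K \<Longrightarrow> k0 \<le> k" and r: "r \<le> 1 / 2" "0 < r"
    and Kr: "\<And>k. k \<in> K \<Longrightarrow> F k \<le> r" "\<And>k. k \<in> K \<Longrightarrow> reach A r (2 ^ k) \<noteq> UNIV"
  shows "(\<Sum>k\<in>K. \<beta> k * card (hits A r (2 ^ k))) \<le> C2 * r powr s"
proof (cases "K = {}")
  case False
  \<comment> \<open>Every level of K is compared with the top one, where density also fails; the
    height ratio then decays geometrically away from the top.\<close>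
  define l where "l = Max K"
  have l: "l \<in> K" "\<And>k. k \<in> K \<Longrightarrow> k \<le> l" using K(1) False by (simp_all add: l_def)
  define u where "u k = max (F k / r) (2 ^ k / 2 ^ l)" for k
  have C1: "0 < C1" using c6 c6_le_C1 by linarith
  have u: "0 < u k" for k unfolding u_def by (simp add: less_max_iff_disj)
  have tm: "\<beta> k * card (hits A r (2 ^ k)) \<le> C1 * (r powr s * u k powr (1 - \<theta>))" if k: "k \<in> K" for k
  proof -
    let ?t = "\<beta> k * card (hits A r (2 ^ k))"
    \<comment> \<open>First bound: scale the count down to radius \<open>F k\<close>, where
      \<open>\<beta> k * N k\<close> equals \<open>F k ^ CARD('m)\<close>; only the volume of the
      r-ball remains.\<close>
    have "?t \<le> \<beta> k * (c6 * (r / F k) ^ CARD('m) * 1 ^ CARD('n) * N k)"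
      using card_le_N[OF Kr(1)[OF k], of 1] beta_pos[of k] by (intro mult_left_mono) simp_all
    also have "\<dots> = c6 * (r / F k) ^ CARD('m) * (\<beta> k * N k)" by simp
    also have "\<dots> = c6 * r ^ CARD('m)"
      unfolding beta_N F_pow[symmetric] using F_pos[of k] by (simp add: power_divide)
    also have "\<dots> \<le> C1 * r ^ CARD('m)" using c6_le_C1 r by (intro mult_right_mono) simp_all
    finally have A1: "?t \<le> C1 * r ^ CARD('m)" .
    \<comment> \<open>Second bound: estimate the count by the trivial number of q, which turns the
      summand into \<open>a k\<close>, and use failure of density.\<close>
    have "real (card (hits A r (2 ^ k))) \<le> c6 * (2 * 2 ^ k) ^ CARD('n)"
      unfolding c6_def using one_le_power[of "2::real" k] by (intro card_hits_upper) linarith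
    then have "?t \<le> \<beta> k * (c6 * (2 * 2 ^ k) ^ CARD('n))"
      using beta_pos[of k] by (intro mult_left_mono) simp_all
    also have "\<dots> = c6 * 2 ^ CARD('n) * a k" unfolding a_def by (simp add: power_mult_distrib)
    also have "\<dots> \<le> c6 * 2 ^ CARD('n) * (4 * c6\<^sup>2 * u k)"
      using a_le_not_dense[OF K(2)[OF k] l(2)[OF k] Kr(1)[OF k] r(1) Kr(2)[OF l(1)]] c6
      unfolding u_def by (intro mult_left_mono) simp_all
    also have "\<dots> = C1 * u k" unfolding C1_def by (simp add: power2_eq_square power3_eq_cube)
    finally have A2: "?t \<le> C1 * u k" .
    have t0: "0 \<le> ?t" using beta_pos[of k] by simp
    define v where "v = ?t / C1"
    have v: "0 \<le> v" "v \<le> r ^ CARD('m)" "v \<le> u k"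
      unfolding v_def using A1 A2 t0 C1 by (simp_all add: pos_divide_le_eq mult.commute)
    have "v = v powr \<theta> * v powr (1 - \<theta>)" using v(1) by (simp flip: powr_add)
    also have "\<dots> \<le> (r ^ CARD('m)) powr \<theta> * u k powr (1 - \<theta>)"
      using v theta by (intro mult_mono powr_mono2) simp_all
    also have "(r ^ CARD('m)) powr \<theta> = r powr s"
      using r unfolding \<theta>_def by (simp add: powr_powr flip: powr_realpow)
    finally show ?thesis unfolding v_def using C1 by (simp add: pos_divide_le_eq mult_ac)
  qed
  have "(\<Sum>k\<in>K. \<beta> k * card (hits A r (2 ^ k))) \<le> (\<Sum>k\<in>K. C1 * (r powr s * u k powr (1 - \<theta>)))"
    by (intro sum_mono tm)
  also have "\<dots> = C1 * r powr s * (\<Sum>k\<in>K. u k powr (1 - \<theta>))" by (simp add: sum_distrib_left mult_ac)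
  also have "\<dots> \<le> C1 * r powr s * (1 / (1 - \<rho> powr (\<theta> * (1 - \<theta>))) + 1 / (1 - (1 / 2) powr (1 - \<theta>)))"
  proof (rule mult_left_mono)
    \<comment> \<open>The maximum is replaced by a sum because its two entries vary in opposite
      directions: \<open>F k / r\<close> is controlled from the lowest level upwards and the height
      ratio from the highest level downwards.\<close>
    have "(\<Sum>k\<in>K. u k powr (1 - \<theta>)) \<le> (\<Sum>k\<in>K. (F k / r) powr (1 - \<theta>) + ((1 / 2) ^ (l - k)) powr (1 - \<theta>))"
    proof (rule sum_mono)
      fix k assume k: "k \<in> K"
      have "(2::real) ^ k / 2 ^ l = (1 / 2) ^ (l - k)"
        using power_diff[of "2::real" k l] l(2)[OF k] by (simp add: power_divide)
      then have "u k powr (1 - \<theta>) = (F k / r) powr (1 - \<theta>) \<or> u k powr (1 - \<theta>) = ((1 / 2) ^ (l - k)) powr (1 - \<theta>)"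
        unfolding u_def max_def by presburger
      moreover have "0 \<le> (F k / r) powr (1 - \<theta>)" "0 \<le> ((1 / 2::real) ^ (l - k)) powr (1 - \<theta>)" by simp_all
      ultimately show "u k powr (1 - \<theta>) \<le> (F k / r) powr (1 - \<theta>) + ((1 / 2) ^ (l - k)) powr (1 - \<theta>)"
        by linarith
    qed
    also have "\<dots> = (\<Sum>k\<in>K. (F k / r) powr (1 - \<theta>)) + (\<Sum>k\<in>K. ((1 / 2) ^ (l - k)) powr (1 - \<theta>))"
      by (rule sum.distrib)
    also have "\<dots> \<le> 1 / (1 - \<rho> powr (\<theta> * (1 - \<theta>))) + 1 / (1 - (1 / 2) powr (1 - \<theta>))"
    proof (rule add_mono)
      have e: "0 < \<theta> * (1 - \<theta>)" using theta by simp
      have half: "((1 / 2) powr (1 - \<theta>) :: real) < 1"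
        using theta powr_less_mono'[of "1/2" 0 "1 - \<theta>"] by simp
      show "(\<Sum>k\<in>K. (F k / r) powr (1 - \<theta>)) \<le> 1 / (1 - \<rho> powr (\<theta> * (1 - \<theta>)))"
      proof (rule sum_geometric_decreasing[OF K(1)])
        fix i j assume ij: "i \<in> K" "j \<in> K" "i \<le> j"
        have "(F j / r) powr (1 - \<theta>) = D j powr (\<theta> * (1 - \<theta>)) / r powr (1 - \<theta>)"
          using F_pos[of j] r by (simp add: powr_divide F_powr)
        also have "\<dots> \<le> (\<rho> powr (\<theta> * (1 - \<theta>))) ^ (j - i) * D i powr (\<theta> * (1 - \<theta>)) / r powr (1 - \<theta>)"
          using D_powr_decay[OF less_imp_le[OF e] K(2)[OF ij(1)] ij(3)] by (intro divide_right_mono) simp_all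
        also have "\<dots> = (\<rho> powr (\<theta> * (1 - \<theta>))) ^ (j - i) * (F i / r) powr (1 - \<theta>)"
          using F_pos[of i] r by (simp add: powr_divide F_powr)
        finally show "(F j / r) powr (1 - \<theta>) \<le> (\<rho> powr (\<theta> * (1 - \<theta>))) ^ (j - i) * (F i / r) powr (1 - \<theta>)" .
      next
        fix k assume "k \<in> K"
        then have "F k / r \<le> 1" using Kr(1) r by simp
        then show "(F k / r) powr (1 - \<theta>) \<le> 1"
          using F_pos[of k] r theta by (intro powr_le1) simp_all
      qed (use rho_powr[OF e] in simp_all)
      show "(\<Sum>k\<in>K. ((1 / 2) ^ (l - k)) powr (1 - \<theta>)) \<le> 1 / (1 - (1 / 2) powr (1 - \<theta>))"
      proof (rule sum_geometric_increasing[OF K(1)])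
        fix i j assume ij: "i \<in> K" "j \<in> K" "i \<le> j"
        have eq: "((1 / 2 :: real) ^ n) powr (1 - \<theta>) = ((1 / 2) powr (1 - \<theta>)) ^ n" for n
          by (simp add: powr_powr mult.commute flip: powr_realpow)
        have "l - i = (j - i) + (l - j)" using ij l(2)[OF ij(2)] by simp
        then show "((1 / 2) ^ (l - i)) powr (1 - \<theta>) \<le> ((1 / 2) powr (1 - \<theta>)) ^ (j - i) * ((1 / 2) ^ (l - j)) powr (1 - \<theta>)"
          unfolding eq by (simp add: power_add)
      next
        fix k assume "k \<in> K"
        show "((1 / 2 :: real) ^ (l - k)) powr (1 - \<theta>) \<le> 1"
          using theta by (intro powr_le1) (simp_all add: power_le_one)
      qed (use half in simp_all)
    qed
    finally show "(\<Sum>k\<in>K. u k powr (1 - \<theta>)) \<le> 1 / (1 - \<rho> powr (\<theta> * (1 - \<theta>))) + 1 / (1 - (1 / 2) powr (1 - \<theta>))" .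
  qed (use C1 in simp)
  also have "\<dots> = C2 * r powr s" unfolding C2_def by (simp only: mult_ac)
  finally show ?thesis .
qed (simp add: C2_nonneg)

end

section \<open>The mass that a finite set of levels gives to one ball\<close>

context dyadic_scales
begin

definition C3 :: real where "C3 = c6 * 4 ^ CARD('m) * 2 ^ CARD('n)"

lemma C3_nonneg: "0 \<le> C3" unfolding C3_def using c6 by simp

text \<open>At a dense level the orbit is equidistributed at scale r up to constants, so the ball
  gets its volume share of \<open>a k\<close>. The remaining levels are the critical ones of
  \<open>sum_not_dense_le\<close>.\<close>

lemma sum_hits_le:
  assumes K: "finite K" "\<And>k. k \<in> K \<Longrightarrow> k0 \<le> k" and r: "r \<le> 1 / 2" "0 < r"
    and Kr: "\<And>k. k \<in> K \<Longrightarrow> F k \<le> r"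
  shows "(\<Sum>k\<in>K. \<beta> k * card (hits A r (2 ^ k))) \<le> C3 * (r ^ CARD('m) * sum a K) + C2 * r powr s"
proof -
  define G where "G = {k \<in> K. reach A r (2 ^ k) = UNIV}"
  have G: "finite G" "G \<subseteq> K" using K(1) unfolding G_def by simp_all
  have "\<beta> k * card (hits A r (2 ^ k)) \<le> C3 * r ^ CARD('m) * a k" if k: "k \<in> G" for k
  proof -
    have "(1::real) / 2 \<le> 2 ^ k" using one_le_power[of "2::real" k] by linarith
    then have "real (card (hits A r (2 ^ k))) \<le> 6 ^ (CARD('m) + CARD('n)) * (4 * r) ^ CARD('m) * (2 * 2 ^ k) ^ CARD('n)"
      using k r unfolding G_def by (intro card_hits_dense) simp_all
    then have "\<beta> k * card (hits A r (2 ^ k)) \<le> \<beta> k * (c6 * (4 * r) ^ CARD('m) * (2 * 2 ^ k) ^ CARD('n))"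
      unfolding c6_def using beta_pos[of k] by (intro mult_left_mono) simp_all
    also have "\<dots> = C3 * r ^ CARD('m) * a k"
      unfolding a_def C3_def by (simp only: power_mult_distrib mult_ac)
    finally show ?thesis .
  qed
  then have "(\<Sum>k\<in>G. \<beta> k * card (hits A r (2 ^ k))) \<le> (\<Sum>k\<in>G. C3 * r ^ CARD('m) * a k)"
    by (rule sum_mono)
  also have "\<dots> = C3 * r ^ CARD('m) * sum a G" by (simp only: sum_distrib_left)
  also have "\<dots> \<le> C3 * r ^ CARD('m) * sum a K"
    using C3_nonneg r a_pos K G by (intro mult_left_mono sum_mono2) (simp_all add: less_imp_le)
  finally have 1: "(\<Sum>k\<in>G. \<beta> k * card (hits A r (2 ^ k))) \<le> C3 * r ^ CARD('m) * sum a K" .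
  have 2: "(\<Sum>k\<in>K - G. \<beta> k * card (hits A r (2 ^ k))) \<le> C2 * r powr s"
    using K Kr by (intro sum_not_dense_le[OF _ _ r]) (simp_all add: G_def)
  have "(\<Sum>k\<in>K. \<beta> k * card (hits A r (2 ^ k)))
      = (\<Sum>k\<in>K - G. \<beta> k * card (hits A r (2 ^ k))) + (\<Sum>k\<in>G. \<beta> k * card (hits A r (2 ^ k)))"
    by (rule sum.subset_diff[OF G(2) K(1)])
  with 1 2 show ?thesis by (simp add: mult.assoc)
qed

lemma sum_small_scales_le:
  assumes K: "finite K" "\<And>k. k \<in> K \<Longrightarrow> k0 \<le> k" and r: "0 < r" and Kr: "\<And>k. k \<in> K \<Longrightarrow> D k \<le> r"
  shows "(\<Sum>k\<in>K. D k powr s) \<le> r powr s / (1 - \<rho> powr s)"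
proof (rule sum_geometric_decreasing[OF K(1)])
  show "D l powr s \<le> (\<rho> powr s) ^ (l - k) * D k powr s" if "k \<in> K" "l \<in> K" "k \<le> l" for k l
    using D_powr_decay[OF less_imp_le[OF s(1)] K(2)[OF that(1)] that(3)] .
  show "D k powr s \<le> r powr s" if "k \<in> K" for k
    using Kr[OF that] D_pos[of k] s by (intro powr_mono2) simp_all
qed (use rho_powr[OF s(1)] in simp_all)

text \<open>The summand is a constant times \<open>r ^ CARD('m) * D k powr (s - CARD('m))\<close>.
  As s < m it grows with the level, and it stays below \<open>r powr s\<close> as long as
  \<open>D k\<close> exceeds r. The 48 is the constant of the fills.\<close>

lemma sum_large_scales_le:
  assumes K: "finite K" "\<And>k. k \<in> K \<Longrightarrow> k0 \<le> k" and r: "0 < r" and Kr: "\<And>k. k \<in> K \<Longrightarrow> r < D k"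
  shows "(\<Sum>k\<in>K. D k powr s * (48 * r / D k) ^ CARD('m))
    \<le> 48 ^ CARD('m) * r powr s / (1 - \<rho> powr (CARD('m) - s))"
proof -
  let ?e = "CARD('m) - s"
  have e: "0 < ?e" using s by simp
  have eq: "D k powr s * (48 * r / D k) ^ CARD('m) = 48 ^ CARD('m) * (r ^ CARD('m) * D k powr - ?e)" for k
    using D_pos[of k] by (simp add: power_divide power_mult_distrib powr_diff powr_realpow)
  have "(\<Sum>k\<in>K. r ^ CARD('m) * D k powr - ?e) \<le> r powr s / (1 - \<rho> powr ?e)"
  proof (rule sum_geometric_increasing[OF K(1)])
    fix k l assume kl: "k \<in> K" "l \<in> K" "k \<le> l"
    have "D l powr ?e \<le> (\<rho> powr ?e) ^ (l - k) * D k powr ?e"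
      by (rule D_powr_decay[OF less_imp_le[OF e] K(2)[OF kl(1)] kl(3)])
    then have "1 / D k powr ?e \<le> (\<rho> powr ?e) ^ (l - k) / D l powr ?e"
      using D_pos[of k] D_pos[of l] by (simp add: field_simps)
    then have "D k powr - ?e \<le> (\<rho> powr ?e) ^ (l - k) * D l powr - ?e"
      unfolding powr_minus_divide by simp
    then have "r ^ CARD('m) * D k powr - ?e \<le> r ^ CARD('m) * ((\<rho> powr ?e) ^ (l - k) * D l powr - ?e)"
      using r by (intro mult_left_mono) simp_all
    then show "r ^ CARD('m) * D k powr - ?e \<le> (\<rho> powr ?e) ^ (l - k) * (r ^ CARD('m) * D l powr - ?e)"
      by (simp only: mult.left_commute)
  next
    fix k assume k: "k \<in> K"
    have "r ^ CARD('m) * D k powr - ?e \<le> r ^ CARD('m) * r powr - ?e"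
      using Kr[OF k] r e by (intro mult_left_mono powr_mono2') simp_all
    also have "\<dots> = r powr s" using r by (simp flip: powr_realpow powr_add)
    finally show "r ^ CARD('m) * D k powr - ?e \<le> r powr s" .
  qed (use rho_powr[OF e] in simp_all)
  then show ?thesis unfolding eq sum_distrib_left[symmetric]
    by (metis mult_left_mono times_divide_eq_right zero_le_power zero_le_numeral)
qed

text \<open>With radius 2^k/8 two elements differ by at most 2^k/4, so differences are hits of
  height \<open>2 ^ k\<close>, and a block around a suitable centre stays in one dyadic
  shell.\<close>

definition block :: "real ^ 'n \<Rightarrow> nat \<Rightarrow> (real ^ 'n) set" where
  "block c k = {q \<in> int_vecs. infnorm (q - c) \<le> 2 ^ k / 8}"

text \<open>A fill charges the ball only if its orbit point is within r + \<open>D k / 4\<close> of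
  x, and differences of such q are hits of twice that radius.\<close>

lemma sum_fill_le:
  fixes \<mu> :: "real ^ 'n \<Rightarrow> 'm torus pmf" and b r :: real
  assumes Q: "Q \<subseteq> block c k" "finite Q"
    and supp: "\<And>q z. z \<in> set_pmf (\<mu> q) \<Longrightarrow> dist (to_torus (A *v q)) z \<le> D k / 4"
    and le: "\<And>q. q \<in> Q \<Longrightarrow> measure (measure_pmf (\<mu> q)) (cball (to_torus x) r) \<le> b" and b: "0 \<le> b"
  shows "(\<Sum>q\<in>Q. measure (measure_pmf (\<mu> q)) (cball (to_torus x) r)) \<le> card (hits A (2 * r + D k / 2) (2 ^ k)) * b"
proof -
  let ?B = "cball (to_torus x) r"
  define P where "P = Q \<inter> near A c (2 ^ k / 8) x (r + D k / 4)"
  have P: "finite P" "P \<subseteq> Q" unfolding P_def using Q(2) by simp_all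
  have zero: "measure (measure_pmf (\<mu> q)) ?B = 0" if q: "q \<in> Q - P" for q
  proof (rule measure_pmf_eq_0_if_disjoint, rule ccontr)
    assume "set_pmf (\<mu> q) \<inter> ?B \<noteq> {}"
    then obtain z where z: "z \<in> set_pmf (\<mu> q)" "dist (to_torus x) z \<le> r" by auto
    have "dist (to_torus (A *v q)) (to_torus x) \<le> r + D k / 4"
      using dist_triangle2[of "to_torus (A *v q)" "to_torus x" z] supp[OF z(1)] z(2) by linarith
    then have "q \<in> P"
      using q Q(1) unfolding P_def near_def block_def dist_to_torus by auto
    with q show False by simp
  qed
  have "(\<Sum>q\<in>Q. measure (measure_pmf (\<mu> q)) ?B) = (\<Sum>q\<in>P. measure (measure_pmf (\<mu> q)) ?B)"
    using zero by (intro sum.mono_neutral_right Q P) simp_all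
  also have "\<dots> \<le> (\<Sum>q\<in>P. b)" using le P(2) by (intro sum_mono) blast
  also have "\<dots> = card P * b" by simp
  also have "\<dots> \<le> card (hits A (2 * r + D k / 2) (2 ^ k)) * b"
  proof -
    have "card P \<le> card (near A c (2 ^ k / 8) x (r + D k / 4))"
      unfolding P_def by (intro card_mono finite_near) simp
    also have "\<dots> \<le> card (hits A (2 * (r + D k / 4)) (2 * (2 ^ k / 8)))" by (rule card_near_le)
    also have "\<dots> \<le> card (hits A (2 * r + D k / 2) (2 ^ k))"
      by (intro card_hits_mono) simp_all
    finally have "card P \<le> card (hits A (2 * r + D k / 2) (2 ^ k))" .
    then show ?thesis using b by (intro mult_right_mono) simp_all
  qed
  finally show ?thesis .
qed

lemma hits_3_le:
  assumes r: "0 < r" and D: "D k \<le> r"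
  shows "card (hits A (2 * r + D k / 2) (2 ^ k)) \<le> c6 * 3 ^ CARD('m) * card (hits A r (2 ^ k))"
proof -
  have "real (card (hits A (2 * r + D k / 2) (2 ^ k))) \<le> card (hits A (3 * r) (2 ^ k))"
    using D r by (intro of_nat_mono card_hits_mono) simp_all
  also have "\<dots> \<le> 6 ^ (CARD('m) + CARD('n)) * (3 * r / r) ^ CARD('m) * (2 ^ k / 2 ^ k) ^ CARD('n) * card (hits A r (2 ^ k))"
    using r by (intro card_hits_scale) simp_all
  finally show ?thesis using r by (simp add: c6_def)
qed

text \<open>Below radius \<open>F k\<close> the number of fills met is at most a constant times
  \<open>N k\<close>, and the weights were chosen so that \<open>\<beta> k * N k\<close> is
  \<open>D k powr s\<close>.\<close>

lemma fill_term_le: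
  fixes \<mu> :: "real ^ 'n \<Rightarrow> 'm torus pmf" and b r :: real
  assumes Q: "Q \<subseteq> block c k" "finite Q" and k: "k0 \<le> k" and r: "r < F k" "0 < r"
    and supp: "\<And>q z. z \<in> set_pmf (\<mu> q) \<Longrightarrow> dist (to_torus (A *v q)) z \<le> D k / 4"
    and le: "\<And>q. q \<in> Q \<Longrightarrow> measure (measure_pmf (\<mu> q)) (cball (to_torus x) r) \<le> b" and b: "0 \<le> b"
  shows "\<beta> k * (\<Sum>q\<in>Q. measure (measure_pmf (\<mu> q)) (cball (to_torus x) r)) \<le> c6 * 3 ^ CARD('m) * (D k powr s * b)"
proof -
  have "real (card (hits A (2 * r + D k / 2) (2 ^ k))) \<le> card (hits A (2 * F k + D k / 2) (2 ^ k))"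
    using r by (intro of_nat_mono card_hits_mono) simp_all
  also have "\<dots> \<le> c6 * 3 ^ CARD('m) * N k"
    unfolding N_def by (rule hits_3_le[OF F_pos D_le_F[OF k]])
  finally have n: "real (card (hits A (2 * r + D k / 2) (2 ^ k))) \<le> c6 * 3 ^ CARD('m) * N k" .
  have "(\<Sum>q\<in>Q. measure (measure_pmf (\<mu> q)) (cball (to_torus x) r)) \<le> card (hits A (2 * r + D k / 2) (2 ^ k)) * b"
    by (rule sum_fill_le[OF Q supp le b])
  also have "\<dots> \<le> c6 * 3 ^ CARD('m) * N k * b" using n b by (rule mult_right_mono)
  finally have "\<beta> k * (\<Sum>q\<in>Q. measure (measure_pmf (\<mu> q)) (cball (to_torus x) r)) \<le> \<beta> k * (c6 * 3 ^ CARD('m) * N k * b)"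
    using beta_pos[of k] by (intro mult_left_mono) simp_all
  also have "\<dots> = c6 * 3 ^ CARD('m) * ((\<beta> k * N k) * b)" by (simp only: mult_ac)
  finally show ?thesis unfolding beta_N .
qed

definition C4 :: real where
  "C4 = c6 * 3 ^ CARD('m) * (C3 + C2 + 1 / (1 - \<rho> powr s) + 48 ^ CARD('m) / (1 - \<rho> powr (CARD('m) - s)))"

lemma C4_nonneg: "0 \<le> C4"
  unfolding C4_def using C3_nonneg C2_nonneg c6 rho_powr[OF s(1)] rho_powr[of "CARD('m) - s"] s(2) by simp

text \<open>Since \<open>D k \<le> F k\<close>, there are three ranges. For
  \<open>F k \<le> r\<close> the ball sees individual orbit points and \<open>sum_hits_le\<close>
  counts them. For \<open>D k \<le> r < F k\<close> each level contributes at most a constant times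
  \<open>D k powr s\<close>, dominated by the coarsest level. For \<open>r < D k\<close> it
  contributes the volume fraction of that mass, dominated by the finest level.\<close>

lemma fill_mass_le:
  fixes \<mu> :: "nat \<Rightarrow> real ^ 'n \<Rightarrow> 'm torus pmf"
  assumes K: "finite K" "\<And>k. k \<in> K \<Longrightarrow> k0 \<le> k" and r: "0 < r" "r \<le> 1 / 2"
    and Q: "\<And>k. k \<in> K \<Longrightarrow> Q k \<subseteq> block (c k) k" "\<And>k. k \<in> K \<Longrightarrow> finite (Q k)"
    and supp: "\<And>k q z. k \<in> K \<Longrightarrow> z \<in> set_pmf (\<mu> k q) \<Longrightarrow> dist (to_torus (A *v q)) z \<le> D k / 4"
    and frost: "\<And>k q. k \<in> K \<Longrightarrow> measure (measure_pmf (\<mu> k q)) (cball (to_torus x) r) \<le> (48 * r / D k) ^ CARD('m)"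
  shows "(\<Sum>k\<in>K. \<beta> k * (\<Sum>q\<in>Q k. measure (measure_pmf (\<mu> k q)) (cball (to_torus x) r)))
    \<le> C4 * (r ^ CARD('m) * sum a K + r powr s)"
proof -
  let ?B = "cball (to_torus x) r"
  let ?c = "c6 * 3 ^ CARD('m)"
  define t where "t k = \<beta> k * (\<Sum>q\<in>Q k. measure (measure_pmf (\<mu> k q)) ?B)" for k
  have c0: "0 \<le> ?c" using c6 by simp
  define K1 where "K1 = {k \<in> K. F k \<le> r}"
  define K2 where "K2 = {k \<in> K. r < F k \<and> D k \<le> r}"
  define K3 where "K3 = {k \<in> K. r < F k \<and> r < D k}"
  have fin: "finite K1" "finite K2" "finite K3" using K(1) by (simp_all add: K1_def K2_def K3_def)
  have split: "sum t K = sum t K1 + sum t K2 + sum t K3"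
  proof -
    have "K = (K1 \<union> K2) \<union> K3" unfolding K1_def K2_def K3_def by force
    moreover have "K1 \<inter> K2 = {}" "(K1 \<union> K2) \<inter> K3 = {}" unfolding K1_def K2_def K3_def by force+
    ultimately show ?thesis using fin by (simp add: sum.union_disjoint)
  qed
  have "sum t K1 \<le> (\<Sum>k\<in>K1. ?c * (\<beta> k * card (hits A r (2 ^ k))))"
  proof (rule sum_mono)
    fix k assume k: "k \<in> K1"
    then have kK: "k \<in> K" and Fr: "F k \<le> r" by (simp_all add: K1_def)
    have "(\<Sum>q\<in>Q k. measure (measure_pmf (\<mu> k q)) ?B) \<le> real (card (hits A (2 * r + D k / 2) (2 ^ k))) * 1"
      by (rule sum_fill_le[OF Q(1)[OF kK] Q(2)[OF kK] supp[OF kK]]) simp_all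
    also have "\<dots> \<le> ?c * card (hits A r (2 ^ k))"
      using hits_3_le[OF r(1), of k] D_le_F[OF K(2)[OF kK]] Fr by simp
    finally have "t k \<le> \<beta> k * (?c * card (hits A r (2 ^ k)))"
      unfolding t_def using beta_pos[of k] by (intro mult_left_mono) simp_all
    then show "t k \<le> ?c * (\<beta> k * card (hits A r (2 ^ k)))" by (simp only: mult.left_commute)
  qed
  also have "\<dots> = ?c * (\<Sum>k\<in>K1. \<beta> k * card (hits A r (2 ^ k)))" by (simp only: sum_distrib_left)
  also have "\<dots> \<le> ?c * (C3 * (r ^ CARD('m) * sum a K1) + C2 * r powr s)"
    using c0 by (intro mult_left_mono sum_hits_le[OF fin(1) _ r(2,1)]) (simp_all add: K1_def K(2))
  also have "\<dots> \<le> ?c * (C3 * (r ^ CARD('m) * sum a K) + C2 * r powr s)"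
    using c0 C3_nonneg C2_nonneg r a_pos K(1)
    by (intro mult_left_mono add_mono sum_mono2) (simp_all add: K1_def less_imp_le)
  finally have 1: "sum t K1 \<le> ?c * (C3 * (r ^ CARD('m) * sum a K) + C2 * r powr s)" .
  have "sum t K2 \<le> (\<Sum>k\<in>K2. ?c * (D k powr s * 1))"
  proof (rule sum_mono)
    fix k assume "k \<in> K2"
    then have k: "k \<in> K" "r < F k" by (simp_all add: K2_def)
    show "t k \<le> ?c * (D k powr s * 1)"
      unfolding t_def by (rule fill_term_le[OF Q(1)[OF k(1)] Q(2)[OF k(1)] K(2)[OF k(1)] k(2) r(1) supp[OF k(1)]]) simp_all
  qed
  also have "\<dots> = ?c * (\<Sum>k\<in>K2. D k powr s)" by (simp add: sum_distrib_left)
  also have "\<dots> \<le> ?c * (r powr s / (1 - \<rho> powr s))"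
    using c0 by (intro mult_left_mono sum_small_scales_le fin(2) r(1)) (simp_all add: K2_def K(2))
  finally have 2: "sum t K2 \<le> ?c * (r powr s / (1 - \<rho> powr s))" .
  have "sum t K3 \<le> (\<Sum>k\<in>K3. ?c * (D k powr s * (48 * r / D k) ^ CARD('m)))"
  proof (rule sum_mono)
    fix k assume "k \<in> K3"
    then have k: "k \<in> K" "r < F k" by (simp_all add: K3_def)
    show "t k \<le> ?c * (D k powr s * (48 * r / D k) ^ CARD('m))"
      unfolding t_def using r(1) D_pos[of k]
      by (intro fill_term_le[OF Q(1)[OF k(1)] Q(2)[OF k(1)] K(2)[OF k(1)] k(2) r(1) supp[OF k(1)] frost[OF k(1)]]) simp_all
  qed
  also have "\<dots> = ?c * (\<Sum>k\<in>K3. D k powr s * (48 * r / D k) ^ CARD('m))" by (simp only: sum_distrib_left)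
  also have "\<dots> \<le> ?c * (48 ^ CARD('m) * r powr s / (1 - \<rho> powr (CARD('m) - s)))"
    using c0 by (intro mult_left_mono sum_large_scales_le fin(3) r(1)) (simp_all add: K3_def K(2))
  finally have 3: "sum t K3 \<le> ?c * (48 ^ CARD('m) * r powr s / (1 - \<rho> powr (CARD('m) - s)))" .
  let ?X = "r ^ CARD('m) * sum a K" and ?Y = "r powr s"
  let ?d = "1 / (1 - \<rho> powr s)" and ?e = "48 ^ CARD('m) / (1 - \<rho> powr (CARD('m) - s))"
  have X: "0 \<le> ?X" using r a_pos by (simp add: sum_nonneg less_imp_le)
  have de: "0 \<le> ?d" "0 \<le> ?e"
    using rho_powr[OF s(1)] rho_powr[of "CARD('m) - s"] s(2) by simp_all
  have "sum t K \<le> ?c * (C3 * ?X + C2 * ?Y) + ?c * (?d * ?Y) + ?c * (?e * ?Y)"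
    using 1 2 3 unfolding split by simp
  also have "\<dots> = ?c * (C3 * ?X + (C2 + ?d + ?e) * ?Y)" by (simp only: distrib_left distrib_right add.assoc)
  also have "\<dots> \<le> ?c * ((C3 + C2 + ?d + ?e) * ?X + (C3 + C2 + ?d + ?e) * ?Y)"
    using c0 C3_nonneg C2_nonneg de X by (intro mult_left_mono add_mono mult_right_mono) simp_all
  also have "\<dots> = C4 * (?X + ?Y)" unfolding C4_def by (simp only: distrib_left[symmetric] mult.assoc)
  finally show ?thesis unfolding t_def .
qed

text \<open>Below all radii \<open>D k\<close> only the third range occurs, so the mass is of order
  \<open>r ^ CARD('m)\<close>. The constant depends on K, but s < m makes this negligible against
  \<open>r powr s\<close> for small r; this yields the thinness required by
  \<open>frostman_step\<close>.\<close>

lemma fill_mass_small_le: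
  fixes \<mu> :: "nat \<Rightarrow> real ^ 'n \<Rightarrow> 'm torus pmf"
  assumes K: "finite K" "\<And>k. k \<in> K \<Longrightarrow> k0 \<le> k" and r: "0 < r" "\<And>k. k \<in> K \<Longrightarrow> r < D k"
    and Q: "\<And>k. k \<in> K \<Longrightarrow> Q k \<subseteq> block (c k) k" "\<And>k. k \<in> K \<Longrightarrow> finite (Q k)"
    and supp: "\<And>k q z. k \<in> K \<Longrightarrow> z \<in> set_pmf (\<mu> k q) \<Longrightarrow> dist (to_torus (A *v q)) z \<le> D k / 4"
    and frost: "\<And>k q. k \<in> K \<Longrightarrow> measure (measure_pmf (\<mu> k q)) (cball (to_torus x) r) \<le> (48 * r / D k) ^ CARD('m)"
  shows "(\<Sum>k\<in>K. \<beta> k * (\<Sum>q\<in>Q k. measure (measure_pmf (\<mu> k q)) (cball (to_torus x) r)))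
    \<le> c6 * 144 ^ CARD('m) * (\<Sum>k\<in>K. D k powr s / D k ^ CARD('m)) * r ^ CARD('m)"
proof -
  have "(\<Sum>k\<in>K. \<beta> k * (\<Sum>q\<in>Q k. measure (measure_pmf (\<mu> k q)) (cball (to_torus x) r)))
      \<le> (\<Sum>k\<in>K. c6 * 3 ^ CARD('m) * (D k powr s * (48 * r / D k) ^ CARD('m)))"
  proof (rule sum_mono)
    fix k assume k: "k \<in> K"
    have rF: "r < F k" using r(2)[OF k] D_le_F[OF K(2)[OF k]] by linarith
    show "\<beta> k * (\<Sum>q\<in>Q k. measure (measure_pmf (\<mu> k q)) (cball (to_torus x) r))
        \<le> c6 * 3 ^ CARD('m) * (D k powr s * (48 * r / D k) ^ CARD('m))"
      using r(1) D_pos[of k]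
      by (intro fill_term_le[OF Q(1)[OF k] Q(2)[OF k] K(2)[OF k] rF r(1) supp[OF k] frost[OF k]]) simp_all
  qed
  also have "\<dots> = (\<Sum>k\<in>K. c6 * 144 ^ CARD('m) * (D k powr s / D k ^ CARD('m)) * r ^ CARD('m))"
  proof (rule sum.cong[OF refl])
    fix k
    have "(144::real) ^ CARD('m) = 3 ^ CARD('m) * 48 ^ CARD('m)"
      by (simp flip: power_mult_distrib)
    then show "c6 * 3 ^ CARD('m) * (D k powr s * (48 * r / D k) ^ CARD('m))
        = c6 * 144 ^ CARD('m) * (D k powr s / D k ^ CARD('m)) * r ^ CARD('m)"
      by (simp add: power_divide power_mult_distrib)
  qed
  also have "\<dots> = c6 * 144 ^ CARD('m) * (\<Sum>k\<in>K. D k powr s / D k ^ CARD('m)) * r ^ CARD('m)"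
    by (simp add: sum_distrib_left sum_distrib_right)
  finally show ?thesis .
qed

end

lemma ex_mixture:
  fixes w :: "'k \<Rightarrow> real" and Q :: "'k \<Rightarrow> 'q set" and \<mu> :: "'k \<Rightarrow> 'q \<Rightarrow> 'a pmf"
  assumes K: "finite K" and Q: "\<And>k. k \<in> K \<Longrightarrow> finite (Q k)" and w: "\<And>k. k \<in> K \<Longrightarrow> 0 < w k"
    and W: "W = (\<Sum>k\<in>K. w k * real (card (Q k)))" "0 < W"
  shows "\<exists>\<nu>. set_pmf \<nu> = (\<Union>k\<in>K. \<Union>q\<in>Q k. set_pmf (\<mu> k q)) \<and>
    (\<forall>S. measure (measure_pmf \<nu>) S = (\<Sum>k\<in>K. w k * (\<Sum>q\<in>Q k. measure (measure_pmf (\<mu> k q)) S)) / W)"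
proof -
  define I where "I = Sigma K Q"
  have I: "finite I" unfolding I_def using K Q by (rule finite_SigmaI)
  have sum_I: "(\<Sum>i\<in>I. f (fst i) (snd i)) = (\<Sum>k\<in>K. \<Sum>q\<in>Q k. f k q)" for f :: "'k \<Rightarrow> 'q \<Rightarrow> real"
    unfolding I_def using sum.Sigma[OF K, of Q f] Q by (simp add: case_prod_unfold)
  have WI: "(\<Sum>i\<in>I. w (fst i)) = W"
    using sum_I[of "\<lambda>k q. w k"] unfolding W(1) by (simp add: mult.commute)
  have ne: "I \<noteq> {}"
  proof
    assume "I = {}"
    with WI W(2) show False by simp
  qed
  have w_pos: "0 < w (fst i)" if "i \<in> I" for i using that w unfolding I_def by force
  obtain p where p: "set_pmf p = I" "\<And>i. i \<in> I \<Longrightarrow> pmf p i = w (fst i) / (\<Sum>i\<in>I. w (fst i))"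
    using ex_weighted_pmf[of I "\<lambda>i. w (fst i)", OF I ne w_pos] by metis
  define \<nu> where "\<nu> = bind_pmf p (\<lambda>i. \<mu> (fst i) (snd i))"
  show ?thesis
  proof (intro exI conjI allI)
    show "set_pmf \<nu> = (\<Union>k\<in>K. \<Union>q\<in>Q k. set_pmf (\<mu> k q))"
      unfolding \<nu>_def set_bind_pmf p(1) I_def by force
    fix S
    have "measure (measure_pmf \<nu>) S = (\<Sum>i\<in>I. pmf p i * measure (measure_pmf (\<mu> (fst i) (snd i))) S)"
      unfolding \<nu>_def using measure_bind_pmf_finite[of p "\<lambda>i. \<mu> (fst i) (snd i)" S] I unfolding p(1) by blast
    also have "\<dots> = (\<Sum>i\<in>I. w (fst i) * measure (measure_pmf (\<mu> (fst i) (snd i))) S / W)"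
      using p(2) unfolding WI by (intro sum.cong) simp_all
    also have "\<dots> = (\<Sum>k\<in>K. \<Sum>q\<in>Q k. w k * measure (measure_pmf (\<mu> k q)) S / W)"
      by (rule sum_I)
    also have "\<dots> = (\<Sum>k\<in>K. w k * (\<Sum>q\<in>Q k. measure (measure_pmf (\<mu> k q)) S)) / W"
      by (simp only: sum_distrib_left sum_divide_distrib)
    finally show "measure (measure_pmf \<nu>) S = (\<Sum>k\<in>K. w k * (\<Sum>q\<in>Q k. measure (measure_pmf (\<mu> k q)) S)) / W" .
  qed
qed

section \<open>Density of the orbit and the choice of blocks\<close>

context dyadic_scales
begin

lemma F_geometric: "k0 \<le> k \<Longrightarrow> F k \<le> F k0 / (\<rho> powr \<theta>) ^ k0 * (\<rho> powr \<theta>) ^ k"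
proof -
  assume k: "k0 \<le> k"
  have q: "0 < \<rho> powr \<theta>" using rho by simp
  have "F k \<le> (\<rho> powr \<theta>) ^ (k - k0) * F k0"
    unfolding F_def using theta by (intro D_powr_decay k) simp_all
  also have "(\<rho> powr \<theta>) ^ (k - k0) = (\<rho> powr \<theta>) ^ k / (\<rho> powr \<theta>) ^ k0"
    using q k by (intro power_diff) simp_all
  finally show ?thesis by (simp add: mult.commute)
qed

lemma F_summable_majorant: "summable (\<lambda>k. F k0 / (\<rho> powr \<theta>) ^ k0 * (\<rho> powr \<theta>) ^ k)"
  using rho_powr[OF theta(1)] by (intro summable_mult summable_geometric) simp

lemma eventually_F_le: "0 < r \<Longrightarrow> \<exists>k1\<ge>k0. \<forall>k\<ge>k1. F k \<le> r"
proof -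
  assume r: "0 < r"
  from order_tendstoD(2)[OF summable_LIMSEQ_zero[OF F_summable_majorant] r]
  obtain k1 where k1: "\<And>k. k1 \<le> k \<Longrightarrow> F k0 / (\<rho> powr \<theta>) ^ k0 * (\<rho> powr \<theta>) ^ k < r"
    unfolding eventually_sequentially by blast
  show ?thesis
  proof (intro exI[of _ "max k0 k1"] conjI allI impI)
    fix k assume "max k0 k1 \<le> k"
    then show "F k \<le> r" using F_geometric[of k] k1[of k] by simp
  qed simp
qed

text \<open>If density failed at all heights, l could be taken arbitrarily large in
  \<open>a_le_not_dense\<close>. Only the entry \<open>F k / r\<close> of the maximum would remain,
  and it is summable.\<close>

lemma ex_dense:
  assumes div: "\<not> summable a" and r: "0 < r" "r \<le> 1 / 2"
  shows "\<exists>l. reach A r (2 ^ l) = UNIV"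
proof (rule ccontr)
  assume "\<nexists>l. reach A r (2 ^ l) = UNIV"
  then have nd: "\<And>l. reach A r (2 ^ l) \<noteq> UNIV" by blast
  obtain k1 where k1: "k0 \<le> k1" "\<And>k. k1 \<le> k \<Longrightarrow> F k \<le> r" using eventually_F_le[OF r(1)] by blast
  have bound: "a k \<le> 4 * c6\<^sup>2 / r * (F k0 / (\<rho> powr \<theta>) ^ k0 * (\<rho> powr \<theta>) ^ k)" if k: "k1 \<le> k" for k
  proof -
    have kk: "k0 \<le> k" using k k1 by simp
    obtain i where i: "(1 / 2) ^ i < F k / r"
      using real_arch_pow_inv[of "F k / r" "1 / 2"] F_pos[of k] r by auto
    have "a k \<le> 4 * c6\<^sup>2 * max (F k / r) (2 ^ k / 2 ^ (k + i))"
      by (rule a_le_not_dense[OF kk le_add1 k1(2)[OF k] r(2) nd])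
    also have "(2::real) ^ k / 2 ^ (k + i) = (1 / 2) ^ i" by (simp add: power_add power_divide)
    also have "max (F k / r) ((1 / 2) ^ i) = F k / r" using i by (simp add: max_def)
    finally have "a k \<le> 4 * c6\<^sup>2 / r * F k" by simp
    also have "\<dots> \<le> 4 * c6\<^sup>2 / r * (F k0 / (\<rho> powr \<theta>) ^ k0 * (\<rho> powr \<theta>) ^ k)"
      using F_geometric[OF kk] r by (intro mult_left_mono) simp_all
    finally show ?thesis .
  qed
  have "summable a"
  proof (rule summable_comparison_test)
    show "\<exists>N. \<forall>k\<ge>N. norm (a k) \<le> 4 * c6\<^sup>2 / r * (F k0 / (\<rho> powr \<theta>) ^ k0 * (\<rho> powr \<theta>) ^ k)"
      using bound a_pos by (intro exI[of _ k1]) (simp add: less_imp_le)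
    show "summable (\<lambda>k. 4 * c6\<^sup>2 / r * (F k0 / (\<rho> powr \<theta>) ^ k0 * (\<rho> powr \<theta>) ^ k))"
      by (rule summable_mult[OF F_summable_majorant])
  qed
  with div show False by simp
qed

text \<open>Density at radius \<eta>/4 fixes one height 2^l. For k at least l + 4 it uses at most
  2^k/16, half of the block radius, and leaves the other half to the pigeonhole bound. The threshold
  works for all c and x.\<close>

lemma near_lower:
  assumes div: "\<not> summable a" and \<eta>: "0 < \<eta>" "\<eta> \<le> 1 / 2"
  shows "\<exists>k1. \<forall>k\<ge>k1. \<forall>c\<in>int_vecs. \<forall>x.
    (\<eta> / 4) ^ CARD('m) * (2 ^ k / 16) ^ CARD('n) \<le> c6 * real (card (near A c (2 ^ k / 8) x (\<eta> / 2)))"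
proof -
  obtain l where l: "reach A (\<eta> / 4) (2 ^ l) = UNIV"
    using ex_dense[OF div, of "\<eta> / 4"] \<eta> by auto
  show ?thesis
  proof (intro exI[of _ "l + 4"] allI impI ballI)
    fix k c x assume k: "l + 4 \<le> k" and c: "c \<in> (int_vecs :: (real ^ 'n) set)"
    have "(2::real) ^ (l + 4) \<le> 2 ^ k" using k by (intro power_increasing) simp_all
    then have l_le: "(2::real) ^ l \<le> 2 ^ k / 16" by (simp add: power_add)
    have "(\<eta> / 4) ^ CARD('m) * (2 ^ k / 16) ^ CARD('n) \<le> c6 * real (card (hits A (\<eta> / 4) (2 ^ k / 16)))"
      unfolding c6_def using \<eta> by (intro card_hits_lower) simp_all
    also have "\<dots> \<le> c6 * real (card (near A c (2 ^ k / 8) x (\<eta> / 2)))"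
    proof (intro mult_left_mono of_nat_mono)
      have "card (hits A (\<eta> / 4) (2 ^ k / 16)) \<le> card (near A c (2 ^ k / 16 + 2 ^ l) x (2 * (\<eta> / 4)))"
        by (rule card_near_ge[OF l c])
      also have "\<dots> \<le> card (near A c (2 ^ k / 8) x (\<eta> / 2))"
      proof (intro card_mono finite_near subsetI)
        fix q assume "q \<in> near A c (2 ^ k / 16 + 2 ^ l) x (2 * (\<eta> / 4))"
        then show "q \<in> near A c (2 ^ k / 8) x (\<eta> / 2)" using l_le unfolding near_def by simp
      qed
      finally show "card (hits A (\<eta> / 4) (2 ^ k / 16)) \<le> card (near A c (2 ^ k / 8) x (\<eta> / 2))" .
    qed (use c6 in simp)
    finally show "(\<eta> / 4) ^ CARD('m) * (2 ^ k / 16) ^ CARD('n) \<le> c6 * real (card (near A c (2 ^ k / 8) x (\<eta> / 2)))" .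
  qed
qed

text \<open>The block around \<open>ctr k\<close> lies in \<open>2\<^sup>k / 2 < |q| \<le> 2\<^sup>k\<close>, so different levels use different \<open>q\<close>.
  For \<open>k < 2\<close> the subtraction truncates.\<close>

definition ctr :: "nat \<Rightarrow> real ^ 'n" where "ctr k = (\<chi> i. 3 * 2 ^ (k - 2))"

lemma ctr_int: "ctr k \<in> int_vecs" unfolding ctr_def int_vecs_def by simp

lemma infnorm_block:
  assumes k: "2 \<le> k" and q: "q \<in> block (ctr k) k"
  shows "2 ^ k / 2 < infnorm q" "infnorm q \<le> 2 ^ k"
proof -
  obtain i where i: "k = 2 + i" using k le_Suc_ex by blast
  have p: "(2::real) ^ k = 4 * 2 ^ (k - 2)" unfolding i by (simp add: power_add)
  have "infnorm (ctr k) \<le> 3 * 2 ^ (k - 2)" unfolding infnorm_le_iff ctr_def by simp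
  moreover have "3 * 2 ^ (k - 2) \<le> infnorm (ctr k)"
    using component_le_infnorm_cart[of "ctr k"] by (simp add: ctr_def)
  moreover have "infnorm (q - ctr k) \<le> 2 ^ k / 8" using q by (simp add: block_def)
  moreover have "infnorm q \<le> infnorm (q - ctr k) + infnorm (ctr k)"
    using infnorm_triangle[of "q - ctr k" "ctr k"] by simp
  moreover have "infnorm (ctr k) \<le> infnorm q + infnorm (q - ctr k)"
    using infnorm_diff_triangle[of q "q - ctr k"] by simp
  moreover have "(0::real) < 2 ^ (k - 2)" by simp
  ultimately show "2 ^ k / 2 < infnorm q" "infnorm q \<le> 2 ^ k" unfolding p by linarith+
qed

lemma ex_block_sum_ge:
  assumes "\<not> summable a"
  shows "\<exists>K. finite K \<and> (\<forall>k\<in>K. k1 \<le> k) \<and> K \<noteq> {} \<and> X \<le> sum a K"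
proof -
  \<comment> \<open>The strict inequality against \<open>max X 0\<close> makes the block sum
    positive, hence the block nonempty, even for negative X.\<close>
  have "\<exists>n. max X 0 + sum a {..<k1} < sum a {..<n}"
  proof (rule ccontr)
    assume "\<not> ?thesis"
    then have "\<And>n. sum a {..<n} \<le> max X 0 + sum a {..<k1}" by (simp add: not_less)
    then have "summable a" using a_pos by (intro summableI_nonneg_bounded) (simp_all add: less_imp_le)
    with assms show False by simp
  qed
  then obtain n where n: "max X 0 + sum a {..<k1} < sum a {..<n}" by blast
  have "sum a {..<n} \<le> sum a ({..<k1} \<union> {k1..<n})"
    using a_pos by (intro sum_mono2) (auto simp: less_imp_le)
  also have "\<dots> = sum a {..<k1} + sum a {k1..<n}" by (intro sum.union_disjoint) auto
  finally have ge: "max X 0 < sum a {k1..<n}" using n by linarith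
  then have "{k1..<n} \<noteq> {}" by (intro notI) simp
  with ge show ?thesis by (intro exI[of _ "{k1..<n}"]) simp
qed

end

text \<open>The sets \<open>E j\<close> of the Cantor construction: one solution beyond each bound
  replaces infinitely many solutions.\<close>

definition approx_beyond :: "real ^ 'n ^ 'm \<Rightarrow> (real \<Rightarrow> real) \<Rightarrow> nat \<Rightarrow> 'm torus set" where
  "approx_beyond A \<psi> j = {y. \<exists>q\<in>int_vecs. real j < infnorm q \<and> dist (to_torus (A *v q)) y < \<psi> (infnorm q)}"

lemma Inter_approx_beyond_subset: "(\<Inter>j. approx_beyond A \<psi> j) \<subseteq> inhom_approx_set A \<psi>"
proof
  fix y assume y: "y \<in> (\<Inter>j. approx_beyond A \<psi> j)"
  obtain b where b: "y = to_torus b" by (rule torus_cases)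
  let ?S = "{q \<in> int_vecs - {0}. lattice_norm (A *v q - b) < \<psi> (infnorm q)}"
  have "infinite ?S"
  proof
    assume fin: "finite ?S"
    define M where "M = (\<Sum>q\<in>?S. infnorm q)"
    obtain j :: nat where j: "M < real j" using reals_Archimedean2 by blast
    from y have "y \<in> approx_beyond A \<psi> j" by blast
    then obtain q where q: "q \<in> int_vecs" "real j < infnorm q" "dist (to_torus (A *v q)) y < \<psi> (infnorm q)"
      unfolding approx_beyond_def by blast
    have "q \<noteq> 0" using q(2) by (auto simp: infnorm_0)
    then have "q \<in> ?S" using q unfolding b dist_to_torus by simp
    then have "infnorm q \<le> M" unfolding M_def using fin by (intro member_le_sum) (simp_all add: infnorm_pos_le)
    with q(2) j show False by linarith
  qed
  then show "y \<in> inhom_approx_set A \<psi>" unfolding b to_torus_in_inhom_approx_set_iff .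
qed

lemma hausdorff_measure_mono:
  assumes "E \<subseteq> E'" shows "hausdorff_measure s E \<le> hausdorff_measure s E'"
  unfolding hausdorff_measure_def hausdorff_content_def
  using assms by (intro SUP_mono' INF_superset_mono) auto

text \<open>A cube of side 1 is a fundamental domain, so this approximates Haar measure on the
  torus.\<close>

lemma ex_initial_pmf:
  assumes "0 < \<epsilon>"
  shows "\<exists>\<eta> p. 0 < \<eta> \<and> \<eta> < \<epsilon> \<and> finite (set_pmf p) \<and>
    (\<forall>y::('m::finite) torus. \<forall>d\<ge>\<eta>. measure (measure_pmf p) (cball y d) \<le> 12 ^ CARD('m) * d powr CARD('m))"
proof -
  obtain M where M: "0 < real M" "1 / real M < \<epsilon>"
    using real_arch_inverse[of \<epsilon>] assms by (auto simp: inverse_eq_divide)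
  obtain p :: "'m torus pmf" where p: "finite (set_pmf p)"
    "\<And>y d. 1 / real M \<le> d \<Longrightarrow> measure (measure_pmf p) (cball y d) \<le> (12 * d / 1) ^ CARD('m)"
    using ex_uniform_pmf[OF zero_less_one order_refl, of M "0 :: real ^ 'm"] M(1) by (metis of_nat_0_less_iff)
  have "measure (measure_pmf p) (cball y d) \<le> 12 ^ CARD('m) * d powr CARD('m)" if d: "1 / real M \<le> d" for y d
  proof -
    have "0 < d" using d M(1) by (metis divide_pos_pos less_le_trans zero_less_one)
    then show ?thesis using p(2)[OF d, of y] by (simp add: power_mult_distrib powr_realpow)
  qed
  then show ?thesis using M p(1) by (intro exI[of _ "1 / real M"] exI[of _ p]) simp
qed

section \<open>Local measures with a uniform Frostman constant\<close>

context dyadic_scales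
begin

text \<open>The constant left by \<open>near_lower\<close>: the weights in a ball of radius \<eta>
  add up to at least \<open>c1 * \<eta> ^ CARD('m)\<close> times the block sum.\<close>

definition c1 :: real where "c1 = 1 / (4 ^ CARD('m) * 16 ^ CARD('n) * c6)"

lemma c1_pos: "0 < c1" unfolding c1_def using c6 by simp

lemma near_subset_block: "near A c (2 ^ k / 8) x r \<subseteq> block c k"
  unfolding near_def block_def by blast

lemma ex_small_scale:
  fixes Z H \<eta> :: real
  assumes "finite K" and H: "1 \<le> H" and \<eta>: "0 < \<eta>"
  shows "\<exists>\<sigma>>0. \<sigma> \<le> \<eta> / 2 \<and> (\<forall>k\<in>K. H * \<sigma> < D k / 4) \<and> Z * \<sigma> powr (CARD('m) - s) \<le> 1"
proof -
  have "((\<lambda>\<sigma>. Z * \<sigma> powr (CARD('m) - s)) \<longlongrightarrow> Z * 0) (at_right 0)"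
    using s by (intro tendsto_mult tendsto_const powr_tendsto_0_at_right) simp
  then have "\<forall>\<^sub>F \<sigma> in at_right 0. Z * \<sigma> powr (CARD('m) - s) < 1"
    by (rule order_tendstoD(2)) simp
  moreover have lim: "((\<lambda>\<sigma>. \<sigma>) \<longlongrightarrow> 0) (at_right (0::real))" by (rule tendsto_ident_at)
  have "\<forall>\<^sub>F \<sigma> in at_right 0. \<sigma> < \<eta> / 2"
    by (rule order_tendstoD(2)[OF lim]) (use \<eta> in simp)
  moreover have "\<forall>\<^sub>F \<sigma> in at_right 0. \<forall>k\<in>K. \<sigma> < D k / (4 * H)"
  proof (intro eventually_ball_finite assms(1) ballI)
    fix k
    show "\<forall>\<^sub>F \<sigma> in at_right 0. \<sigma> < D k / (4 * H)"
      by (rule order_tendstoD(2)[OF lim]) (use D_pos[of k] H in simp)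
  qed
  moreover have "\<forall>\<^sub>F \<sigma> in at_right (0::real). 0 < \<sigma>" by (rule eventually_at_right_less)
  ultimately have "\<forall>\<^sub>F \<sigma> in at_right 0. Z * \<sigma> powr (CARD('m) - s) < 1 \<and> \<sigma> < \<eta> / 2 \<and>
      (\<forall>k\<in>K. \<sigma> < D k / (4 * H)) \<and> 0 < \<sigma>"
    by (intro eventually_conj)
  then obtain \<sigma> where \<sigma>: "Z * \<sigma> powr (CARD('m) - s) < 1" "\<sigma> < \<eta> / 2" "\<And>k. k \<in> K \<Longrightarrow> \<sigma> < D k / (4 * H)" "0 < \<sigma>"
    using eventually_happens'[OF trivial_limit_at_right_real] by blast
  have "H * \<sigma> < D k / 4" if "k \<in> K" for k
    using \<sigma>(3)[OF that] H by (simp add: field_simps)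
  with \<sigma> show ?thesis by (intro exI[of _ \<sigma>]) simp
qed

text \<open>Radius \<open>D k / 4\<close> instead of \<open>D k\<close> leaves room for the small
  balls added later; it also turns the constant 12 of \<open>ex_uniform_pmf\<close> into 48.\<close>

lemma ex_fills:
  assumes K: "finite K" "\<And>k. k \<in> K \<Longrightarrow> D k \<le> 1" and \<sigma>: "0 < \<sigma>"
  shows "\<exists>\<mu> :: nat \<Rightarrow> real ^ 'n \<Rightarrow> 'm torus pmf. \<forall>k\<in>K. \<forall>q. finite (set_pmf (\<mu> k q)) \<and>
    (\<forall>z\<in>set_pmf (\<mu> k q). dist (to_torus (A *v q)) z \<le> D k / 4) \<and>
    (\<forall>y d. \<sigma> \<le> d \<longrightarrow> measure (measure_pmf (\<mu> k q)) (cball y d) \<le> (48 * d / D k) ^ CARD('m))"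
proof -
  obtain M where M: "0 < real M" "1 / real M < \<sigma>"
    using real_arch_inverse[of \<sigma>] \<sigma> by (auto simp: inverse_eq_divide)
  have "\<exists>p. finite (set_pmf p) \<and> (\<forall>z\<in>set_pmf p. dist (to_torus (A *v q)) z \<le> D k / 4) \<and>
      (\<forall>y d. \<sigma> \<le> d \<longrightarrow> measure (measure_pmf p) (cball y d) \<le> (48 * d / D k) ^ CARD('m))" if k: "k \<in> K" for k q
  proof -
    have \<delta>: "0 < D k / 4" "D k / 4 \<le> 1" "0 < M" using D_pos[of k] K(2)[OF k] M(1) by simp_all
    have small: "D k / 4 / real M \<le> d" if "\<sigma> \<le> d" for d
    proof -
      have "D k / 4 / real M \<le> 1 / real M" using \<delta> by (intro divide_right_mono) simp_all
      then show ?thesis using M(2) that by linarith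
    qed
    obtain p where p: "finite (set_pmf p)" "\<And>z. z \<in> set_pmf p \<Longrightarrow> dist (to_torus (A *v q)) z \<le> D k / 4"
      "\<And>y d. D k / 4 / real M \<le> d \<Longrightarrow> measure (measure_pmf p) (cball y d) \<le> (12 * d / (D k / 4)) ^ CARD('m)"
      using ex_uniform_pmf[OF \<delta>, of "A *v q"] by metis
    have eq: "12 * d / (D k / 4) = 48 * d / D k" for d by simp
    show ?thesis
      using p(1,2) p(3)[OF small] unfolding eq by (intro exI[of _ p]) simp
  qed
  then have "\<forall>k\<in>K. \<exists>p. \<forall>q. finite (set_pmf (p q)) \<and>
      (\<forall>z\<in>set_pmf (p q). dist (to_torus (A *v q)) z \<le> D k / 4) \<and>
      (\<forall>y d. \<sigma> \<le> d \<longrightarrow> measure (measure_pmf (p q)) (cball y d) \<le> (48 * d / D k) ^ CARD('m))"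
    by (intro ballI choice allI)
  then show ?thesis by (rule bchoice)
qed

text \<open>Dividing the bound of \<open>fill_mass_le\<close> by the total weight leaves a constant
  times \<open>(d / \<eta>) ^ CARD('m) + d powr s / (\<eta> ^ CARD('m) * L)\<close>. For
  \<open>L \<ge> \<eta> powr (s - CARD('m))\<close> both terms are at most
  \<open>(d / \<eta>) powr s\<close>, so the constant depends on none of \<eta>, H and j.\<close>

lemma ex_local_pmf:
  fixes \<psi> :: "real \<Rightarrow> real"
  assumes div: "\<not> summable a" and \<psi>: "\<And>k x. 0 < x \<Longrightarrow> x \<le> 2 ^ k \<Longrightarrow> D k \<le> \<psi> x"
    and \<eta>: "0 < \<eta>" "\<eta> < 1 / 2" and H: "1 \<le> H"
  shows "\<exists>\<sigma>>0. \<sigma> \<le> \<eta> / 2 \<and> (\<forall>x. \<exists>\<nu>. finite (set_pmf \<nu>) \<and>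
        (\<forall>z\<in>set_pmf \<nu>. cball z \<sigma> \<subseteq> cball x \<eta> \<inter> approx_beyond A \<psi> j) \<and>
        (\<forall>y d. \<sigma> \<le> d \<longrightarrow> d \<le> \<eta> \<longrightarrow> measure (measure_pmf \<nu>) (cball y d) \<le> 2 * C4 / c1 * (d / \<eta>) powr s) \<and>
        (\<forall>y. measure (measure_pmf \<nu>) (cball y (H * \<sigma>)) \<le> \<sigma> powr s / H))"
proof -
  have \<eta>h: "\<eta> \<le> 1 / 2" using \<eta> by simp
  obtain k1 where k1: "\<And>k c x. k1 \<le> k \<Longrightarrow> c \<in> int_vecs \<Longrightarrow>
      (\<eta> / 4) ^ CARD('m) * (2 ^ k / 16) ^ CARD('n) \<le> c6 * real (card (near A c (2 ^ k / 8) x (\<eta> / 2)))"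
    using near_lower[OF div \<eta>(1) \<eta>h] by blast
  obtain k2 where k2: "k0 \<le> k2" "\<And>k. k2 \<le> k \<Longrightarrow> F k \<le> \<eta>" using eventually_F_le[OF \<eta>(1)] by blast
  \<comment> \<open>Beyond \<open>k1\<close> every ball of radius \<eta>/2 contains many orbit
    points, beyond \<open>k2\<close> the fills are small compared with \<eta>, and beyond j + 2 the
    points q have norm above j.\<close>
  obtain K where K: "finite K" "\<And>k. k \<in> K \<Longrightarrow> max (max k1 k2) (j + 2) \<le> k" "K \<noteq> {}"
    and Lge: "\<eta> powr (s - CARD('m)) \<le> sum a K"
    using ex_block_sum_ge[OF div, of "max (max k1 k2) (j + 2)" "\<eta> powr (s - CARD('m))"] by blast
  have Kk: "k1 \<le> k" "k2 \<le> k" "j + 2 \<le> k" "k0 \<le> k" if "k \<in> K" for k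
    using K(2)[OF that] k2(1) by simp_all
  have D\<eta>: "D k \<le> \<eta>" if "k \<in> K" for k
    using D_le_F[OF Kk(4)[OF that]] k2(2)[OF Kk(2)[OF that]] by linarith
  define L where "L = sum a K"
  have L: "0 < L" unfolding L_def using K a_pos by (intro sum_pos) simp_all
  define V where "V = c1 * \<eta> ^ CARD('m) * L"
  have V: "0 < V" unfolding V_def using c1_pos \<eta> L by simp
  define B where "B = c6 * 144 ^ CARD('m) * (\<Sum>k\<in>K. D k powr s / D k ^ CARD('m)) * H ^ CARD('m)"
  have B: "0 \<le> B" unfolding B_def using c6 H D_pos by (intro mult_nonneg_nonneg sum_nonneg) (simp_all add: less_imp_le)
  \<comment> \<open>The bound \<open>D k / 4\<close> keeps a \<sigma>-ball around a fill point
    within \<open>D k / 2\<close> of the orbit point and puts radius H * \<sigma> below every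
    \<open>D k\<close>. The last condition converts \<open>B * \<sigma> ^ CARD('m) / V\<close> into
    \<open>\<sigma> powr s / H\<close>.\<close>
  obtain \<sigma> where \<sigma>: "0 < \<sigma>" "\<sigma> \<le> \<eta> / 2" "\<And>k. k \<in> K \<Longrightarrow> H * \<sigma> < D k / 4" "B * H / V * \<sigma> powr (CARD('m) - s) \<le> 1"
    using ex_small_scale[OF K(1) H \<eta>(1), of "B * H / V"] by blast
  have H\<sigma>: "\<sigma> \<le> H * \<sigma>" using H \<sigma>(1) by simp
  have D1: "D k \<le> 1" if "k \<in> K" for k using D\<eta>[OF that] \<eta> by linarith
  obtain \<mu> where \<mu>0: "\<forall>k\<in>K. \<forall>q. finite (set_pmf (\<mu> k q)) \<and>
    (\<forall>z\<in>set_pmf (\<mu> k q). dist (to_torus (A *v q)) z \<le> D k / 4) \<and>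
    (\<forall>y d. \<sigma> \<le> d \<longrightarrow> measure (measure_pmf (\<mu> k q)) (cball y d) \<le> (48 * d / D k) ^ CARD('m))"
    by (rule exE[OF ex_fills[OF K(1) D1 \<sigma>(1)]])
  have \<mu>: "\<And>k q. k \<in> K \<Longrightarrow> finite (set_pmf (\<mu> k q))"
    "\<And>k q z. k \<in> K \<Longrightarrow> z \<in> set_pmf (\<mu> k q) \<Longrightarrow> dist (to_torus (A *v q)) z \<le> D k / 4"
    "\<And>k q y d. k \<in> K \<Longrightarrow> \<sigma> \<le> d \<Longrightarrow> measure (measure_pmf (\<mu> k q)) (cball y d) \<le> (48 * d / D k) ^ CARD('m)"
    using \<mu>0 by simp_all
  have "\<exists>\<nu>. finite (set_pmf \<nu>) \<and>
        (\<forall>z\<in>set_pmf \<nu>. cball z \<sigma> \<subseteq> cball x \<eta> \<inter> approx_beyond A \<psi> j) \<and>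
        (\<forall>y d. \<sigma> \<le> d \<longrightarrow> d \<le> \<eta> \<longrightarrow> measure (measure_pmf \<nu>) (cball y d) \<le> 2 * C4 / c1 * (d / \<eta>) powr s) \<and>
        (\<forall>y. measure (measure_pmf \<nu>) (cball y (H * \<sigma>)) \<le> \<sigma> powr s / H)" for x
  proof -
    obtain b where b: "x = to_torus b" by (rule torus_cases)
    define Q where "Q k = near A (ctr k) (2 ^ k / 8) b (\<eta> / 2)" for k
    have Q: "Q k \<subseteq> block (ctr k) k" "finite (Q k)" for k
      unfolding Q_def by (rule near_subset_block, rule finite_near)
    define W where "W = (\<Sum>k\<in>K. \<beta> k * real (card (Q k)))"
    have VW: "V \<le> W"
    proof -
      have "c1 * \<eta> ^ CARD('m) * a k \<le> \<beta> k * real (card (Q k))" if k: "k \<in> K" for k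
      proof -
        have "\<beta> k * ((\<eta> / 4) ^ CARD('m) * (2 ^ k / 16) ^ CARD('n)) \<le> \<beta> k * (c6 * real (card (Q k)))"
          unfolding Q_def using k1[OF Kk(1)[OF k] ctr_int[of k], of b] beta_pos[of k] by (intro mult_left_mono) simp_all
        then have "1 / c6 * (\<beta> k * ((\<eta> / 4) ^ CARD('m) * (2 ^ k / 16) ^ CARD('n))) \<le> 1 / c6 * (\<beta> k * (c6 * real (card (Q k))))"
          by (rule mult_left_mono) (use c6 in simp)
        also have "1 / c6 * (\<beta> k * (c6 * real (card (Q k)))) = \<beta> k * real (card (Q k))" using c6 by simp
        also have "1 / c6 * (\<beta> k * ((\<eta> / 4) ^ CARD('m) * (2 ^ k / 16) ^ CARD('n))) = c1 * \<eta> ^ CARD('m) * a k"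
          unfolding c1_def a_def by (simp add: power_divide mult_ac)
        finally show ?thesis .
      qed
      then show ?thesis unfolding V_def W_def L_def sum_distrib_left by (rule sum_mono)
    qed
    then have W: "0 < W" using V by linarith
    have "\<exists>\<nu>. set_pmf \<nu> = (\<Union>k\<in>K. \<Union>q\<in>Q k. set_pmf (\<mu> k q)) \<and>
        (\<forall>S. measure (measure_pmf \<nu>) S = (\<Sum>k\<in>K. \<beta> k * (\<Sum>q\<in>Q k. measure (measure_pmf (\<mu> k q)) S)) / W)"
      by (rule ex_mixture[OF K(1) Q(2) beta_pos W_def W])
    then obtain \<nu> where \<nu>0: "set_pmf \<nu> = (\<Union>k\<in>K. \<Union>q\<in>Q k. set_pmf (\<mu> k q)) \<and>
        (\<forall>S. measure (measure_pmf \<nu>) S = (\<Sum>k\<in>K. \<beta> k * (\<Sum>q\<in>Q k. measure (measure_pmf (\<mu> k q)) S)) / W)"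
      by (rule exE)
    have \<nu>: "set_pmf \<nu> = (\<Union>k\<in>K. \<Union>q\<in>Q k. set_pmf (\<mu> k q))"
      "\<And>S. measure (measure_pmf \<nu>) S = (\<Sum>k\<in>K. \<beta> k * (\<Sum>q\<in>Q k. measure (measure_pmf (\<mu> k q)) S)) / W"
      using \<nu>0 by blast+
    have "finite (set_pmf \<nu>)" unfolding \<nu>(1) using K(1) Q(2) \<mu>(1) by (intro finite_UN_I)
    moreover have "cball z \<sigma> \<subseteq> cball x \<eta> \<inter> approx_beyond A \<psi> j" if z: "z \<in> set_pmf \<nu>" for z
    proof
      fix y assume y: "y \<in> cball z \<sigma>"
      obtain k q where kq: "k \<in> K" "q \<in> Q k" "z \<in> set_pmf (\<mu> k q)" using z unfolding \<nu>(1) by blast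
      have d1: "dist (to_torus (A *v q)) z \<le> D k / 4" by (rule \<mu>(2)[OF kq(1,3)])
      have d2: "dist z y \<le> D k / 4" using y \<sigma>(3)[OF kq(1)] H\<sigma> by simp
      have d3: "dist (to_torus (A *v q)) y \<le> D k / 2"
        using dist_triangle[of "to_torus (A *v q)" y z] d1 d2 by linarith
      have d4: "dist (to_torus (A *v q)) x \<le> \<eta> / 2"
        using kq(2) unfolding Q_def near_def b dist_to_torus by simp
      have "dist x y \<le> \<eta>"
        using dist_triangle3[of x y "to_torus (A *v q)"] d3 d4 D\<eta>[OF kq(1)] by linarith
      moreover have "y \<in> approx_beyond A \<psi> j"
      proof -
        have k: "2 \<le> k" using Kk(3)[OF kq(1)] by simp
        have qb: "q \<in> block (ctr k) k" using Q(1) kq(2) by blast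
        have "real j < 2 ^ k / 2"
        proof -
          have "real j < 2 ^ j" by (rule of_nat_less_two_power)
          also have "(2::real) ^ j \<le> 2 ^ (k - 1)" using Kk(3)[OF kq(1)] by (intro power_increasing) simp_all
          also have "(2::real) ^ (k - 1) = 2 ^ k / 2" using k by (simp add: power_diff)
          finally show ?thesis .
        qed
        then have q: "real j < infnorm q" "infnorm q \<le> 2 ^ k"
          using infnorm_block[OF k qb] by linarith+
        have q0: "0 < infnorm q" using q(1) by (rule le_less_trans[OF of_nat_0_le_iff])
        \<comment> \<open>This gives the strict inequality in the approximation condition;
          \<open>D k\<close> itself is at most \<open>\<psi> (infnorm q)\<close> because q has norm
          at most \<open>2 ^ k\<close>.\<close>
        have "D k / 2 < D k" using D_pos[of k] by simp
        then have "dist (to_torus (A *v q)) y < \<psi> (infnorm q)"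
          using d3 \<psi>[OF q0 q(2)] by linarith
        moreover have "q \<in> int_vecs" using qb unfolding block_def by blast
        ultimately show ?thesis unfolding approx_beyond_def using q(1) by blast
      qed
      ultimately show "y \<in> cball x \<eta> \<inter> approx_beyond A \<psi> j" by simp
    qed
    moreover have "measure (measure_pmf \<nu>) (cball y d) \<le> 2 * C4 / c1 * (d / \<eta>) powr s" if d: "\<sigma> \<le> d" "d \<le> \<eta>" for y d
    proof -
      obtain b' where b': "y = to_torus b'" by (rule torus_cases)
      have d0: "0 < d" using d \<sigma>(1) by linarith
      have "(\<Sum>k\<in>K. \<beta> k * (\<Sum>q\<in>Q k. measure (measure_pmf (\<mu> k q)) (cball y d)))
          \<le> C4 * (d ^ CARD('m) * L + d powr s)"
        unfolding b' L_def using d0 d \<eta>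
        by (intro fill_mass_le[OF K(1) Kk(4) _ _ Q(1) Q(2) \<mu>(2) \<mu>(3)]) simp_all
      then have "measure (measure_pmf \<nu>) (cball y d) \<le> C4 * (d ^ CARD('m) * L + d powr s) / W"
        unfolding \<nu>(2) using W by (intro divide_right_mono) simp_all
      also have "\<dots> \<le> C4 * (d ^ CARD('m) * L + d powr s) / V"
        using VW V L d0 C4_nonneg W by (intro divide_left_mono mult_pos_pos mult_nonneg_nonneg add_nonneg_nonneg) simp_all
      also have "\<dots> = C4 / c1 * ((d / \<eta>) ^ CARD('m) + d powr s / (\<eta> ^ CARD('m) * L))"
        unfolding V_def using L \<eta> c1_pos by (simp add: field_simps power_divide)
      also have "\<dots> \<le> C4 / c1 * ((d / \<eta>) powr s + (d / \<eta>) powr s)"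
      proof (intro mult_left_mono add_mono)
        have "(d / \<eta>) ^ CARD('m) = (d / \<eta>) powr CARD('m)" using d0 \<eta> by (simp add: powr_realpow)
        also have "\<dots> \<le> (d / \<eta>) powr s" using d0 d \<eta> s by (intro powr_mono') simp_all
        finally show "(d / \<eta>) ^ CARD('m) \<le> (d / \<eta>) powr s" .
        have "\<eta> powr s = \<eta> ^ CARD('m) * \<eta> powr (s - CARD('m))"
          using \<eta> by (simp add: powr_diff powr_realpow)
        also have "\<dots> \<le> \<eta> ^ CARD('m) * L" using Lge \<eta> unfolding L_def by (intro mult_left_mono) simp_all
        finally have "\<eta> powr s \<le> \<eta> ^ CARD('m) * L" .
        then have "d powr s / (\<eta> ^ CARD('m) * L) \<le> d powr s / \<eta> powr s"
          using \<eta> L by (intro divide_left_mono mult_pos_pos) simp_all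
        then show "d powr s / (\<eta> ^ CARD('m) * L) \<le> (d / \<eta>) powr s" using d0 \<eta> by (simp add: powr_divide)
      qed (use C4_nonneg c1_pos in simp)
      also have "\<dots> = 2 * C4 / c1 * (d / \<eta>) powr s" by simp
      finally show ?thesis .
    qed
    moreover have "measure (measure_pmf \<nu>) (cball y (H * \<sigma>)) \<le> \<sigma> powr s / H" for y
    proof -
      obtain b' where b': "y = to_torus b'" by (rule torus_cases)
      have r0: "0 < H * \<sigma>" using H \<sigma>(1) by simp
      have rD: "H * \<sigma> < D k" if "k \<in> K" for k using \<sigma>(3)[OF that] D_pos[of k] by linarith
      have "(\<Sum>k\<in>K. \<beta> k * (\<Sum>q\<in>Q k. measure (measure_pmf (\<mu> k q)) (cball y (H * \<sigma>))))
          \<le> c6 * 144 ^ CARD('m) * (\<Sum>k\<in>K. D k powr s / D k ^ CARD('m)) * (H * \<sigma>) ^ CARD('m)"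
        unfolding b' using H\<sigma>
        by (intro fill_mass_small_le[OF K(1) Kk(4) r0 rD Q(1) Q(2) \<mu>(2) \<mu>(3)]) simp_all
      also have "\<dots> = B * \<sigma> ^ CARD('m)" unfolding B_def by (simp only: power_mult_distrib mult.assoc)
      finally have "measure (measure_pmf \<nu>) (cball y (H * \<sigma>)) \<le> B * \<sigma> ^ CARD('m) / W"
        unfolding \<nu>(2) using W by (intro divide_right_mono) simp_all
      also have "\<dots> \<le> B * \<sigma> ^ CARD('m) / V"
        using VW V W B \<sigma>(1) by (intro divide_left_mono mult_pos_pos mult_nonneg_nonneg) simp_all
      also have "\<dots> = (B * H / V * \<sigma> powr (CARD('m) - s)) * (\<sigma> powr s / H)"
        using H \<sigma>(1) by (simp add: powr_diff powr_realpow)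
      also have "\<dots> \<le> 1 * (\<sigma> powr s / H)" using \<sigma>(4) H by (intro mult_right_mono) simp_all
      finally show ?thesis by simp
    qed
    ultimately show ?thesis by blast
  qed
  then show ?thesis using \<sigma>(1,2) by blast
qed

lemma hausdorff_measure_approx_eq_infinity:
  fixes \<psi> :: "real \<Rightarrow> real"
  assumes "\<not> summable a" and "\<And>k x. 0 < x \<Longrightarrow> x \<le> 2 ^ k \<Longrightarrow> D k \<le> \<psi> x"
  shows "hausdorff_measure s (inhom_approx_set A \<psi>) = \<infinity>"
proof -
  have "hausdorff_measure s (\<Inter>j. approx_beyond A \<psi> j) = \<infinity>"
  proof (rule hausdorff_measure_eq_infinity[OF compact_UNIV_torus s])
    show "0 \<le> (12 :: real) ^ CARD('m)" by simp
    show "0 \<le> 2 * C4 / c1" using C4_nonneg c1_pos by simp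
    show "0 < (1 / 2 :: real)" by simp
  qed (fact ex_initial_pmf, rule ex_local_pmf[OF assms])
  then show ?thesis
    using hausdorff_measure_mono[OF Inter_approx_beyond_subset[of A \<psi>], of s] by (simp add: top_unique)
qed

end

section \<open>The convergence case\<close>

text \<open>Below radius 1/2 the vector p is determined by q: two candidates would differ by less
  than 1.\<close>

lemma lattice_count_eq_card_hits:
  fixes A :: "real ^ 'n ^ 'm" and r T :: real
  assumes "r < 1 / 2"
  shows "lattice_count A r T = card (hits A r T)"
proof -
  let ?S = "{(p, q). p \<in> int_vecs \<and> q \<in> int_vecs \<and> infnorm (A *v q - p) \<le> r \<and> infnorm q \<le> T}"
  have "inj_on snd ?S"
  proof (rule inj_onI)
    fix u v assume "u \<in> ?S" "v \<in> ?S" "snd u = snd v"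
    then obtain p p' q where uv: "u = (p, q)" "v = (p', q)" "p \<in> int_vecs" "p' \<in> int_vecs"
      "infnorm (A *v q - p) \<le> r" "infnorm (A *v q - p') \<le> r"
      by (cases u, cases v) simp
    have "infnorm (p' - p) \<le> infnorm (A *v q - p) + infnorm (A *v q - p')"
      using infnorm_diff_triangle[of "A *v q - p" "A *v q - p'"] by simp
    then have "infnorm (p' - p) < 1" using uv(5,6) assms by linarith
    then have "p' - p = 0" using uv(3,4) by (intro int_vec_infnorm_less_1 int_vecs_diff)
    then show "u = v" using uv(1,2) by simp
  qed
  moreover have "snd ` ?S = hits A r T"
    unfolding hits_def lattice_norm_le_iff by force
  ultimately show ?thesis
    unfolding lattice_count_def using card_image by fastforce
qed

text \<open>The centres are a maximal r-separated set of orbit points. Maximality makes it a cover,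
  separation bounds its size by packing.\<close>

lemma ex_cover_orbit:
  fixes A :: "real ^ 'n ^ 'm" and r T :: real
  assumes r: "0 < r" and T: "1 / 2 \<le> T"
  obtains J where "finite J" "J \<subseteq> (int_vecs :: (real ^ 'n) set)"
    "real (card J) * real (card (hits A r T)) \<le> 6 ^ (CARD('m) + CARD('n)) * (2 * T) ^ CARD('n)"
    "\<And>q. q \<in> int_vecs \<Longrightarrow> infnorm q \<le> T \<Longrightarrow> \<exists>q'\<in>J. lattice_norm (A *v q - A *v q') \<le> r"
proof -
  define Q where "Q = {q \<in> int_vecs. infnorm (q :: real ^ 'n) \<le> T}"
  have Q: "finite Q" unfolding Q_def by (rule finite_int_vecs_bounded)
  define S where "S = {J. J \<subseteq> Q \<and> (\<forall>i\<in>J. \<forall>j\<in>J. i \<noteq> j \<longrightarrow> r < lattice_norm (A *v i - A *v j))}"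
  have "finite S" unfolding S_def by (rule finite_subset[of _ "Pow Q"]) (use Q in auto)
  moreover have "S \<noteq> {}" unfolding S_def by blast
  ultimately obtain J where J: "J \<in> S" "\<And>J'. J' \<in> S \<Longrightarrow> J \<subseteq> J' \<Longrightarrow> J = J'"
    using finite_has_maximal[of S] by blast
  have JQ: "J \<subseteq> Q" and sep: "\<And>i j. i \<in> J \<Longrightarrow> j \<in> J \<Longrightarrow> i \<noteq> j \<Longrightarrow> r < lattice_norm (A *v i - A *v j)"
    using J(1) unfolding S_def by blast+
  have fin: "finite J" by (rule finite_subset[OF JQ Q])
  have "real (card J) * card (hits A r T)
      \<le> 6 ^ (CARD('m) + CARD('n)) * (r / r) ^ CARD('m) * (T / (1 / 2)) ^ CARD('n) * card (hits A r (1 / 2))"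
  proof (rule card_hits_packing[where x = "\<lambda>q. A *v q", OF fin])
    fix q assume "q \<in> J"
    then have q: "q \<in> int_vecs" "infnorm q \<le> T" using JQ unfolding Q_def by auto
    have "lattice_norm (A *v q - A *v q) \<le> r" using r by (simp add: lattice_norm_eq_0_iff[THEN iffD2])
    then show "A *v q \<in> reach A r T" unfolding reach_def using q by blast
  next
    fix i j assume ij: "i \<in> J" "j \<in> J" "i \<noteq> j"
    show "A *v i - A *v j \<notin> reach A r (1 / 2)"
    proof
      assume "A *v i - A *v j \<in> reach A r (1 / 2)"
      then obtain q where q: "q \<in> int_vecs" "infnorm q \<le> 1 / 2" "lattice_norm (A *v i - A *v j - A *v q) \<le> r"
        unfolding reach_def by blast
      have "q = 0" by (rule int_vec_infnorm_less_1[OF q(1)]) (use q(2) in simp)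
      then show False using q(3) sep[OF ij] by simp
    qed
  qed (use r T in simp_all)
  also have "\<dots> \<le> 6 ^ (CARD('m) + CARD('n)) * (r / r) ^ CARD('m) * (T / (1 / 2)) ^ CARD('n) * 1"
    using T r card_hits_le_1[of "1 / 2" A r] by (intro mult_left_mono) simp_all
  finally have card: "real (card J) * real (card (hits A r T)) \<le> 6 ^ (CARD('m) + CARD('n)) * (2 * T) ^ CARD('n)"
    using r by (simp add: mult.commute)
  have cov: "\<exists>q'\<in>J. lattice_norm (A *v q - A *v q') \<le> r" if q: "q \<in> int_vecs" "infnorm q \<le> T" for q
  proof (rule ccontr)
    assume "\<not> ?thesis"
    then have far: "\<And>q'. q' \<in> J \<Longrightarrow> r < lattice_norm (A *v q - A *v q')" by (simp add: not_le)
    have far': "\<And>q'. q' \<in> J \<Longrightarrow> r < lattice_norm (A *v q' - A *v q)"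
      using far lattice_norm_minus_commute[of "A *v q"] by simp
    have "insert q J \<in> S" unfolding S_def Q_def using q far far' sep JQ unfolding Q_def by auto
    then have "q \<in> J" using J(2)[of "insert q J"] by blast
    from far[OF this] show False using r by (simp add: lattice_norm_eq_0_iff[THEN iffD2])
  qed
  have "J \<subseteq> int_vecs" using JQ unfolding Q_def by blast
  from that[OF fin this card cov] show thesis .
qed

lemma diameter_cball_le:
  fixes x :: "'a::metric_space"
  assumes "0 \<le> r" shows "diameter (cball x r) \<le> 2 * r"
proof -
  have "dist y z \<le> 2 * r" if "y \<in> cball x r" "z \<in> cball x r" for y z
    using that dist_triangle3[of y z x] by simp
  moreover have "cball x r \<times> cball x r \<noteq> {}" using assms by auto
  ultimately show ?thesis
    unfolding diameter_def using assms by (auto intro!: cSUP_least)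
qed

lemma hausdorff_content_le_sum:
  fixes E :: "'a::metric_space set" and J :: "nat \<Rightarrow> 'i set" and c :: "nat \<Rightarrow> 'i \<Rightarrow> 'a" and R :: "nat \<Rightarrow> real"
  assumes cover: "E \<subseteq> (\<Union>k. \<Union>x\<in>J k. cball (c k x) (R k))" and J: "\<And>k. finite (J k)"
    and R: "\<And>k. 0 \<le> R k" "\<And>k. 2 * R k \<le> \<delta>" and s: "0 < s"
    and summ: "summable (\<lambda>k. real (card (J k)) * (2 * R k) powr s)"
  shows "hausdorff_content \<delta> s E \<le> ennreal (\<Sum>k. real (card (J k)) * (2 * R k) powr s)"
proof -
  have \<delta>: "0 \<le> \<delta>" using R(1)[of 0] R(2)[of 0] by linarith
  have "\<forall>k. \<exists>h. bij_betw h {0..<card (J k)} (J k)" using ex_bij_betw_nat_finite[OF J] by blast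
  then obtain h where h: "\<And>k. bij_betw (h k) {0..<card (J k)} (J k)" by metis
  \<comment> \<open>Each finite level is padded with empty sets, which contribute 0, so the double
    family is indexed by all pairs.\<close>
  define U where "U = (\<lambda>(k, i). if i < card (J k) then cball (c k (h k i)) (R k) else {})"
  define f where "f u = ennreal (diameter (U u) powr s)" for u
  have "E \<subseteq> (\<Union>n. U (prod_decode n))"
  proof
    fix y assume "y \<in> E"
    then obtain k x where kx: "x \<in> J k" "y \<in> cball (c k x) (R k)" using cover by blast
    obtain i where i: "i < card (J k)" "x = h k i"
      using bij_betw_imp_surj_on[OF h[of k]] kx(1) by (metis atLeastLessThan_iff imageE)
    have "y \<in> U (prod_decode (prod_encode (k, i)))" using kx i by (simp add: U_def)
    then show "y \<in> (\<Union>n. U (prod_decode n))" by blast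
  qed
  moreover have "bounded (U u) \<and> diameter (U u) \<le> \<delta>" for u
  proof -
    obtain k i where u: "u = (k, i)" by (cases u)
    show ?thesis
    proof (cases "i < card (J k)")
      case True
      have "diameter (cball (c k (h k i)) (R k)) \<le> \<delta>"
        using diameter_cball_le[OF R(1)[of k], of "c k (h k i)"] R(2)[of k] by linarith
      then show ?thesis using True by (simp add: U_def u)
    qed (use \<delta> in \<open>simp add: U_def u\<close>)
  qed
  ultimately have "hausdorff_content \<delta> s E \<le> (\<Sum>n. f (prod_decode n))"
    unfolding hausdorff_content_def f_def by (intro INF_lower) simp
  also have "\<dots> = (\<Sum>k. \<Sum>i. f (k, i))"
    by (rule suminf_ennreal_2dimen) simp
  also have "\<dots> \<le> (\<Sum>k. ennreal (real (card (J k)) * (2 * R k) powr s))"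
  proof (intro suminf_le summableI)
    fix k
    have "(\<Sum>i. f (k, i)) = (\<Sum>i<card (J k). f (k, i))"
      by (rule suminf_finite) (use s in \<open>simp_all add: f_def U_def\<close>)
    also have "\<dots> \<le> (\<Sum>i<card (J k). ennreal ((2 * R k) powr s))"
    proof (rule sum_mono)
      fix i assume "i \<in> {..<card (J k)}"
      then have U: "U (k, i) = cball (c k (h k i)) (R k)" by (simp add: U_def)
      have "diameter (cball (c k (h k i)) (R k)) powr s \<le> (2 * R k) powr s"
        using diameter_cball_le[OF R(1)[of k], of "c k (h k i)"] s
        by (intro powr_mono2 diameter_ge_0 bounded_cball) simp_all
      then show "f (k, i) \<le> ennreal ((2 * R k) powr s)" unfolding f_def U by (rule ennreal_leI)
    qed
    also have "\<dots> = ennreal (real (card (J k)) * (2 * R k) powr s)"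
      by (simp add: ennreal_mult ennreal_of_nat_eq_real_of_nat)
    finally show "(\<Sum>i. f (k, i)) \<le> ennreal (real (card (J k)) * (2 * R k) powr s)" .
  qed
  also have "\<dots> = ennreal (\<Sum>k. real (card (J k)) * (2 * R k) powr s)"
    by (rule suminf_ennreal2[OF _ summ]) simp
  finally show ?thesis .
qed

lemma inhom_approx_set_far:
  assumes "to_torus b \<in> inhom_approx_set A \<psi>"
  obtains q where "q \<in> int_vecs" "M < infnorm q" "lattice_norm (A *v q - b) < \<psi> (infnorm q)"
proof -
  have "infinite {q \<in> int_vecs - {0}. lattice_norm (A *v q - b) < \<psi> (infnorm q)}"
    using assms unfolding to_torus_in_inhom_approx_set_iff .
  then have "\<not> {q \<in> int_vecs - {0}. lattice_norm (A *v q - b) < \<psi> (infnorm q)} \<subseteq> {q \<in> int_vecs. infnorm q \<le> M}"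
    using finite_subset finite_int_vecs_bounded by blast
  then obtain q where "q \<in> int_vecs" "lattice_norm (A *v q - b) < \<psi> (infnorm q)" "\<not> infnorm q \<le> M"
    by blast
  then show thesis using that[of q] by (simp add: not_le)
qed

lemma ex_dyadic_level:
  fixes x :: real
  assumes "1 \<le> x" obtains k :: nat where "2 ^ k \<le> x" "x < 2 ^ Suc k"
proof -
  obtain n :: nat where n: "x < 2 ^ n" using real_arch_pow[of 2 x] by auto
  define k where "k = (LEAST n. x < (2::real) ^ n)"
  have k: "x < 2 ^ k" unfolding k_def using n by (rule LeastI)
  have "k \<noteq> 0" using k assms by (intro notI) simp
  then obtain j where j: "k = Suc j" by (cases k) simp_all
  have "\<not> x < 2 ^ j" using not_less_Least[of j "\<lambda>n. x < (2::real) ^ n"] j unfolding k_def[symmetric] by simp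
  with that[of j] k j show thesis by (simp add: not_less)
qed

text \<open>For q in the dyadic shell from 2^k to 2^(k+1), monotonicity bounds the target radius by
  \<open>D k\<close>, and \<open>A *v q\<close> is within \<open>D k\<close> of a centre. Balls of
  radius \<open>2 * D k\<close> around the centres therefore cover, and the covering sum is a
  constant times a tail of the series.\<close>

lemma hausdorff_measure_approx_eq_0:
  fixes A :: "real ^ 'n ^ 'm" and \<psi> :: "real \<Rightarrow> real" and s :: real
  assumes pos: "\<And>x. 0 < x \<Longrightarrow> 0 < \<psi> x" and anti: "\<And>x y. 0 < x \<Longrightarrow> x \<le> y \<Longrightarrow> \<psi> y \<le> \<psi> x"
    and lim: "(\<lambda>k. \<psi> (2 ^ k)) \<longlonglongrightarrow> 0" and s: "0 < s"
    and summ: "summable (\<lambda>k. (2 ^ k) ^ CARD('n) * \<psi> (2 ^ k) powr s / real (card (hits A (\<psi> (2 ^ k)) (2 ^ k))))"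
  shows "hausdorff_measure s (inhom_approx_set A \<psi>) = 0"
proof -
  define D where "D k = \<psi> (2 ^ k)" for k :: nat
  have D: "0 < D k" for k unfolding D_def by (intro pos) simp
  define t where "t k = (2 ^ k) ^ CARD('n) * D k powr s / real (card (hits A (D k) (2 ^ k)))" for k
  have summ_t: "summable t" using summ unfolding t_def D_def .
  \<comment> \<open>The 4 to the n comes from packing at height 2^(k+1), the 4 to the s from the
    diameter of balls of radius \<open>2 * D k\<close>.\<close>
  define C :: real where "C = 6 ^ (CARD('m) + CARD('n)) * 4 ^ CARD('n) * 4 powr s"
  have t: "0 \<le> t k" for k unfolding t_def by simp
  have "hausdorff_content \<delta> s (inhom_approx_set A \<psi>) \<le> ennreal \<epsilon>" if \<delta>: "0 < \<delta>" and \<epsilon>: "0 < \<epsilon>" for \<delta> \<epsilon>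
  proof -
    have "\<forall>\<^sub>F k in sequentially. D k < \<delta> / 4"
      unfolding D_def by (rule order_tendstoD(2)[OF lim]) (use \<delta> in simp)
    then obtain k1 where k1: "\<And>k. k1 \<le> k \<Longrightarrow> D k < \<delta> / 4" unfolding eventually_sequentially by blast
    have "summable (\<lambda>k. C * t k)" using summ_t by (rule summable_mult)
    from suminf_exist_split[OF \<epsilon> this]
    obtain k2 where k2: "\<And>k. k2 \<le> k \<Longrightarrow> norm (\<Sum>i. C * t (i + k)) < \<epsilon>" by blast
    define l where "l = max k1 k2"
    have "\<exists>J. finite J \<and> J \<subseteq> (int_vecs :: (real ^ 'n) set) \<and>
        real (card J) * real (card (hits A (D k) (2 ^ Suc k))) \<le> 6 ^ (CARD('m) + CARD('n)) * (2 * 2 ^ Suc k) ^ CARD('n) \<and>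
        (\<forall>q. q \<in> int_vecs \<longrightarrow> infnorm q \<le> 2 ^ Suc k \<longrightarrow> (\<exists>q'\<in>J. lattice_norm (A *v q - A *v q') \<le> D k))" for k
    proof -
      have "(1::real) / 2 \<le> 2 ^ Suc k" using one_le_power[of "2::real" "Suc k"] by linarith
      from ex_cover_orbit[OF D this, of A k] show ?thesis by metis
    qed
    then obtain J where J: "\<And>k. finite (J k)"
        "\<And>k. real (card (J k)) * real (card (hits A (D k) (2 ^ Suc k))) \<le> 6 ^ (CARD('m) + CARD('n)) * (2 * 2 ^ Suc k) ^ CARD('n)"
        "\<And>k q. q \<in> int_vecs \<Longrightarrow> infnorm q \<le> 2 ^ Suc k \<Longrightarrow> \<exists>q'\<in>J k. lattice_norm (A *v q - A *v q') \<le> D k"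
      by metis
    have cardJ: "real (card (J k)) * (2 * (2 * D k)) powr s \<le> C * t k" for k
    proof -
      let ?n = "real (card (hits A (D k) (2 ^ k)))"
      have n: "0 < ?n" using card_hits_pos[of "D k" "2 ^ k" A] D[of k] by simp
      \<comment> \<open>The cover is taken at height 2^(k+1), the series counts at height 2^k; the
        larger count only helps.\<close>
      have "?n \<le> real (card (hits A (D k) (2 ^ Suc k)))" by (intro of_nat_mono card_hits_mono) simp_all
      then have "real (card (J k)) * ?n \<le> real (card (J k)) * real (card (hits A (D k) (2 ^ Suc k)))"
        by (rule mult_left_mono) simp
      also have "\<dots> \<le> 6 ^ (CARD('m) + CARD('n)) * (2 * 2 ^ Suc k) ^ CARD('n)" by (rule J(2))
      also have "(2 * 2 ^ Suc k :: real) = 4 * 2 ^ k" by simp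
      also have "(4 * 2 ^ k :: real) ^ CARD('n) = 4 ^ CARD('n) * (2 ^ k) ^ CARD('n)" by (rule power_mult_distrib)
      finally have "real (card (J k)) \<le> 6 ^ (CARD('m) + CARD('n)) * (4 ^ CARD('n) * (2 ^ k) ^ CARD('n)) / ?n"
        by (simp only: pos_le_divide_eq[OF n])
      then have "real (card (J k)) * (4 powr s * D k powr s)
          \<le> 6 ^ (CARD('m) + CARD('n)) * (4 ^ CARD('n) * (2 ^ k) ^ CARD('n)) / ?n * (4 powr s * D k powr s)"
        by (rule mult_right_mono) simp
      also have "\<dots> = C * t k" unfolding C_def t_def by simp
      also have "4 powr s * D k powr s = (4 * D k) powr s" by (rule powr_mult[symmetric])
      also have "4 * D k = 2 * (2 * D k)" by simp
      finally show ?thesis .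
    qed
    have summ_l: "summable (\<lambda>k. C * t (k + l))"
      using summ_t by (intro summable_mult summable_ignore_initial_segment)
    have summ_J: "summable (\<lambda>k. real (card (J (k + l))) * (2 * (2 * D (k + l))) powr s)"
      using cardJ by (intro summable_comparison_test[OF _ summ_l]) simp
    have cover: "inhom_approx_set A \<psi> \<subseteq> (\<Union>k. \<Union>q\<in>J (k + l). cball (to_torus (A *v q)) (2 * D (k + l)))"
    proof
      fix y assume y: "y \<in> inhom_approx_set A \<psi>"
      obtain b where b: "y = to_torus b" by (rule torus_cases)
      obtain q where q: "q \<in> int_vecs" "2 ^ l < infnorm q" "lattice_norm (A *v q - b) < \<psi> (infnorm q)"
        using inhom_approx_set_far[OF y[unfolded b]] by blast
      have "1 \<le> infnorm q" using q(2) one_le_power[of "2::real" l] by linarith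
      then obtain k where k: "2 ^ k \<le> infnorm q" "infnorm q < 2 ^ Suc k" by (rule ex_dyadic_level)
      \<comment> \<open>Norm above 2^l places q in a shell of index at least l, so only the tail of
        the cover is used.\<close>
      have "(2::real) ^ l < 2 ^ Suc k" using q(2) k(2) by linarith
      then have "l < Suc k" by (rule power_less_imp_less_exp[rotated]) simp
      then have "l \<le> k" by simp
      then obtain i where i: "k = i + l" using le_Suc_ex add.commute by metis
      obtain q' where q': "q' \<in> J k" "lattice_norm (A *v q - A *v q') \<le> D k"
        using J(3)[OF q(1), of k] k(2) by auto
      have "\<psi> (infnorm q) \<le> D k" unfolding D_def by (rule anti[OF _ k(1)]) simp
      then have "lattice_norm (A *v q' - b) \<le> 2 * D k"
        using lattice_norm_diff_triangle[of "A *v q'" b "A *v q"] lattice_norm_minus_commute[of "A *v q'" "A *v q"] q(3) q'(2)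
        by linarith
      then have "y \<in> cball (to_torus (A *v q')) (2 * D (i + l))" unfolding b mem_cball dist_to_torus i .
      with q'(1) show "y \<in> (\<Union>k. \<Union>q\<in>J (k + l). cball (to_torus (A *v q)) (2 * D (k + l)))"
        unfolding i by blast
    qed
    have "hausdorff_content \<delta> s (inhom_approx_set A \<psi>) \<le> ennreal (\<Sum>k. real (card (J (k + l))) * (2 * (2 * D (k + l))) powr s)"
    proof (rule hausdorff_content_le_sum[OF cover J(1) _ _ s summ_J])
      show "0 \<le> 2 * D (k + l)" for k using D[of "k + l"] by simp
      show "2 * (2 * D (k + l)) \<le> \<delta>" for k
      proof -
        have "k1 \<le> k + l" unfolding l_def by simp
        from k1[OF this] show ?thesis by simp
      qed
    qed
    also have "\<dots> \<le> ennreal \<epsilon>"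
    proof (rule ennreal_leI)
      have "(\<Sum>k. real (card (J (k + l))) * (2 * (2 * D (k + l))) powr s) \<le> (\<Sum>k. C * t (k + l))"
        by (rule suminf_le[OF cardJ summ_J summ_l])
      also have "\<dots> \<le> \<epsilon>" using k2[of l] unfolding l_def by simp
      finally show "(\<Sum>k. real (card (J (k + l))) * (2 * (2 * D (k + l))) powr s) \<le> \<epsilon>" .
    qed
    finally show ?thesis .
  qed
  then have zero: "hausdorff_content \<delta> s (inhom_approx_set A \<psi>) = 0" if "0 < \<delta>" for \<delta>
    using that ennreal_le_epsilon[of 0 "hausdorff_content \<delta> s (inhom_approx_set A \<psi>)"] by simp
  show ?thesis
    unfolding hausdorff_measure_def using zero by (auto intro!: SUP_eq_const simp: SUP_eq_iff)
qed

theorem corollary3p1: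
  fixes A :: "real ^ 'n ^ 'm" and \<psi> :: "real \<Rightarrow> real" and s :: real
  assumes "\<And>x. 0 < x \<Longrightarrow> 0 < \<psi> x"
    and "antimono_on {0<..} \<psi>"
    and "dyadically_regular \<psi>"
    and "0 < s" and "s < CARD('m)"
  shows "(summable (\<lambda>k. 2 ^ (k * CARD('n)) * \<psi> (2 ^ k) powr s
             / real (lattice_count A (\<psi> (2 ^ k)) (2 ^ k)))
           \<longrightarrow> hausdorff_measure s (inhom_approx_set A \<psi>) = 0) \<and>
         (\<not> summable (\<lambda>k. 2 ^ (k * CARD('n)) * \<psi> (2 ^ k) powr s
             / real (lattice_count A (\<psi> (2 ^ k) powr (s / CARD('m))) (2 ^ k)))
           \<longrightarrow> hausdorff_measure s (inhom_approx_set A \<psi>) = \<infinity>)"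
proof -
  obtain \<rho> k0 where \<rho>: "0 < \<rho>" "\<rho> < 1" and reg: "\<forall>k\<ge>k0. \<psi> (2 ^ (k + 1)) \<le> \<rho> * \<psi> (2 ^ k)"
    using assms(3) unfolding dyadically_regular_def Bex_def greaterThanLessThan_iff by blast
  have anti: "\<psi> y \<le> \<psi> x" if "0 < x" "x \<le> y" for x y
    using assms(2) that unfolding monotone_on_def by simp
  define D where "D k = \<psi> (2 ^ k)" for k :: nat
  have D: "0 < D k" for k unfolding D_def by (intro assms(1)) simp
  have step: "D (Suc k) \<le> \<rho> * D k" if "k0 \<le> k" for k
    using reg that unfolding D_def Suc_eq_plus1 by blast
  have decay: "D (i + k0) \<le> \<rho> ^ i * D k0" for i
  proof (induction i)
    case (Suc i)
    have "D (Suc i + k0) \<le> \<rho> * D (i + k0)"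
      unfolding add_Suc by (rule step) simp
    also have "\<dots> \<le> \<rho> * (\<rho> ^ i * D k0)" using Suc less_imp_le[OF \<rho>(1)] by (rule mult_left_mono)
    finally show ?case by (simp only: power_Suc mult.assoc)
  qed simp
  have "(\<lambda>i. \<rho> ^ i) \<longlonglongrightarrow> 0"
    using \<rho> by (intro LIMSEQ_realpow_zero) simp_all
  then have geom: "(\<lambda>i. \<rho> ^ i * D k0) \<longlonglongrightarrow> 0" by (rule tendsto_mult_left_zero)
  have "(\<lambda>i. D (i + k0)) \<longlonglongrightarrow> 0"
  proof (rule tendsto_sandwich[OF _ _ tendsto_const geom])
    show "\<forall>\<^sub>F i in sequentially. 0 \<le> D (i + k0)"
      by (intro always_eventually allI less_imp_le D)
    show "\<forall>\<^sub>F i in sequentially. D (i + k0) \<le> \<rho> ^ i * D k0"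
      by (intro always_eventually allI decay)
  qed
  then have lim: "D \<longlonglongrightarrow> 0" by (rule LIMSEQ_offset[of D k0])
  let ?\<theta> = "s / CARD('m)"
  have "((\<lambda>k. D k powr ?\<theta>) \<longlonglongrightarrow> 0)"
  proof (rule tendsto_zero_powrI[OF lim tendsto_const])
    show "\<forall>\<^sub>F k in sequentially. 0 \<le> D k"
      by (intro always_eventually allI less_imp_le D)
    show "0 < ?\<theta>" using assms(4) by simp
  qed
  then have ev: "\<forall>\<^sub>F k in sequentially. D k powr ?\<theta> < 1 / 2" by (rule order_tendstoD(2)) simp
  then obtain k1 where k1: "\<And>k. k1 \<le> k \<Longrightarrow> D k powr ?\<theta> < 1 / 2" unfolding eventually_sequentially by blast
  \<comment> \<open>Regularity holds from \<open>k0\<close> on, and the radii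
    \<open>D k powr (s / CARD('m))\<close> are at most 1/2 from \<open>k1\<close> on.\<close>
  interpret dyadic_scales A D s \<rho> "max k0 k1"
  proof
    show "D k powr ?\<theta> \<le> 1 / 2" if "max k0 k1 \<le> k" for k
      using k1[of k] that by simp
    show "D (Suc k) \<le> \<rho> * D k" if "max k0 k1 \<le> k" for k
      using step[of k] that by simp
  qed (fact D \<rho> assms(4,5))+
  \<comment> \<open>The stated series and the ones used above agree only once the radii drop below
    1/2, where \<open>lattice_count\<close> counts hits; changing finitely many terms does not
    affect summability.\<close>
  have conv: "hausdorff_measure s (inhom_approx_set A \<psi>) = 0"
    if "summable (\<lambda>k. 2 ^ (k * CARD('n)) * \<psi> (2 ^ k) powr s / real (lattice_count A (\<psi> (2 ^ k)) (2 ^ k)))"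
  proof (rule hausdorff_measure_approx_eq_0[OF assms(1) anti lim[unfolded D_def] assms(4)])
    have "\<forall>\<^sub>F k in sequentially. D k < 1 / 2" by (rule order_tendstoD(2)[OF lim]) simp
    then have "\<forall>\<^sub>F k in sequentially. 2 ^ (k * CARD('n)) * \<psi> (2 ^ k) powr s / real (lattice_count A (\<psi> (2 ^ k)) (2 ^ k))
        = (2 ^ k) ^ CARD('n) * \<psi> (2 ^ k) powr s / real (card (hits A (\<psi> (2 ^ k)) (2 ^ k)))"
      by eventually_elim (simp add: D_def lattice_count_eq_card_hits power_mult)
    from summable_cong[OF this] that
    show "summable (\<lambda>k. (2 ^ k) ^ CARD('n) * \<psi> (2 ^ k) powr s / real (card (hits A (\<psi> (2 ^ k)) (2 ^ k))))" by simp
  qed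
  have div: "hausdorff_measure s (inhom_approx_set A \<psi>) = \<infinity>"
    if "\<not> summable (\<lambda>k. 2 ^ (k * CARD('n)) * \<psi> (2 ^ k) powr s / real (lattice_count A (\<psi> (2 ^ k) powr ?\<theta>) (2 ^ k)))"
  proof (rule hausdorff_measure_approx_eq_infinity)
    from ev have "\<forall>\<^sub>F k in sequentially. 2 ^ (k * CARD('n)) * \<psi> (2 ^ k) powr s / real (lattice_count A (\<psi> (2 ^ k) powr ?\<theta>) (2 ^ k)) = a k"
      by eventually_elim (simp add: D_def lattice_count_eq_card_hits power_mult a_def \<beta>_def N_def F_def \<theta>_def)
    from summable_cong[OF this] that show "\<not> summable a" by simp
    show "D k \<le> \<psi> x" if "0 < x" "x \<le> 2 ^ k" for k x
      unfolding D_def using that by (rule anti)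
  qed
  from conv div show ?thesis by blast
qed

end
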